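(* The $\star$-dual of the Ammann-Beenker tiling is mutually locally derivable with the Ammann-Beenker tiling.
   Context: Identify $\mathbb{R}^2$ with $\mathbb{C}$; let $\xi=e^{2\pi i/8}$ and $\lambda=1+\sqrt2=1+\xi+\xi^{-1}$. Substitutions as function systems. A tile-substitution with factor $\lambda$ inflates each tile by $\lambda$ and dissects the result into isometric copies of the prototiles. Equivalently it is given by a function system $X_j=\bigcup_i\bigcup_{f\in F_{ij}}f(X_i)$, whose maps are isometries composed with the contraction $\lambda^{-1}$, whose unique solution by nonempty compact sets $X_j$ gives the prototiles, and in which the pieces of each union have pairwise disjoint interiors. A tiling is a substitution tiling for it if each of its finite subsets is a translate of a subset of some iterate of the substitution applied to some prototile. Only the way each prototile is dissected matters: where the prototiles are located in the plane and a common scaling of the prototiles are regarded as irrelevant. Ammann-Beenker tiling. The prototiles are a rhombus $L$ with angles $45^\circ$ and $135^\circ$ and an isosceles right triangle $S$ whose legs have the length of the sides of $L$. The substitution is given by $$L=f_1(L)\cup f_2(L)\cup f_3(L)\cup f_6(S)\cup f_7(S)\cup f_8(S)\cup f_9(S),\qquad S=f_4(L)\cup f_5(L)\cup f_{10}(S)\cup f_{11}(S)\cup f_{12}(S),$$ $$\begin{aligned} f_1(x)&=\lambda^{-1}\xi^4x+1+\xi, & f_7(x)&=\lambda^{-1}\xi^3x+1+2\xi+\xi^2+\xi^7,\\ f_2(x)&=\lambda^{-1}\xi\,\overline{x}+1+\xi+\xi^2+\xi^7, & f_8(x)&=\lambda^{-1}\xi^6\,\overline{x}+2+\xi+\xi^2+\xi^7,\\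 f_3(x)&=\lambda^{-1}\xi^7\,\overline{x}+1+\xi+\xi^2, & f_9(x)&=\lambda^{-1}\xi^7x+1,\\ f_4(x)&=\lambda^{-1}x+\xi+\xi^2, & f_{10}(x)&=\lambda^{-1}\xi^5x+\xi+\xi^3,\\ f_5(x)&=\lambda^{-1}\xi^2x+\xi, & f_{11}(x)&=\lambda^{-1}\xi^6\,\overline{x}+1+\xi+\xi^2,\\ f_6(x)&=\lambda^{-1}\xi^2\,\overline{x}+\xi, & f_{12}(x)&=\lambda^{-1}\xi^3x+2\xi+\xi^2. \end{aligned}$$ $\star$-dual. For $f$ of the form $x\mapsto\alpha x+\beta$ or $x\mapsto\alpha\overline{x}+\beta$ with $\alpha,\beta\in\mathbb{Q}(\xi)$, $\alpha\ne0$, let $f^\sharp$ be the map obtained from $f^{-1}$ by replacing each $\xi$ in its coefficients by the Galois conjugate $\xi^3$. The $\star$-dual of the Ammann-Beenker tiling is the substitution tiling defined by the $\star$-dual system $$L^\star=f_1^\sharp(L^\star)\cup f_2^\sharp(L^\star)\cup f_3^\sharp(L^\star)\cup f_4^\sharp(S^\star)\cup f_5^\sharp(S^\star),$$ $$S^\star=f_6^\sharp(L^\star)\cup f_7^\sharp(L^\star)\cup f_8^\sharp(L^\star)\cup f_9^\sharp(L^\star)\cup f_{10}^\sharp(S^\star)\cup f_{11}^\sharp(S^\star)\cup f_{12}^\sharp(S^\star).$$ Mutually locally derivable means that each of the two tilings can be obtained from the other by local replacement rules. *)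

theory Defs
  imports "HOL-Analysis.Analysis"
begin

text \<open>The plane is identified with the complex numbers.\<close>

definition xi :: complex where
  "xi = exp (2 * of_real pi * \<i> / 8)"

definition lam :: real where
  "lam = 1 + sqrt 2"

text \<open>A similarity is kept as its coefficient data, since the star-dual acts on coefficients:
  \<open>Dir a b\<close> stands for \<open>x \<mapsto> a x + b\<close>, and \<open>Opp a b\<close> for \<open>x \<mapsto> a \<cdot> cnj x + b\<close>.\<close>

datatype simil = Dir complex complex | Opp complex complex

fun app :: "simil \<Rightarrow> complex \<Rightarrow> complex" where
  "app (Dir a b) x = a * x + b"
| "app (Opp a b) x = a * cnj x + b"

fun simil_inv :: "simil \<Rightarrow> simil" where
  "simil_inv (Dir a b) = Dir (1 / a) (- b / a)"
| "simil_inv (Opp a b) = Opp (1 / cnj a) (- cnj (b / a))"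

lemma app_simil_inv:
  "a \<noteq> 0 \<Longrightarrow> app (simil_inv (Dir a b)) (app (Dir a b) x) = x"
  "a \<noteq> 0 \<Longrightarrow> app (simil_inv (Opp a b)) (app (Opp a b) x) = x"
  by (simp_all add: field_simps)

text \<open>The Galois automorphism of the field of rational expressions in \<open>xi\<close> that sends \<open>xi\<close> to
  \<open>xi ^ 3\<close>. The powers \<open>xi ^ k\<close> with \<open>k < 4\<close> form a basis of this field over the rationals,
  so the described element exists and is unique; outside the field the value is unspecified.\<close>

definition galois :: "complex \<Rightarrow> complex" where
  "galois z = (THE w. \<exists>q :: nat \<Rightarrow> rat.
     z = (\<Sum>k<4. of_rat (q k) * xi ^ k) \<and> w = (\<Sum>k<4. of_rat (q k) * (xi ^ 3) ^ k))"

fun galois_simil :: "simil \<Rightarrow> simil" where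
  "galois_simil (Dir a b) = Dir (galois a) (galois b)"
| "galois_simil (Opp a b) = Opp (galois a) (galois b)"

definition sharp :: "simil \<Rightarrow> simil" where
  "sharp f = galois_simil (simil_inv f)"

text \<open>Indices of the two prototiles. A function system assigns to \<open>j\<close> the set of all \<open>(i, f)\<close>
  for which \<open>f(X i)\<close> is a piece of \<open>X j\<close>.\<close>

datatype proto = Rhomb | Tri

type_synonym fsystem = "proto \<Rightarrow> (proto \<times> simil) set"

definition prototile :: "fsystem \<Rightarrow> proto \<Rightarrow> complex set" where
  "prototile F = (THE X. \<forall>j. compact (X j) \<and> X j \<noteq> {} \<and> X j = (\<Union>(i, f)\<in>F j. app f ` X i))"

text \<open>The pieces of the prototile \<open>j\<close> after \<open>n\<close> dissections, without inflation.\<close>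

primrec dissection :: "fsystem \<Rightarrow> nat \<Rightarrow> proto \<Rightarrow> complex set set" where
  "dissection F 0 j = {prototile F j}"
| "dissection F (Suc n) j = (\<Union>(i, f)\<in>F j. (\<lambda>t. app f ` t) ` dissection F n i)"

definition scale_tiles :: "real \<Rightarrow> complex set set \<Rightarrow> complex set set" where
  "scale_tiles c T = (\<lambda>t. (*\<^sub>R) c ` t) ` T"

definition translate_tiles :: "complex \<Rightarrow> complex set set \<Rightarrow> complex set set" where
  "translate_tiles v T = (\<lambda>t. (+) v ` t) ` T"

text \<open>The \<open>n\<close>-th iterate of the substitution, with inflation factor \<open>lam\<close>, applied to a
  prototile.\<close>

definition subst_iterate :: "fsystem \<Rightarrow> nat \<Rightarrow> proto \<Rightarrow> complex set set" where
  "subst_iterate F n j = scale_tiles (lam ^ n) (dissection F n j)"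

definition tiling :: "complex set set \<Rightarrow> bool" where
  "tiling T \<longleftrightarrow> \<Union>T = UNIV \<and> pairwise (\<lambda>s t. interior s \<inter> interior t = {}) T"

definition substitution_tilings :: "fsystem \<Rightarrow> complex set set set" where
  "substitution_tilings F = {T. tiling T \<and>
     (\<forall>P. P \<subseteq> T \<and> finite P \<longrightarrow> (\<exists>v n j. \<exists>Q \<subseteq> subst_iterate F n j. P = translate_tiles v Q))}"

definition ammann_beenker :: fsystem where
  "ammann_beenker j = (case j of
     Rhomb \<Rightarrow>
      {(Rhomb, Dir (xi ^ 4 / of_real lam) (1 + xi)),
       (Rhomb, Opp (xi / of_real lam) (1 + xi + xi ^ 2 + xi ^ 7)),
       (Rhomb, Opp (xi ^ 7 / of_real lam) (1 + xi + xi ^ 2)),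
       (Tri, Opp (xi ^ 2 / of_real lam) xi),
       (Tri, Dir (xi ^ 3 / of_real lam) (1 + 2 * xi + xi ^ 2 + xi ^ 7)),
       (Tri, Opp (xi ^ 6 / of_real lam) (2 + xi + xi ^ 2 + xi ^ 7)),
       (Tri, Dir (xi ^ 7 / of_real lam) 1)}
   | Tri \<Rightarrow>
      {(Rhomb, Dir (1 / of_real lam) (xi + xi ^ 2)),
       (Rhomb, Dir (xi ^ 2 / of_real lam) xi),
       (Tri, Dir (xi ^ 5 / of_real lam) (xi + xi ^ 3)),
       (Tri, Opp (xi ^ 6 / of_real lam) (1 + xi + xi ^ 2)),
       (Tri, Dir (xi ^ 3 / of_real lam) (2 * xi + xi ^ 2))})"

definition star_dual :: "fsystem \<Rightarrow> fsystem" where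
  "star_dual F j = {(i, sharp f) | i f. (j, f) \<in> F i}"

text \<open>The tiles of \<open>T\<close> that meet the closed disc of radius \<open>r\<close> around \<open>x\<close>, seen from \<open>x\<close>.
  For \<open>r = 0\<close> these are the tiles containing \<open>x\<close>.\<close>

definition patch :: "complex set set \<Rightarrow> real \<Rightarrow> complex \<Rightarrow> complex set set" where
  "patch T r x = translate_tiles (- x) {t \<in> T. t \<inter> cball x r \<noteq> {}}"

text \<open>\<open>\<Phi>\<close> is given on the class \<open>A\<close> by one local replacement rule: for some radius \<open>r\<close>, the tiles
  of \<open>\<Phi> T\<close> at a point depend, up to translation, only on the \<open>r\<close>-patch of \<open>T\<close> around that point.\<close>

definition local_rule ::
  "complex set set set \<Rightarrow> (complex set set \<Rightarrow> complex set set) \<Rightarrow> bool" where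
  "local_rule A \<Phi> \<longleftrightarrow> (\<exists>r>0. \<forall>T\<in>A. \<forall>T'\<in>A. \<forall>x y.
     patch T r x = patch T' r y \<longrightarrow> patch (\<Phi> T) 0 x = patch (\<Phi> T') 0 y)"

text \<open>Mutual local derivability of two classes of tilings: mutually inverse maps, each given by a
  local rule. In particular \<open>T\<close> and \<open>\<Phi> T\<close> are mutually locally derivable for every \<open>T\<close> in \<open>A\<close>,
  and each tiling in \<open>B\<close> is of the form \<open>\<Phi> T\<close>.\<close>

definition mutually_locally_derivable ::
  "complex set set set \<Rightarrow> complex set set set \<Rightarrow> bool" where
  "mutually_locally_derivable A B \<longleftrightarrow>
     (\<exists>\<Phi>. bij_betw \<Phi> A B \<and> local_rule A \<Phi> \<and> local_rule B (inv_into A \<Phi>))"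

end

theory Submission
  imports Defs
begin

text \<open>After scaling by \<open>lam\<^sup>2\<close> the two dual prototiles are the quarter of the Ammann-Beenker rhomb
  (cut along its diagonals) and the quarter of the square made of two triangles \<open>S\<close>, so that a
  rhomb is four and a triangle two dual tiles. This cutting intertwines the two substitutions exactly.
  Conversely four rhomb quarters determine their rhomb, but the four quarters of a square can be
  paired along either diagonal. Orient every edge of a rhomb from the acute to the obtuse angle. In a
  patch of the substitution the triangle with right angle \<open>V\<close> and oriented legs \<open>Q \<rightarrow> V \<rightarrow> P\<close> always has
  a rhomb behind its leg \<open>V P\<close>, oriented like the leg, and the mirrored triangle behind its hypotenuse,
  unless these edges lie on the boundary of the patch. So \<open>P\<close> is the only corner of the square at which
  both edges border rhombs and point towards \<open>P\<close>, and the diagonal \<open>P Q\<close> is determined locally.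

  All facts about finitely many positions are computed on coordinates in \<open>\<int>[xi] / 4\<close>.\<close>

section \<open>Arithmetic in the cyclotomic field\<close>

text \<open>The dual keeps the inflation factor because the conjugation sends
  \<open>lam = 1 + sqrt 2\<close> to \<open>1 - sqrt 2 = - 1 / lam\<close>: inverting a contraction
  by \<open>1 / lam\<close> and conjugating gives a contraction by \<open>1 / lam\<close> again.

  Two obstacles shape the proof. Tiles are bare sets, so a triangle does not show which of its acute
  corners is \<open>P\<close>; placements are therefore carried along with tiles, and only the
  rhombs behind the legs can reveal the right one. Moreover, legality speaks about finite patches
  only, each contained in a translated iterate that depends on the patch and may end right next to
  the tile in question, where those rhombs are missing.

  Both are met by one sample point inside each required dual tile. Tiles covering the sample points
  are put into the finite patch in advance. Since the point for a rhomb lies beyond the edge to be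
  crossed, an iterate covering it does not end at that edge, so the rhomb is present. The point also
  lies on the perpendicular bisector of the rhomb side, so a rhomb quarter of opposite orientation
  behind that side would contain it too, and packing excludes the wrong diagonal.\<close>

lemma xi_cis: "xi = cis (pi / 4)"
  by (simp add: xi_def cis_conv_exp field_simps)

lemma xi_Complex: "xi = Complex (sqrt 2 / 2) (sqrt 2 / 2)"
  by (simp add: xi_cis complex_eq_iff cos_45 sin_45)

lemma xi_nonzero [simp]: "xi \<noteq> 0"
  by (simp add: xi_cis)

lemma norm_xi [simp]: "norm xi = 1"
  by (simp add: xi_cis)

lemma xi_power2: "xi ^ 2 = \<i>"
  by (simp add: xi_Complex complex_eq_iff power2_eq_square)

lemma xi_power3: "xi ^ 3 = \<i> * xi"
  by (simp add: power3_eq_cube power2_eq_square[symmetric] xi_power2 flip: mult.assoc)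

lemma xi_power4: "xi ^ 4 = - 1"
proof -
  have "xi ^ 4 = (xi ^ 2) ^ 2" by simp
  then show ?thesis by (simp only: xi_power2) simp
qed

lemma xi_times_xi: "xi * xi = \<i>"
  using xi_power2 by (simp add: power2_eq_square)

lemma cnj_xi: "cnj xi = - \<i> * xi"
  by (simp add: xi_Complex complex_eq_iff)

lemma lam_xi: "of_real lam = 1 + xi - \<i> * xi"
  by (simp add: lam_def xi_Complex complex_eq_iff field_simps)

lemma lam_pos [simp]: "lam > 0"
  by (simp add: lam_def add_pos_nonneg)

lemma lam_nonzero [simp]: "lam \<noteq> 0"
  using lam_pos by linarith

lemma lam_gt_1: "lam > 1"
  by (simp add: lam_def)

text \<open>\<open>Zx a b c d\<close> are the coordinates of a point in a quarter of the ring of integers; this makes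
  the vertices, their midpoints and one interior point of each dual tile integral.\<close>

datatype zx = Zx int int int int

fun den :: "zx \<Rightarrow> complex" where
  "den (Zx a b c d) = (of_int a + of_int b * xi + of_int c * xi ^ 2 + of_int d * xi ^ 3) / 4"

fun zadd :: "zx \<Rightarrow> zx \<Rightarrow> zx" where
  "zadd (Zx a b c d) (Zx a' b' c' d') = (Zx (a + a') (b + b') (c + c') (d + d'))"

fun zneg :: "zx \<Rightarrow> zx" where
  "zneg (Zx a b c d) = (Zx (- a) (- b) (- c) (- d))"

fun zcnj :: "zx \<Rightarrow> zx" where
  "zcnj (Zx a b c d) = (Zx a (- d) (- c) (- b))"

text \<open>Multiplication by \<open>lam = 1 + xi - xi ^ 3\<close>, reduced with
  \<open>xi ^ 4 = - 1\<close>.\<close>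

fun zlam :: "zx \<Rightarrow> zx" where
  "zlam (Zx a b c d) = (Zx (a + b - d) (a + b + c) (b + c + d) (c + d - a))"

fun zrot4 :: "int \<Rightarrow> zx \<Rightarrow> zx" where
  "zrot4 j (Zx a b c d) =
    (if j = 0 then (Zx a b c d) else if j = 1 then (Zx (- d) a b c)
     else if j = 2 then (Zx (- c) (- d) a b) else (Zx (- b) (- c) (- d) a))"

text \<open>Multiplication by \<open>xi powi k\<close>: a cyclic shift of the coordinates, with a
  sign for every wrap because \<open>xi ^ 4 = - 1\<close>.\<close>

definition zrot :: "int \<Rightarrow> zx \<Rightarrow> zx" where
  "zrot k z = (let j = k mod 8 in if j < 4 then zrot4 j z else zneg (zrot4 (j - 4) z))"

lemma den_alt: "den (Zx a b c d) = (of_int a + of_int b * xi + of_int c * \<i> + of_int d * (\<i> * xi)) / 4"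
  by (simp add: xi_power2 xi_power3)

lemma den_zadd: "den (zadd z w) = den z + den w"
  by (cases z; cases w) (simp add: field_simps)

lemma den_zneg: "den (zneg z) = - den z"
  by (cases z) (simp add: field_simps)

lemma den_zcnj: "den (zcnj z) = cnj (den z)"
proof -
  have "cnj (\<i> * xi) = - xi" by (simp add: cnj_xi)
  then show ?thesis
    by (cases z) (simp add: den_alt cnj_xi del: den.simps complex_cnj_mult, simp add: algebra_simps cnj_xi)
qed

lemma den_zrot1: "den (Zx (- d) a b c) = xi * den (Zx a b c d)"
proof -
  have "xi * (x + y * xi + z * \<i> + w * (\<i> * xi)) = x * xi + y * (xi * xi) + z * (\<i> * xi) + w * (\<i> * (xi * xi))" for x y z w
    by (simp add: algebra_simps)
  then show ?thesis
    by (simp only: den_alt times_divide_eq_right xi_times_xi) (simp add: algebra_simps)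
qed

lemma den_zlam: "den (zlam z) = of_real lam * den z"
proof -
  obtain a b c d where z: "z = (Zx a b c d)" by (cases z)
  have "of_real lam * den z = den z + xi * den z - xi * (xi * (xi * den z))"
    by (simp add: lam_xi algebra_simps) (simp add: xi_times_xi flip: mult.assoc)
  also have "\<dots> = den (Zx a b c d) + den (Zx (- d) a b c) - den (Zx (- b) (- c) (- d) a)"
    by (simp only: z flip: den_zrot1)
  also have "\<dots> = den (zlam z)"
    unfolding z by (simp add: field_simps)
  finally show ?thesis ..
qed

lemma den_zrot4: "j \<in> {0..3} \<Longrightarrow> den (zrot4 j z) = xi ^ nat j * den z"
proof -
  assume "j \<in> {0..3}"
  then consider "j = 0" | "j = 1" | "j = 2" | "j = 3" by fastforce
  then show ?thesis
  proof cases
    case 3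
    show ?thesis
      by (cases z) (simp add: 3 power2_eq_square mult.assoc del: den.simps flip: den_zrot1)
  next
    case 4
    show ?thesis
      by (cases z) (simp add: 4 power3_eq_cube mult.assoc del: den.simps flip: den_zrot1)
  qed (cases z; simp del: den.simps flip: den_zrot1)+
qed

lemma xi_power_int_8: "xi powi 8 = 1"
proof -
  have "xi powi 8 = (xi ^ 4) ^ 2" by (simp flip: power_mult)
  then show ?thesis by (simp add: xi_power4)
qed

lemma xi_power_int_mod: "xi powi (k mod 8) = xi powi k"
proof -
  have "xi powi k = xi powi (8 * (k div 8) + k mod 8)" by simp
  also have "\<dots> = (xi powi 8) powi (k div 8) * xi powi (k mod 8)"
    by (simp only: power_int_add power_int_mult xi_nonzero simp_thms)
  also have "\<dots> = xi powi (k mod 8)"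
    by (simp only: xi_power_int_8 power_int_1_left mult_1_left)
  finally show ?thesis ..
qed

lemma den_zrot: "den (zrot k z) = xi powi k * den z"
proof -
  define j where "j = k mod 8"
  have j: "0 \<le> j" "j < 8" by (auto simp: j_def)
  have powi: "xi ^ nat j = xi powi k"
    using j by (subst xi_power_int_mod[symmetric]) (simp add: power_int_def flip: j_def)
  show ?thesis
  proof (cases "j < 4")
    case True
    then have "den (zrot k z) = xi ^ nat j * den z"
      using j by (simp add: zrot_def Let_def den_zrot4 flip: j_def)
    also have "xi ^ nat j = xi powi k" by (rule powi)
    finally show ?thesis .
  next
    case False
    then have "den (zrot k z) = - (xi ^ nat (j - 4) * den z)"
      using j by (simp add: zrot_def Let_def den_zrot4 den_zneg flip: j_def)
    also have "- (xi ^ nat (j - 4) * den z) = (- (xi ^ nat (j - 4))) * den z" by simp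
    also have "- (xi ^ nat (j - 4)) = xi ^ 4 * xi ^ nat (j - 4)" by (simp add: xi_power4)
    also have "\<dots> = xi ^ nat j" using j False by (simp add: nat_diff_distrib flip: power_add)
    also have "\<dots> = xi powi k" by (rule powi)
    finally show ?thesis by (simp add: algebra_simps)
  qed
qed

text \<open>\<open>Mot k r z\<close> stands for the isometry \<open>x \<mapsto> xi\<^sup>k x + den z\<close>, or
  \<open>x \<mapsto> xi\<^sup>k cnj x + den z\<close> if \<open>r\<close>.\<close>

datatype motion = Mot (mturn: int) (mflip: bool) (mshift: zx)

fun mact :: "motion \<Rightarrow> complex \<Rightarrow> complex" where
  "mact (Mot k r z) x = xi powi k * (if r then cnj x else x) + den z"

fun zact :: "motion \<Rightarrow> zx \<Rightarrow> zx" where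
  "zact (Mot k r z) w = zadd (zrot k (if r then zcnj w else w)) z"

text \<open>After a reflection the turn is subtracted, as \<open>cnj xi\<close> is the inverse of
  \<open>xi\<close>. Reduction mod 8 gives normal forms, so that the finite checks can compare
  motions by plain equality.\<close>

fun mcomp :: "motion \<Rightarrow> motion \<Rightarrow> motion" where
  "mcomp (Mot k r z) (Mot k' r' z') =
    Mot ((if r then k - k' else k + k') mod 8) (r \<noteq> r') (zact (Mot k r z) z')"

text \<open>Conjugation by the scaling with \<open>lam\<close>: the linear part stays and only the
  shift is stretched.\<close>

fun minfl :: "motion \<Rightarrow> motion" where
  "minfl (Mot k r z) = Mot k r (zlam z)"

fun minv :: "motion \<Rightarrow> motion" where
  "minv (Mot k r z) = 
    (if r then Mot k True (zneg (zrot k (zcnj z))) else Mot (- k mod 8) False (zneg (zrot (- k) z)))"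

lemma den_zact: "den (zact g w) = mact g (den w)"
  by (cases g) (simp add: den_zadd den_zrot den_zcnj)

lemma cnj_xi_inverse: "cnj xi = inverse xi"
  by (simp add: xi_cis cis_cnj cis_inverse)

lemma cnj_xi_powi': "cnj xi powi k = inverse (xi powi k)"
  by (simp add: cnj_xi_inverse power_int_inverse)

lemma mact_mcomp: "mact (mcomp g h) = mact g \<circ> mact h"
proof
  fix x
  obtain k r z where g: "g = (Mot k r z)" by (cases g)
  obtain k' r' z' where h: "h = (Mot k' r' z')" by (cases h)
  show "mact (mcomp g h) x = (mact g \<circ> mact h) x"
    by (simp add: g h den_zadd den_zrot den_zcnj xi_power_int_mod power_int_add power_int_diff
        cnj_xi_powi' power_int_minus divide_inverse algebra_simps)
qed

lemma mact_minv: "mact (minv g) \<circ> mact g = id" "mact g \<circ> mact (minv g) = id"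
proof -
  obtain k r z where g: "g = (Mot k r z)" by (cases g)
  have [simp]: "xi powi k \<noteq> 0" by simp
  show "mact (minv g) \<circ> mact g = id" "mact g \<circ> mact (minv g) = id"
    by (auto simp add: fun_eq_iff g den_zneg den_zrot den_zcnj xi_power_int_mod power_int_minus cnj_xi_powi' algebra_simps)
qed

lemma mact_minfl: "mact (minfl g) (of_real lam * x) = of_real lam * mact g x"
proof -
  obtain k r z where "g = (Mot k r z)" by (cases g)
  then show ?thesis by (simp add: den_zlam algebra_simps)
qed

definition mone :: motion where "mone = (Mot 0 False (Zx 0 0 0 0))"

lemma mact_mone [simp]: "mact mone = id"
  by (simp add: fun_eq_iff mone_def)

section \<open>Finite data and finite checks\<close>

text \<open>A pair \<open>(i, g)\<close> in a rule for \<open>j\<close> means that \<open>mact g\<close> of tile \<open>i\<close> is a piece of the tile \<open>j\<close>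
  inflated by \<open>lam\<close>. The dual rule is conjugated by the scaling with \<open>lam\<^sup>2\<close>.\<close>

fun ab_rule :: "proto \<Rightarrow> (proto \<times> motion) list" where
  "ab_rule Rhomb =
    [(Rhomb, (Mot 4 False (Zx 8 8 4 (- 4)))),
     (Rhomb, (Mot 1 True (Zx 12 12 4 (- 4)))),
     (Rhomb, (Mot 7 True (Zx 8 12 8 0))),
     (Tri, (Mot 2 True (Zx 4 4 4 0))),
     (Tri, (Mot 3 False (Zx 16 16 8 (- 4)))),
     (Tri, (Mot 6 True (Zx 16 16 4 (- 8)))),
     (Tri, (Mot 7 False (Zx 4 4 0 (- 4))))]"
| "ab_rule Tri =
    [(Rhomb, (Mot 0 False (Zx 4 8 8 4))),
     (Rhomb, (Mot 2 False (Zx 4 4 4 0))),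
     (Tri, (Mot 5 False (Zx 0 4 8 4))),
     (Tri, (Mot 6 True (Zx 8 12 8 0))),
     (Tri, (Mot 3 False (Zx 8 12 12 4)))]"

fun dual_rule :: "proto \<Rightarrow> (proto \<times> motion) list" where
  "dual_rule Rhomb =
    [(Rhomb, (Mot 0 False (Zx (- 4) (- 8) (- 8) (- 4)))),
     (Rhomb, (Mot 7 True (Zx (- 4) (- 12) (- 12) (- 4)))),
     (Rhomb, (Mot 1 True (Zx 0 (- 4) (- 4) (- 4)))),
     (Tri, (Mot 4 False (Zx (- 8) (- 8) (- 4) 4))),
     (Tri, (Mot 6 False (Zx (- 8) (- 12) (- 8) 0)))]"
| "dual_rule Tri =
    [(Rhomb, (Mot 2 True (Zx (- 8) 0 8 12))),
     (Rhomb, (Mot 3 False (Zx (- 12) (- 4) 8 12))),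
     (Rhomb, (Mot 6 True (Zx (- 12) (- 4) 8 12))),
     (Rhomb, (Mot 7 False (Zx (- 8) 0 8 12))),
     (Tri, (Mot 5 False (Zx (- 12) 0 12 16))),
     (Tri, (Mot 6 True (Zx (- 4) 0 4 4))),
     (Tri, (Mot 3 False (Zx (- 8) 4 16 16)))]"

fun quarters :: "proto \<Rightarrow> (proto \<times> motion) list" where
  "quarters Rhomb =
    [(Rhomb, (Mot 2 True (Zx 6 6 2 (- 2)))),
     (Rhomb, (Mot 7 False (Zx 6 6 2 (- 2)))),
     (Rhomb, (Mot 3 False (Zx 2 2 2 (- 2)))),
     (Rhomb, (Mot 6 True (Zx 2 2 2 (- 2))))]"
| "quarters Tri =
    [(Tri, (Mot 5 True (Zx 2 2 (- 2) (- 2)))),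
     (Tri, (Mot 7 True (Zx 6 6 2 (- 2))))]"

fun ab_vertices :: "proto \<Rightarrow> zx list" where
  "ab_vertices Rhomb =
    [(Zx 0 0 0 0),
     (Zx 4 4 0 (- 4)),
     (Zx 8 8 4 (- 4)),
     (Zx 4 4 4 0)]"
| "ab_vertices Tri =
    [(Zx 0 0 0 0),
     (Zx 4 8 4 0),
     (Zx 0 4 4 4)]"

fun dual_vertices :: "proto \<Rightarrow> zx list" where
  "dual_vertices Rhomb =
    [(Zx (- 2) (- 6) (- 6) (- 2)),
     (Zx 0 (- 2) (- 2) 0),
     (Zx (- 2) (- 2) (- 2) 2)]"
| "dual_vertices Tri =
    [(Zx (- 6) (- 2) 2 6),
     (Zx (- 2) 0 2 4),
     (Zx (- 2) 2 6 6)]"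

fun ab_syms :: "proto \<Rightarrow> motion list" where
  "ab_syms Rhomb =
    [(Mot 0 False (Zx 0 0 0 0)),
     (Mot 1 True (Zx 0 0 0 0)),
     (Mot 4 False (Zx 8 8 4 (- 4))),
     (Mot 5 True (Zx 8 8 4 (- 4)))]"
| "ab_syms Tri =
    [(Mot 0 False (Zx 0 0 0 0)),
     (Mot 6 True (Zx 4 8 4 0))]"

text \<open>A rhomb quarter is a right triangle with acute angles pi / 8 and 3 pi / 8 and has no
  symmetry; a square quarter is isosceles and keeps one reflection.\<close>

fun dual_syms :: "proto \<Rightarrow> motion list" where
  "dual_syms Rhomb =
    [(Mot 0 False (Zx 0 0 0 0))]"
| "dual_syms Tri =
    [(Mot 0 False (Zx 0 0 0 0)),
     (Mot 6 True (Zx 0 0 0 0))]"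

text \<open>The triangle has its right angle at \<open>V\<close> and its vertices are listed as \<open>P, Q, V\<close>; the legs are
  oriented \<open>Q \<rightarrow> V \<rightarrow> P\<close>. An edge is kept as its frame: the motion that takes \<open>0\<close> to the source, the
  positive real axis along the edge, and the upper half plane to the side of the tile. Two tiles
  thus share an edge in the same orientation iff their frames differ by complex conjugation.\<close>

datatype edge = ERhomb | ELegQ | ELegP | EHyp

fun edges :: "proto \<Rightarrow> (edge \<times> motion) list" where
  "edges Rhomb =
    [(ERhomb, (Mot 0 False (Zx 0 0 0 0))),
     (ERhomb, (Mot 1 True (Zx 0 0 0 0))),
     (ERhomb, (Mot 5 True (Zx 8 8 4 (- 4)))),
     (ERhomb, (Mot 4 False (Zx 8 8 4 (- 4))))]"
| "edges Tri =
    [(ELegQ, (Mot 4 False (Zx 4 8 4 0))),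
     (ELegP, (Mot 6 False (Zx 0 4 4 4))),
     (EHyp, (Mot 5 True (Zx 4 8 4 0)))]"

text \<open>Sides have length \<open>lam\<close> and hypotenuses \<open>sqrt 2 * lam\<close>.
  Inflation turns them into \<open>lam ^ 2 = lam + sqrt 2 * lam\<close> and
  \<open>sqrt 2 * lam ^ 2 = lam + sqrt 2 * lam + lam\<close>, which are the pieces in order from the
  source. All but the first point backwards, whence the turn 4; the flip keeps the side of the tile.
  \<open>ELegP\<close> never occurs, so a new leg \<open>V P\<close> always lies inside the inflated
  parent.\<close>

fun subedges :: "edge \<Rightarrow> (edge \<times> motion) list" where
  "subedges EHyp =
    [(ERhomb, (Mot 0 False (Zx 0 0 0 0))),
     (EHyp, (Mot 4 True (Zx 12 8 0 (- 8)))),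
     (ELegQ, (Mot 4 True (Zx 16 12 0 (- 12))))]"
| "subedges k =
    [(ERhomb, (Mot 0 False (Zx 0 0 0 0))),
     (EHyp, (Mot 4 True (Zx 12 8 0 (- 8))))]"

text \<open>The invariant that survives subdivision: a leg \<open>V P\<close> meets only rhombs, a
  hypotenuse only hypotenuses. Agreement of the frames is demanded separately in
  \<open>matched\<close>.\<close>

fun matching :: "edge \<Rightarrow> edge \<Rightarrow> bool" where
  "matching ERhomb k = (k \<noteq> EHyp)"
| "matching ELegQ k = (k = ERhomb \<or> k = ELegQ)"
| "matching ELegP k = (k = ERhomb)"
| "matching EHyp k = (k = EHyp)"

text \<open>\<open>wit1\<close> places the rhomb quarter behind the leg \<open>V P\<close>, and \<open>wit2\<close> its mirror image in the
  hypotenuse. Composing such a placement with \<open>swap\<close> exchanges the acute and the obtuse end.\<close>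

definition mcj :: motion where "mcj = (Mot 0 True (Zx 0 0 0 0))"

definition edgeP :: motion where "edgeP = (Mot 6 False (Zx 0 4 4 4))"

definition edgeH :: motion where "edgeH = (Mot 5 True (Zx 4 8 4 0))"

definition flipH :: motion where "flipH = (Mot 2 True (Zx 0 0 0 0))"

definition wit1 :: motion where "wit1 = (Mot 4 False (Zx (- 2) (- 2) (- 2) 2))"

definition wit2 :: motion where "wit2 = (Mot 6 True (Zx (- 2) (- 2) (- 2) (- 2)))"

definition swap :: motion where "swap = (Mot 0 True (Zx 0 (- 4) (- 8) (- 4)))"

definition qedge :: motion where "qedge = (Mot 2 True (Zx 6 6 2 (- 2)))"

text \<open>For the rhomb the point is chosen on the mirror line of \<open>swap\<close>, the
  perpendicular bisector of the rhomb side, so that a quarter and its image with acute and obtuse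
  end exchanged share it.\<close>

fun inner_pt :: "proto \<Rightarrow> zx" where
  "inner_pt Rhomb =
    (Zx (- 2) (- 3) (- 4) (- 1))"
| "inner_pt Tri =
    (Zx (- 4) 0 4 4)"

text \<open>The last fact holds because all sides of a rhomb are oriented from the acute to the
  obtuse angle: the single placement \<open>qedge\<close> then locates the adjacent quarter in the
  frame of each of the four sides.\<close>

lemma motion_data:
  "mcomp edgeP (mcomp mcj qedge) = wit1"
  "mcomp flipH wit1 = wit2"
  "mcomp edgeH mcj = mcomp flipH edgeH"
  "(ELegP, edgeP) \<in> set (edges Tri)"
  "(EHyp, edgeH) \<in> set (edges Tri)"
  "\<forall>(\<kappa>, e)\<in>set (edges Rhomb). (Rhomb, mcomp e qedge) \<in> set (quarters Rhomb)"
  by code_simp+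

lemma quarters_ab_rule:
  "\<forall>j\<in>set [Rhomb, Tri].
     set [(i', mcomp f d). (i, f) \<leftarrow> ab_rule j, (i', d) \<leftarrow> quarters i] =
     set [(i', mcomp (minfl d) f). (i, d) \<leftarrow> quarters j, (i', f) \<leftarrow> dual_rule i]"
  by code_simp

lemma edges_subdivided:
  "\<forall>j\<in>set [Rhomb, Tri]. \<forall>(i, f)\<in>set (ab_rule j). \<forall>(\<kappa>, e)\<in>set (edges i).
     (\<exists>(i', f')\<in>set (ab_rule j). \<exists>(\<kappa>', e')\<in>set (edges i').
        matching \<kappa> \<kappa>' \<and> mcomp f' e' = mcomp f (mcomp e mcj)) \<or>
     (\<exists>(\<kappa>\<^sub>0, e\<^sub>0)\<in>set (edges j). \<exists>(\<kappa>', s)\<in>set (subedges \<kappa>\<^sub>0).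
        \<kappa>' = \<kappa> \<and> mcomp f e = mcomp (minfl e\<^sub>0) s)"
  by code_simp

text \<open>The neighbour's half of the induction in \<open>edge_matched_or_outer\<close>: a tile
  beyond a shared inflated edge contributes a piece along every subedge. The motion tested is the
  frame of the subedge in the coordinates of that piece.\<close>

lemma subedges_edges:
  "\<forall>j\<in>set [Rhomb, Tri]. \<forall>(\<kappa>\<^sub>0, e\<^sub>0)\<in>set (edges j). \<forall>(\<kappa>, s)\<in>set (subedges \<kappa>\<^sub>0).
     \<exists>(i, f)\<in>set (ab_rule j). (\<kappa>, mcomp (mcomp (minv f) (minfl e\<^sub>0)) s) \<in> set (edges i)"
  by code_simp

lemma subedges_matching:
  "matching \<kappa> \<kappa>' \<Longrightarrow> subedges \<kappa> = subedges \<kappa>'"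
  "(\<kappa>', s) \<in> set (subedges \<kappa>) \<Longrightarrow> matching \<kappa>' \<kappa>'"
  by (cases \<kappa>; cases \<kappa>'; auto)+

lemma subedges_motions:
  "(\<kappa>', s) \<in> set (subedges \<kappa>) \<Longrightarrow> mcomp s mcj = mcomp mcj s \<and>
     s \<in> set [(Mot 0 False (Zx 0 0 0 0)), (Mot 4 True (Zx 12 8 0 (- 8))), (Mot 4 True (Zx 16 12 0 (- 12)))]"
  by (cases \<kappa>; auto simp: mcj_def zrot_def)

definition all_lins :: "motion list" where
  "all_lins = [(Mot k r (Zx 0 0 0 0)). k \<leftarrow> [0..7], r \<leftarrow> [False, True]]"

text \<open>For a given linear part an isometry is fixed by the image of one vertex. Rigidity thus
  becomes a search over 16 linear parts and the possible images of the first vertex.\<close>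

definition align :: "motion \<Rightarrow> zx \<Rightarrow> zx \<Rightarrow> motion" where
  "align g p q = Mot (mturn g) (mflip g) (zadd q (zneg (zact g p)))"

lemma ab_vertices_rigid:
  "\<forall>g\<in>set all_lins. \<forall>i\<in>set [Rhomb, Tri]. \<forall>i'\<in>set [Rhomb, Tri]. \<forall>p\<in>set (ab_vertices i).
     (let h = align g (hd (ab_vertices i')) p in
      zact h ` set (ab_vertices i') = set (ab_vertices i) \<longrightarrow> i = i' \<and> h \<in> set (ab_syms i))"
  by code_simp

lemma dual_vertices_rigid:
  "\<forall>g\<in>set all_lins. \<forall>i\<in>set [Rhomb, Tri]. \<forall>i'\<in>set [Rhomb, Tri]. \<forall>p\<in>set (dual_vertices i).
     (let h = align g (hd (dual_vertices i')) p in
      zact h ` set (dual_vertices i') = set (dual_vertices i) \<longrightarrow> i = i' \<and> h \<in> set (dual_syms i))"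
  by code_simp

lemma dual_syms_vertices:
  "\<forall>i\<in>set [Rhomb, Tri]. \<forall>s\<in>set (dual_syms i). zact s ` set (dual_vertices i) = set (dual_vertices i)"
  by code_simp

lemma ab_syms_quarters:
  "\<forall>i\<in>set [Rhomb, Tri]. \<forall>g\<in>set (ab_syms i). \<forall>(i', d)\<in>set (quarters i).
     \<exists>(i'', d')\<in>set (quarters i). i'' = i' \<and> (\<exists>s\<in>set (dual_syms i'). mcomp g d = mcomp d' s)"
  by code_simp

text \<open>\<open>c\<close> is the position of the first tile as seen from the second. In the
  exceptional case two triangles halve one square along different diagonals. Their corners
  \<open>P\<close> are then the two ends of one side of the square, and each demands a rhomb behind
  this side pointing to its own end; the equation with \<open>swap\<close> expresses this
  conflict.\<close>

lemma shared_quarter: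
  "\<forall>i\<in>set [Rhomb, Tri]. \<forall>j\<in>set [Rhomb, Tri]. \<forall>(i', d)\<in>set (quarters i). \<forall>(j', d')\<in>set (quarters j).
     i' = j' \<longrightarrow> i = j \<and> (\<forall>s\<in>set (dual_syms i').
       let c = mcomp (mcomp d' s) (minv d) in
       c \<in> set (ab_syms i) \<or>
       i = Tri \<and> (\<exists>w\<in>{wit1, wit2}. \<exists>w'\<in>{wit1, wit2}. mcomp c w = mcomp w' swap))"
  by code_simp

text \<open>The imaginary part of \<open>Zx a b c d\<close> is a positive multiple of \<open>x + y sqrt 2\<close>.\<close>

definition im_pos :: "zx \<Rightarrow> bool" where
  "im_pos z = (case z of (Zx a b c d) \<Rightarrow> let x = 2 * c; y = b + d in
     x \<ge> 0 \<and> y \<ge> 0 \<and> (x > 0 \<or> y > 0) \<or>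
     x > 0 \<and> y < 0 \<and> x * x > 2 * (y * y) \<or> x < 0 \<and> y > 0 \<and> x * x < 2 * (y * y))"

definition im_zero :: "zx \<Rightarrow> bool" where
  "im_zero z = (case z of (Zx a b c d) \<Rightarrow> c = 0 \<and> b + d = 0)"

lemma edges_halfplane:
  "\<forall>j\<in>set [Rhomb, Tri]. \<forall>(\<kappa>, e)\<in>set (edges j). \<forall>(i, d)\<in>set (quarters j).
     \<forall>p\<in>set (dual_vertices i). (let q = zact (minv e) (zact d p) in im_pos q \<or> im_zero q)"
  by code_simp

lemma wit_outside:
  "im_pos (zneg (zact (minv edgeP) (zact wit1 (inner_pt Rhomb))))"
  "im_pos (zneg (zact (minv edgeH) (zact wit2 (inner_pt Rhomb))))"
  "im_pos (zneg (zact (minv (mcomp flipH edgeP)) (zact wit2 (inner_pt Rhomb))))"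
  by code_simp+

text \<open>Certificates for extreme points: after a suitable rotation and scaling all other
  vertices lie strictly above the given one.\<close>

lemma vertices_exposed:
  "\<forall>V\<in>set [ab_vertices Rhomb, ab_vertices Tri, dual_vertices Rhomb, dual_vertices Tri].
     \<forall>p\<in>set V. \<exists>k\<in>set [0..7]. \<exists>k'\<in>set [k, k + 1]. \<forall>q\<in>set V. q \<noteq> p \<longrightarrow> (let d = zadd q (zneg p) in im_pos (zadd (zrot k d) (zrot k' d)))"
  by code_simp

text \<open>The vertices of the quarters are vertices of the tile or midpoints of two of them, so
  the tile and the union of its quarters have the same convex hull.\<close>

lemma quarters_vertices:
  "\<forall>j\<in>set [Rhomb, Tri]. \<forall>p\<in>set (ab_vertices j). \<exists>(i, d)\<in>set (quarters j). p \<in> zact d ` set (dual_vertices i)"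
  "\<forall>j\<in>set [Rhomb, Tri]. \<forall>(i, d)\<in>set (quarters j). \<forall>q\<in>set (dual_vertices i).
     \<exists>p\<in>set (ab_vertices j). \<exists>p'\<in>set (ab_vertices j). zadd (zact d q) (zact d q) = zadd p p'"
  by code_simp+

fun zgal :: "zx \<Rightarrow> zx" where
  "zgal (Zx a b c d) = (Zx a d (- c) b)"

definition sharp_coeffs :: "motion \<Rightarrow> zx \<times> zx" where
  "sharp_coeffs g = (case g of (Mot k r z) \<Rightarrow>
     if r then (zgal (zlam (zrot k (Zx 4 0 0 0))), zgal (zneg (zrot k (zcnj z))))
     else (zgal (zlam (zrot (- k) (Zx 4 0 0 0))), zgal (zneg (zrot (- k) z))))"

text \<open>Multiplying the linear coefficient by \<open>lam\<close> must leave a power of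
  \<open>xi\<close>. The shift receives one factor \<open>lam\<close> from the inflation and two
  from the scale at which the dual tiles are drawn.\<close>

definition sharp_fits :: "motion \<Rightarrow> motion \<Rightarrow> bool" where
  "sharp_fits g h \<longleftrightarrow> mflip h = mflip g \<and>
     zlam (fst (sharp_coeffs g)) = zrot (mturn h) (Zx 4 0 0 0) \<and>
     zlam (zlam (zlam (snd (sharp_coeffs g)))) = mshift h"

lemma dual_rule_sharp:
  "\<forall>i\<in>set [Rhomb, Tri]. \<forall>(j, g)\<in>set (ab_rule i). \<exists>(i', h)\<in>set (dual_rule j). i' = i \<and> sharp_fits g h"
  "\<forall>j\<in>set [Rhomb, Tri]. \<forall>(i, h)\<in>set (dual_rule j). \<exists>(j', g)\<in>set (ab_rule i). j' = j \<and> sharp_fits g h"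
  by code_simp+

lemma swap_inner_pt: "zact swap (inner_pt Rhomb) = inner_pt Rhomb"
  by code_simp

section \<open>The Galois conjugate and the coded function systems\<close>

lemma sqrt2_irrational: "sqrt 2 \<notin> \<rat>"
proof
  assume "sqrt 2 \<in> \<rat>"
  then obtain m n :: nat where n: "n \<noteq> 0" and eq: "\<bar>sqrt 2\<bar> = real m / real n" and co: "coprime m n"
    by (rule Rats_abs_nat_div_natE)
  have "real m = real n * sqrt 2"
    using eq n by (simp add: field_simps)
  then have "real m ^ 2 = 2 * real n ^ 2"
    by (simp add: power_mult_distrib)
  then have m: "m ^ 2 = 2 * n ^ 2" by (metis of_nat_eq_iff of_nat_mult of_nat_numeral of_nat_power)
  then have "even m" by (metis dvd_triv_left even_power pos2)
  then obtain k where k: "m = 2 * k" by blast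
  with m have "n ^ 2 = 2 * k ^ 2" by (simp add: power_mult_distrib)
  then have "even n" by (metis dvd_triv_left even_power pos2)
  with \<open>even m\<close> co show False by (meson coprime_common_divisor odd_one)
qed

lemma rat_sqrt2_lin_indep:
  assumes "real_of_rat a + real_of_rat b * sqrt 2 = 0"
  shows "a = 0 \<and> b = 0"
proof -
  have "b = 0"
  proof (rule ccontr)
    assume "b \<noteq> 0"
    then have "sqrt 2 = real_of_rat (- a / b)"
      using assms by (simp add: of_rat_divide of_rat_minus field_simps add_eq_0_iff)
    with sqrt2_irrational show False by (metis Rats_of_rat)
  qed
  with assms show ?thesis by simp
qed

lemma of_rat_complex: "(of_rat q :: complex) = of_real (of_rat q)"
proof -
  obtain a b where "q = of_int a / of_int b"
    by (metis quotient_of_div surj_pair)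
  then show ?thesis by (simp add: of_rat_divide)
qed

lemma sum_lessThan_4: "(\<Sum>k<4. f k) = f 0 + f 1 + f 2 + (f (3::nat) :: complex)"
  by (simp add: eval_nat_numeral)

text \<open>Real and imaginary part are rational combinations of 1 and \<open>sqrt 2\<close>. The
  result makes the description in \<open>galois\<close> unique and gives injectivity of
  \<open>den\<close>, on which the transfer from coordinates back to points rests.\<close>

lemma xi_power_lin_indep:
  assumes "(\<Sum>k<4. of_rat (q k) * xi ^ k) = 0" "k < 4"
  shows "q k = 0"
proof -
  have z: "of_rat (q 0) + of_rat (q 1) * xi + of_rat (q 2) * \<i> + of_rat (q 3) * (\<i> * xi) = 0"
    using assms(1) by (simp add: sum_lessThan_4 xi_power2 xi_power3)
  have "of_rat (2 * q 0) + of_rat (q 1 - q 3) * sqrt 2 = 0"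
    using arg_cong[OF z, of Re] by (simp add: of_rat_complex xi_Complex of_rat_mult of_rat_diff field_simps)
  moreover have "of_rat (2 * q 2) + of_rat (q 1 + q 3) * sqrt 2 = 0"
    using arg_cong[OF z, of Im] by (simp add: of_rat_complex xi_Complex of_rat_mult of_rat_add field_simps)
  ultimately have "2 * q 0 = 0 \<and> q 1 - q 3 = 0" "2 * q 2 = 0 \<and> q 1 + q 3 = 0"
    by (blast dest: rat_sqrt2_lin_indep)+
  then have "q 0 = 0" "q 1 = 0" "q 2 = 0" "q 3 = 0" by auto
  moreover have "k = 0 \<or> k = 1 \<or> k = 2 \<or> k = 3" using assms(2) by auto
  ultimately show ?thesis by auto
qed

lemma galois_eq:
  "galois (\<Sum>k<4. of_rat (q k) * xi ^ k) = (\<Sum>k<4. of_rat (q k) * (xi ^ 3) ^ k)"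
  unfolding galois_def
proof (rule the_equality)
  fix w assume "\<exists>p. (\<Sum>k<4. of_rat (q k) * xi ^ k) = (\<Sum>k<4. of_rat (p k) * xi ^ k) \<and>
    w = (\<Sum>k<4. of_rat (p k) * (xi ^ 3) ^ k)"
  then obtain p where p: "(\<Sum>k<4. of_rat (q k) * xi ^ k) = (\<Sum>k<4. of_rat (p k) * xi ^ k)"
    and w: "w = (\<Sum>k<4. of_rat (p k) * (xi ^ 3) ^ k)" by blast
  have "(\<Sum>k<4. of_rat (q k - p k) * xi ^ k) = 0"
    using p by (simp add: of_rat_diff left_diff_distrib sum_subtractf)
  then have "q k = p k" if "k < 4" for k using xi_power_lin_indep[OF _ that] by force
  then show "w = (\<Sum>k<4. of_rat (q k) * (xi ^ 3) ^ k)" using w by simp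
qed blast

lemma xi_power6: "xi ^ 6 = - \<i>" and xi_power9: "xi ^ 9 = xi"
proof -
  have "xi ^ 6 = xi ^ 4 * xi ^ 2" "xi ^ 9 = xi ^ 4 * xi ^ 4 * xi" by (simp_all flip: power_add power_Suc2)
  then show "xi ^ 6 = - \<i>" "xi ^ 9 = xi" by (simp_all add: xi_power4 xi_power2)
qed

lemma galois_den: "galois (den z) = den (zgal z)"
proof -
  obtain a b c d where z: "z = (Zx a b c d)" by (cases z)
  define q :: "nat \<Rightarrow> rat" where "q k = of_int ([a, b, c, d] ! k) / 4" for k
  have "den z = (\<Sum>k<4. of_rat (q k) * xi ^ k)"
    by (simp add: z sum_lessThan_4 q_def of_rat_divide add_divide_distrib)
  moreover have "den (zgal z) = (\<Sum>k<4. of_rat (q k) * (xi ^ 3) ^ k)"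
    by (simp add: z sum_lessThan_4 q_def of_rat_divide add_divide_distrib xi_power2 xi_power6 xi_power9 flip: power_mult)
  ultimately show ?thesis by (simp add: galois_eq)
qed

lemma den_inject: "den z = den w \<longleftrightarrow> z = w"
proof
  assume eq: "den z = den w"
  obtain a b c d where z: "z = (Zx a b c d)" by (cases z)
  obtain a' b' c' d' where w: "w = (Zx a' b' c' d')" by (cases w)
  define q :: "nat \<Rightarrow> rat" where "q k = of_int ([a - a', b - b', c - c', d - d'] ! k)" for k
  have "(\<Sum>k<4. of_rat (q k) * xi ^ k) = 0"
  proof -
    have "(\<Sum>k<4. of_rat (q k) * xi ^ k) = 4 * den z - 4 * den w"
      by (simp add: z w sum_lessThan_4 q_def algebra_simps)
    with eq show ?thesis by simp
  qed
  then have "q 0 = 0" "q 1 = 0" "q 2 = 0" "q 3 = 0" using xi_power_lin_indep by force+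
  then show "z = w" by (simp add: z w q_def eval_nat_numeral)
qed simp

lemma Im_den: "Im (den (Zx a b c d)) = (2 * c + (b + d) * sqrt 2) / 8"
  by (simp add: den_alt xi_Complex field_simps del: den.simps)

lemma add_sqrt2_pos:
  assumes "x \<ge> 0 \<and> y \<ge> 0 \<and> (x > 0 \<or> y > 0) \<or>
     x > 0 \<and> y < 0 \<and> x * x > 2 * (y * y) \<or> x < 0 \<and> y > 0 \<and> x * x < 2 * (y * y)"
  shows "real_of_int x + real_of_int y * sqrt 2 > 0"
proof -
  have sq: "real_of_int x ^ 2 = of_int (x * x)" "(real_of_int y * sqrt 2) ^ 2 = of_int (2 * (y * y))"
    by (simp_all add: power_mult_distrib power2_eq_square)
  consider "x \<ge> 0" "y \<ge> 0" "x > 0 \<or> y > 0" | "x > 0" "y < 0" "x * x > 2 * (y * y)"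
    | "x < 0" "y > 0" "x * x < 2 * (y * y)"
    using assms by blast
  then show ?thesis
  proof cases
    case 1
    then show ?thesis by (auto simp: add_pos_nonneg add_nonneg_pos)
  next
    case 2
    then have "(- (real_of_int y * sqrt 2)) ^ 2 < real_of_int x ^ 2"
      by (simp only: power2_minus sq of_int_less_iff)
    then have "- (real_of_int y * sqrt 2) < real_of_int x"
      by (rule power_less_imp_less_base) (use 2 in simp)
    then show ?thesis by simp
  next
    case 3
    then have "(- real_of_int x) ^ 2 < (real_of_int y * sqrt 2) ^ 2"
      by (simp only: power2_minus sq of_int_less_iff)
    then have "- real_of_int x < real_of_int y * sqrt 2"
      by (rule power_less_imp_less_base) (use 3 in simp)
    then show ?thesis by simp
  qed
qed

lemma im_pos: "im_pos z \<Longrightarrow> Im (den z) > 0"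
proof -
  assume pos: "im_pos z"
  obtain a b c d where z: "z = (Zx a b c d)" by (cases z)
  have "real_of_int (2 * c) + real_of_int (b + d) * sqrt 2 > 0"
    by (rule add_sqrt2_pos) (use pos in \<open>simp add: im_pos_def z Let_def\<close>)
  then show ?thesis by (simp add: z Im_den del: den.simps)
qed

lemma im_zero: "im_zero z \<Longrightarrow> Im (den z) = 0"
  by (cases z) (auto simp add: Im_den im_zero_def simp flip: of_int_add simp del: den.simps of_int_add)

lemma im_neg: "im_pos (zneg z) \<Longrightarrow> Im (den z) < 0"
  using im_pos[of "zneg z"] by (simp add: den_zneg)

lemma den_4: "den (Zx 4 0 0 0) = 1"
  by simp

section \<open>The two function systems as motions followed by a common contraction\<close>

definition msimil :: "motion \<Rightarrow> simil" where
  "msimil g = (case g of (Mot k r z) \<Rightarrow> (if r then Opp else Dir) (xi powi k / lam) (den z / lam))"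

lemma ammann_beenker_msimil: "ammann_beenker j = map_prod id msimil ` set (ab_rule j)"
proof -
  have e: "den (zlam z) / lam = den z" for z using lam_pos by (simp add: den_zlam)
  have e1: "den (Zx 8 8 4 (- 4)) / lam = 1 + xi" using e[of "(Zx 4 4 0 0)"] by (simp add: add_divide_distrib)
  have e2: "den (Zx 12 12 4 (- 4)) / lam = 1 + xi + xi ^ 2 - xi ^ 3"
    using e[of "(Zx 4 4 4 (- 4))"] by (simp add: add_divide_distrib diff_divide_distrib)
  have e3: "den (Zx 8 12 8 0) / lam = 1 + xi + xi ^ 2" using e[of "(Zx 4 4 4 0)"] by (simp add: add_divide_distrib)
  have e4: "den (Zx 4 4 4 0) / lam = xi" using e[of "(Zx 0 4 0 0)"] by (simp add: add_divide_distrib)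
  have e5: "den (Zx 16 16 8 (- 4)) / lam = 1 + 2 * xi + xi ^ 2 - xi ^ 3"
    using e[of "(Zx 4 8 4 (- 4))"] by (simp add: add_divide_distrib diff_divide_distrib)
  have e6: "den (Zx 16 16 4 (- 8)) / lam = 2 + xi + xi ^ 2 - xi ^ 3"
    using e[of "(Zx 8 4 4 (- 4))"] by (simp add: add_divide_distrib diff_divide_distrib)
  have e7: "den (Zx 4 4 0 (- 4)) / lam = 1" using e[of "(Zx 4 0 0 0)"] by (simp add: add_divide_distrib)
  have e8: "den (Zx 4 8 8 4) / lam = xi + xi ^ 2" using e[of "(Zx 0 4 4 0)"] by (simp add: add_divide_distrib)
  have e9: "den (Zx 0 4 8 4) / lam = xi + xi ^ 3" using e[of "(Zx 0 4 0 4)"] by (simp add: add_divide_distrib)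
  have e10: "den (Zx 8 12 12 4) / lam = 2 * xi + xi ^ 2" using e[of "(Zx 0 8 4 0)"] by (simp add: add_divide_distrib)
  have xi7: "xi ^ 7 = - (xi ^ 3)"
    using power_add[of xi 4 3] by (simp add: xi_power4)
  show ?thesis
    by (cases j) (simp_all add: ammann_beenker_def msimil_def e1 e2 e3 e4 e5 e6 e7 e8 e9 e10 xi7 del: den.simps)
qed

lemma sharp_msimil:
  assumes g: "g = (Mot k r z)" and ab: "sharp_coeffs g = (a, b)"
  shows "sharp (msimil g) = (if r then Opp else Dir) (den a) (den b)"
proof (cases r)
  case True
  have a: "a = zgal (zlam (zrot k (Zx 4 0 0 0)))" and b: "b = zgal (zneg (zrot k (zcnj z)))"
    using ab True by (simp_all add: sharp_coeffs_def g)
  have "1 / cnj (xi powi k / lam) = den (zlam (zrot k (Zx 4 0 0 0)))"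
    by (simp only: den_zlam den_zrot den_4) (simp add: cnj_xi_powi' field_simps)
  moreover have "- cnj ((den z / lam) / (xi powi k / lam)) = den (zneg (zrot k (zcnj z)))"
    by (simp only: den_zneg den_zrot den_zcnj) (simp add: cnj_xi_powi' field_simps)
  ultimately show ?thesis
    by (simp only: g True sharp_def msimil_def motion.case if_True simil_inv.simps galois_simil.simps a b galois_den)
next
  case False
  have a: "a = zgal (zlam (zrot (- k) (Zx 4 0 0 0)))" and b: "b = zgal (zneg (zrot (- k) z))"
    using ab False by (simp_all add: sharp_coeffs_def g)
  have "1 / (xi powi k / lam) = den (zlam (zrot (- k) (Zx 4 0 0 0)))"
    by (simp only: den_zlam den_zrot den_4) (simp add: power_int_minus field_simps)
  moreover have "- (den z / lam) / (xi powi k / lam) = den (zneg (zrot (- k) z))"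
    by (simp only: den_zneg den_zrot) (simp add: power_int_minus field_simps)
  ultimately show ?thesis
    by (simp only: g False sharp_def msimil_def motion.case if_False simil_inv.simps galois_simil.simps a b galois_den)
qed

text \<open>\<open>c\<close> is the scale at which the rule is drawn: conjugated by this scaling,
  every map of \<open>F\<close> is a motion of \<open>R\<close> followed by division by
  \<open>lam\<close>.\<close>

definition coded_by :: "real \<Rightarrow> fsystem \<Rightarrow> (proto \<Rightarrow> (proto \<times> motion) list) \<Rightarrow> bool" where
  "coded_by c F R \<longleftrightarrow> (\<forall>j.
     (\<forall>(i, f)\<in>F j. \<exists>g. (i, g) \<in> set (R j) \<and> (\<forall>x. app f x = mact g (of_real c * x) / of_real (c * lam))) \<and>
     (\<forall>(i, g)\<in>set (R j). \<exists>f. (i, f) \<in> F j \<and> (\<forall>x. app f x = mact g (of_real c * x) / of_real (c * lam))))"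

lemma map_prod_id_image: "(i, f) \<in> map_prod id h ` S \<longleftrightarrow> (\<exists>g. (i, g) \<in> S \<and> f = h g)"
  by force

lemma coded_ammann_beenker: "coded_by 1 ammann_beenker ab_rule"
proof -
  have "app (msimil g) x = mact g x / lam" for g x
  proof -
    obtain k r z where "g = (Mot k r z)" by (cases g)
    then show ?thesis by (simp add: msimil_def add_divide_distrib)
  qed
  note app = this
  show ?thesis
    unfolding coded_by_def
  proof (intro allI conjI ballI; clarify)
    fix j i f assume "(i, f) \<in> ammann_beenker j"
    then obtain g where "(i, g) \<in> set (ab_rule j)" "f = msimil g"
      unfolding ammann_beenker_msimil map_prod_id_image by blast
    then show "\<exists>g. (i, g) \<in> set (ab_rule j) \<and> (\<forall>x. app f x = mact g (complex_of_real 1 * x) / complex_of_real (1 * lam))"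
      using app[of g] by (intro exI[of _ g]) (simp only: of_real_1 mult_1_left simp_thms)
  next
    fix j i g assume "(i, g) \<in> set (ab_rule j)"
    then have "(i, msimil g) \<in> ammann_beenker j" 
      unfolding ammann_beenker_msimil map_prod_id_image by blast
    then show "\<exists>f. (i, f) \<in> ammann_beenker j \<and> (\<forall>x. app f x = mact g (complex_of_real 1 * x) / complex_of_real (1 * lam))"
      using app[of g] by (intro exI[of _ "msimil g"]) (simp only: of_real_1 mult_1_left simp_thms)
  qed
qed

lemma all_proto: "(\<forall>j\<in>set [Rhomb, Tri]. P j) \<longleftrightarrow> (\<forall>j. P j)"
proof
  assume *: "\<forall>j\<in>set [Rhomb, Tri]. P j"
  show "\<forall>j. P j"
  proof
    fix j show "P j" using * by (cases j) simp_all
  qed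
qed simp

lemma ball_pair: "(\<forall>(a, b)\<in>S. P a b) \<longleftrightarrow> (\<forall>a b. (a, b) \<in> S \<longrightarrow> P a b)"
  and bex_pair: "(\<exists>(a, b)\<in>S. P a b) \<longleftrightarrow> (\<exists>a b. (a, b) \<in> S \<and> P a b)"
  by blast+

lemma coded_star_dual: "coded_by (lam ^ 2) (star_dual ammann_beenker) dual_rule"
proof -
  have key: "app (sharp (msimil g)) x = mact h (of_real (lam ^ 2) * x) / of_real (lam ^ 2 * lam)"
    if fits: "sharp_fits g h"
    for g h x
  proof -
    obtain k r z where g: "g = (Mot k r z)" by (cases g)
    obtain k' r' z' where "h = (Mot k' r' z')" by (cases h)
    with fits have h: "h = (Mot k' r z')" by (simp add: g sharp_fits_def)
    obtain a b where ab: "sharp_coeffs g = (a, b)" by (cases "sharp_coeffs g")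
    have e: "zlam a = zrot k' (Zx 4 0 0 0)" "zlam (zlam (zlam b)) = z'"
      using fits unfolding ab h sharp_fits_def fst_conv snd_conv motion.sel by blast+
    have a: "xi powi k' = lam * den a"
      using arg_cong[OF e(1), of den] by (simp only: den_zlam den_zrot den_4 mult_1_right)
    have b: "den z' = lam * (lam * (lam * den b))"
      using arg_cong[OF e(2), of den] by (simp only: den_zlam)
    have eq: "(complex_of_real lam * A * (of_real (lam ^ 2) * y) + of_real lam * (of_real lam * (of_real lam * B))) / of_real (lam ^ 2 * lam) = A * y + B" for A B y
    proof -
      have "complex_of_real lam * A * (of_real (lam ^ 2) * y) + of_real lam * (of_real lam * (of_real lam * B)) = of_real (lam ^ 2 * lam) * (A * y + B)"
        by (simp add: power2_eq_square algebra_simps)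
      then show ?thesis by simp
    qed
    have "app (sharp (msimil g)) x = den a * (if r then cnj x else x) + den b"
      by (simp only: sharp_msimil[OF g ab]) simp
    moreover have "mact h (of_real (lam ^ 2) * x) = lam * den a * (of_real (lam ^ 2) * (if r then cnj x else x)) + lam * (lam * (lam * den b))"
      by (simp only: h mact.simps a b) simp
    ultimately show ?thesis by (simp only: eq)
  qed
  have d: "(i, f) \<in> star_dual ammann_beenker j \<longleftrightarrow> (\<exists>g. (j, g) \<in> set (ab_rule i) \<and> f = sharp (msimil g))" for i j f
    unfolding star_dual_def mem_Collect_eq prod.inject ammann_beenker_msimil map_prod_id_image by blast
  show ?thesis
    unfolding coded_by_def
  proof (intro allI conjI ballI; clarify)
    fix j i f assume "(i, f) \<in> star_dual ammann_beenker j"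
    then obtain g where g: "(j, g) \<in> set (ab_rule i)" "f = sharp (msimil g)" unfolding d by blast
    obtain h where "(i, h) \<in> set (dual_rule j)" and h: "sharp_fits g h"
      using dual_rule_sharp(1)[unfolded all_proto ball_pair bex_pair, rule_format, OF g(1)] by blast
    then show "\<exists>h. (i, h) \<in> set (dual_rule j) \<and>
        (\<forall>x. app f x = mact h (complex_of_real (lam\<^sup>2) * x) / complex_of_real (lam\<^sup>2 * lam))"
      unfolding g(2) by (intro exI[of _ h] conjI allI key[OF h])
  next
    fix j i h assume ih: "(i, h) \<in> set (dual_rule j)"
    obtain g where g: "(j, g) \<in> set (ab_rule i)" and h: "sharp_fits g h"
      using dual_rule_sharp(2)[unfolded all_proto ball_pair bex_pair, rule_format, OF ih] by blast
    have "(i, sharp (msimil g)) \<in> star_dual ammann_beenker j" unfolding d using g by blast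
    then show "\<exists>f. (i, f) \<in> star_dual ammann_beenker j \<and>
        (\<forall>x. app f x = mact h (complex_of_real (lam\<^sup>2) * x) / complex_of_real (lam\<^sup>2 * lam))"
      by (intro exI[of _ "sharp (msimil g)"] conjI allI key[OF h])
  qed
qed

section \<open>Iterates, tilings and attractors\<close>

lemma dist_mact: "dist (mact g x) (mact g y) = dist x y"
proof -
  obtain k r z where g: "g = Mot k r z" by (cases g)
  have "norm (cnj (x - y)) = norm (x - y)" by (rule complex_mod_cnj)
  moreover have "norm (xi powi k) = 1" by (simp add: norm_power_int)
  moreover have "mact g x - mact g y = xi powi k * (if r then cnj (x - y) else x - y)"
    by (simp add: g algebra_simps)
  ultimately show ?thesis by (simp only: dist_norm norm_mult) (simp del: complex_cnj_diff)
qed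

definition infl :: "(complex \<Rightarrow> complex) \<Rightarrow> complex \<Rightarrow> complex" where
  "infl g x = of_real lam * g (x / of_real lam)"

lemma infl_id [simp]: "infl id = id"
  by (simp add: fun_eq_iff infl_def)

lemma infl_comp: "infl (g \<circ> h) = infl g \<circ> infl h"
  by (simp add: fun_eq_iff infl_def)

lemma infl_mact: "infl (mact g) = mact (minfl g)"
proof
  fix x show "infl (mact g) x = mact (minfl g) x"
    using mact_minfl[of g "x / of_real lam"] by (simp add: infl_def)
qed

lemma funpow_infl_comp: "(infl ^^ n) (g \<circ> h) = (infl ^^ n) g \<circ> (infl ^^ n) h"
proof (induction n)
  case (Suc n)
  have "(infl ^^ Suc n) k = infl ((infl ^^ n) k)" for k by simp
  then show ?case by (simp only: Suc.IH infl_comp)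
qed simp

lemma funpow_infl: "(infl ^^ n) g x = of_real (lam ^ n) * g (x / of_real (lam ^ n))"
  by (induction n arbitrary: x) (simp_all add: infl_def field_simps)

type_synonym rule = "proto \<Rightarrow> (proto \<times> motion) list"

text \<open>The first substitution step is peeled off, as in \<open>dissection\<close>. Maps are
  recorded at inflated size, so they are isometries, and the outer one is inflated \<open>n\<close>
  times. The map is kept rather than the tile because a bare triangle forgets which corner is
  \<open>P\<close>.\<close>

primrec iter :: "rule \<Rightarrow> nat \<Rightarrow> proto \<Rightarrow> (proto \<times> (complex \<Rightarrow> complex)) set" where
  "iter R 0 j = {(j, id)}"
| "iter R (Suc n) j = {(i', (infl ^^ n) (mact f) \<circ> g) |i' f g. \<exists>i. (i, f) \<in> set (R j) \<and> (i', g) \<in> iter R n i}"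

text \<open>The same iterate with the last step peeled off: inflate once and dissect every tile.
  This is the form in which tiles and their neighbours can be followed through a further
  substitution.\<close>

lemma iter_Suc_bottom:
  "iter R (Suc n) j = {(i', infl g \<circ> mact f) |i' g f. \<exists>i. (i, g) \<in> iter R n j \<and> (i', f) \<in> set (R i)}"
proof (induction n arbitrary: j)
  case 0
  then show ?case by simp
next
  case (Suc n)
  have "iter R (Suc (Suc n)) j =
      {(i', (infl ^^ Suc n) (mact f) \<circ> g) |i' f g. \<exists>i. (i, f) \<in> set (R j) \<and> (i', g) \<in> iter R (Suc n) i}"
    by (rule iter.simps)
  also have "\<dots> = {(i', (infl ^^ Suc n) (mact f) \<circ> (infl g \<circ> mact f')) |i' f g f'.
      \<exists>i i''. (i, f) \<in> set (R j) \<and> (i'', g) \<in> iter R n i \<and> (i', f') \<in> set (R i'')}"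
    unfolding Suc.IH by blast
  also have "\<dots> = {(i', infl ((infl ^^ n) (mact f) \<circ> g) \<circ> mact f') |i' f g f'.
      \<exists>i i''. (i, f) \<in> set (R j) \<and> (i'', g) \<in> iter R n i \<and> (i', f') \<in> set (R i'')}"
    by (simp add: infl_comp comp_assoc)
  also have "\<dots> = {(i', infl g \<circ> mact f) |i' g f. \<exists>i. (i, g) \<in> iter R (Suc n) j \<and> (i', f) \<in> set (R i)}"
    unfolding iter.simps by blast
  finally show ?case .
qed

lemma iter_add:
  assumes "(i, g) \<in> iter R m j" "(i', g') \<in> iter R n i"
  shows "(i', (infl ^^ n) g \<circ> g') \<in> iter R (m + n) j"
  using assms(2)
proof (induction n arbitrary: i' g')
  case 0
  then show ?case using assms(1) by simp
next
  case (Suc n)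
  then obtain i'' h f where h: "(i'', h) \<in> iter R n i" "(i', f) \<in> set (R i'')" "g' = infl h \<circ> mact f"
    unfolding iter_Suc_bottom by blast
  then have "(i', infl ((infl ^^ n) g \<circ> h) \<circ> mact f) \<in> iter R (Suc (m + n)) j"
    unfolding iter_Suc_bottom using Suc.IH by blast
  then have "(i', (infl \<circ> infl ^^ n) g \<circ> (infl h \<circ> mact f)) \<in> iter R (Suc (m + n)) j"
    by (simp only: infl_comp comp_assoc) (simp only: comp_apply)
  then show ?case unfolding h(3) by (simp only: funpow.simps add_Suc_right)
qed

lemma coded_byD:
  assumes "coded_by c F R"
  shows "(i, f) \<in> F j \<Longrightarrow> \<exists>g. (i, g) \<in> set (R j) \<and> (\<forall>x. app f x = mact g (of_real c * x) / of_real (c * lam))"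
    and "(i, g) \<in> set (R j) \<Longrightarrow> \<exists>f. (i, f) \<in> F j \<and> (\<forall>x. app f x = mact g (of_real c * x) / of_real (c * lam))"
  using assms unfolding coded_by_def by blast+

lemma dissection_iter:
  assumes F: "coded_by c F R" and c: "c > 0"
  shows "dissection F n j =
    (\<lambda>(i, g). (\<lambda>x. g (of_real c * x) / of_real (c * lam ^ n)) ` prototile F i) ` iter R n j"
proof (induction n arbitrary: j)
  case 0
  then show ?case using c by simp
next
  case (Suc n)
  have step: "app f ` (\<lambda>x. g (of_real c * x) / of_real (c * lam ^ n)) ` X =
      (\<lambda>x. ((infl ^^ n) (mact f') \<circ> g) (of_real c * x) / of_real (c * lam ^ Suc n)) ` X"
    if "\<forall>x. app f x = mact f' (of_real c * x) / of_real (c * lam)" for f f' g X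
    unfolding image_image
    by (rule image_cong) (use that c in \<open>simp_all add: funpow_infl\<close>)
  show ?case
  proof (intro equalityI subsetI)
    fix t assume "t \<in> dissection F (Suc n) j"
    then obtain i f i' g where f: "(i, f) \<in> F j" and g: "(i', g) \<in> iter R n i"
      and t: "t = app f ` (\<lambda>x. g (of_real c * x) / of_real (c * lam ^ n)) ` prototile F i'"
      unfolding dissection.simps Suc.IH by auto
    obtain f' where f': "(i, f') \<in> set (R j)" "\<forall>x. app f x = mact f' (of_real c * x) / of_real (c * lam)"
      using coded_byD(1)[OF F f] by blast
    have "(i', (infl ^^ n) (mact f') \<circ> g) \<in> iter R (Suc n) j" using f' g by auto
    then show "t \<in> (\<lambda>(i, g). (\<lambda>x. g (of_real c * x) / of_real (c * lam ^ Suc n)) ` prototile F i) ` iter R (Suc n) j"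
      unfolding t step[OF f'(2)] by (rule rev_image_eqI) simp
  next
    fix t assume "t \<in> (\<lambda>(i, g). (\<lambda>x. g (of_real c * x) / of_real (c * lam ^ Suc n)) ` prototile F i) ` iter R (Suc n) j"
    then obtain i f' i' g where f': "(i, f') \<in> set (R j)" and g: "(i', g) \<in> iter R n i"
      and t: "t = (\<lambda>x. ((infl ^^ n) (mact f') \<circ> g) (of_real c * x) / of_real (c * lam ^ Suc n)) ` prototile F i'"
      by auto
    obtain f where f: "(i, f) \<in> F j" "\<forall>x. app f x = mact f' (of_real c * x) / of_real (c * lam)"
      using coded_byD(2)[OF F f'] by blast
    have "(\<lambda>x. g (of_real c * x) / of_real (c * lam ^ n)) ` prototile F i' \<in> dissection F n i"
      unfolding Suc.IH by (rule rev_image_eqI[OF g]) simp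
    then show "t \<in> dissection F (Suc n) j"
      unfolding t step[OF f(2), symmetric] dissection.simps using f(1) by blast
  qed
qed

text \<open>\<open>prototile\<close> is a definite description, so uniqueness must be shown as well.
  It is a contraction argument: every point of one solution is within \<open>d0 / lam ^ n\<close> of
  the other for all \<open>n\<close>, and the other is closed.\<close>

lemma prototile_unique:
  assumes F: "coded_by c F R" and c: "c > 0"
    and B: "\<And>j. compact (B j)" "\<And>j. B j \<noteq> {}"
    and eq: "\<And>j. (*) (of_real lam) ` B j = (\<Union>(i, g)\<in>set (R j). mact g ` B i)"
  shows "(*) (of_real c) ` prototile F i = B i"
proof -
  let ?fix = "\<lambda>X. \<forall>j. compact (X j) \<and> X j \<noteq> {} \<and> X j = (\<Union>(i, f)\<in>F j. app f ` X i)"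
  define X where "X j = (\<lambda>x. x / of_real c) ` B j" for j
  have XB: "(*) (of_real c) ` X j = B j" for j
    using c by (simp add: X_def image_image)
  have X: "?fix X"
  proof (intro allI conjI)
    fix j
    show "compact (X j)" unfolding X_def using c
      by (intro compact_continuous_image continuous_intros B) simp
    show "X j \<noteq> {}" using B by (simp add: X_def)
    have im: "app f ` X i = (\<lambda>x. x / of_real (c * lam)) ` mact g ` B i"
      if "\<forall>x. app f x = mact g (of_real c * x) / of_real (c * lam)" for f g i
      unfolding XB[symmetric] image_image by (rule image_cong) (use that in simp_all)
    have "(\<Union>(i, f)\<in>F j. app f ` X i) = (\<Union>(i, g)\<in>set (R j). (\<lambda>x. x / of_real (c * lam)) ` mact g ` B i)"
    proof (intro equalityI UN_least; clarify)
      fix i f x assume f: "(i, f) \<in> F j" and x: "x \<in> X i"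
      obtain g where g: "(i, g) \<in> set (R j)" "\<forall>x. app f x = mact g (of_real c * x) / of_real (c * lam)"
        using coded_byD(1)[OF F f] by blast
      have "app f x \<in> (\<lambda>x. x / of_real (c * lam)) ` mact g ` B i"
        unfolding im[OF g(2), symmetric] using x by blast
      with g(1) show "app f x \<in> (\<Union>(i, g)\<in>set (R j). (\<lambda>x. x / of_real (c * lam)) ` mact g ` B i)"
        by blast
    next
      fix i g x assume g: "(i, g) \<in> set (R j)" and x: "x \<in> B i"
      obtain f where f: "(i, f) \<in> F j" "\<forall>x. app f x = mact g (of_real c * x) / of_real (c * lam)"
        using coded_byD(2)[OF F g] by blast
      have "mact g x / of_real (c * lam) \<in> app f ` X i"
        unfolding im[OF f(2)] using x by blast
      with f(1) show "mact g x / of_real (c * lam) \<in> (\<Union>(i, f)\<in>F j. app f ` X i)"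
        by blast
    qed
    also have "\<dots> = (\<lambda>x. x / of_real (c * lam)) ` (\<Union>(i, g)\<in>set (R j). mact g ` B i)"
      by blast
    also have "\<dots> = (\<lambda>x. x / of_real (c * lam)) ` (*) (of_real lam) ` B j"
      by (simp only: eq)
    also have "\<dots> = X j"
      unfolding image_image X_def by (rule image_cong) simp_all
    finally show "X j = (\<Union>(i, f)\<in>F j. app f ` X i)" ..
  qed
  have contr: "dist (app f x) (app f y) = dist x y / lam" if f: "(i, f) \<in> F j" for f i j x y
  proof -
    obtain g where g: "\<forall>x. app f x = mact g (of_real c * x) / of_real (c * lam)"
      using coded_byD(1)[OF F f] by blast
    have "dist (app f x) (app f y) = norm ((mact g (of_real c * x) - mact g (of_real c * y)) / of_real (c * lam))"
      by (simp only: g dist_norm diff_divide_distrib)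
    also have "\<dots> = dist (of_real c * x) (of_real c * y) / \<bar>c * lam\<bar>"
      by (simp only: norm_divide norm_of_real dist_norm[symmetric] dist_mact)
    also have "dist (of_real c * x) (of_real c * y) = \<bar>c\<bar> * dist x y"
      by (simp only: dist_norm right_diff_distrib[symmetric] norm_mult norm_of_real)
    also have "\<bar>c\<bar> * dist x y / \<bar>c * lam\<bar> = dist x y / lam"
      using c abs_of_pos[OF lam_pos] by (simp add: abs_mult)
    finally show ?thesis .
  qed
  have sub: "X1 j \<subseteq> X2 j" if X1: "?fix X1" and X2: "?fix X2" for X1 X2 :: "proto \<Rightarrow> complex set" and j
  proof -
    have cpt: "compact (X1 j)" "compact (X2 j)" "X2 j \<noteq> {}" for j using X1 X2 by blast+
    then have "bounded (X1 Rhomb \<union> X1 Tri \<union> X2 Rhomb \<union> X2 Tri)" by (simp add: compact_imp_bounded)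
    then obtain d0 where d0: "\<And>x y. x \<in> X1 Rhomb \<union> X1 Tri \<union> X2 Rhomb \<union> X2 Tri \<Longrightarrow>
        y \<in> X1 Rhomb \<union> X1 Tri \<union> X2 Rhomb \<union> X2 Tri \<Longrightarrow> dist x y \<le> d0"
      unfolding bounded_two_points by blast
    have near: "\<exists>y\<in>X2 j. dist x y \<le> d0 / lam ^ n" if "x \<in> X1 j" for x n j
      using that
    proof (induction n arbitrary: x j)
      case 0
      obtain y where y: "y \<in> X2 j" using cpt(3) by (meson ex_in_conv)
      have "dist x y \<le> d0" by (rule d0; cases j; use 0 y in auto)
      then show ?case using y by auto
    next
      case (Suc n)
      have "x \<in> (\<Union>(i, f)\<in>F j. app f ` X1 i)" using X1 Suc.prems by blast
      then obtain i f x' where f: "(i, f) \<in> F j" and x': "x' \<in> X1 i" "x = app f x'" by blast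
      obtain y' where y': "y' \<in> X2 i" "dist x' y' \<le> d0 / lam ^ n" using Suc.IH x' by blast
      have "app f y' \<in> (\<Union>(i, f)\<in>F j. app f ` X2 i)" using f y' by blast
      then have "app f y' \<in> X2 j" using X2 by blast
      moreover have "dist x (app f y') \<le> d0 / lam ^ Suc n"
        using y' lam_pos by (simp add: x' contr[OF f] field_simps)
      ultimately show ?case by blast
    qed
    show ?thesis
    proof
      fix x assume x: "x \<in> X1 j"
      have "(\<lambda>n. d0 / lam ^ n) \<longlonglongrightarrow> 0"
        using lam_gt_1 by (intro tendsto_divide_0[OF tendsto_const] filterlim_at_top_imp_at_infinity
            filterlim_realpow_sequentially_gt1) simp
      obtain y where y: "\<And>n. y n \<in> X2 j" "\<And>n. dist x (y n) \<le> d0 / lam ^ n" using near[OF x] by metis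
      have "(\<lambda>n. dist (y n) x) \<longlonglongrightarrow> 0"
        by (rule tendsto_sandwich[OF _ _ tendsto_const \<open>(\<lambda>n. d0 / lam ^ n) \<longlonglongrightarrow> 0\<close>]) (use y in \<open>auto simp: dist_commute\<close>)
      then have "y \<longlonglongrightarrow> x" by (rule tendsto_dist_iff[THEN iffD2])
      moreover have "closed (X2 j)" using cpt by (simp add: compact_imp_closed)
      ultimately show "x \<in> X2 j" using closed_sequentially[of "X2 j" y] y(1) by simp
    qed
  qed
  have "prototile F = X"
    unfolding prototile_def
  proof (rule the_equality[of ?fix, OF X])
    fix Y assume "?fix Y"
    then show "Y = X" using sub X by (intro ext equalityI)
  qed
  then show ?thesis using XB by simp
qed

section \<open>Hulls of placed iterates\<close>

definition place :: "(proto \<Rightarrow> complex set) \<Rightarrow> complex \<Rightarrow> (proto \<times> (complex \<Rightarrow> complex)) set \<Rightarrow> complex set set" where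
  "place B v S = (\<lambda>(i, g). (\<lambda>x. v + g x) ` B i) ` S"

definition hull_of :: "(proto \<Rightarrow> complex set) \<Rightarrow> rule \<Rightarrow> complex set set set" where
  "hull_of B R = {T. tiling T \<and> (\<forall>P. P \<subseteq> T \<and> finite P \<longrightarrow> (\<exists>v n j. P \<subseteq> place B v (iter R n j)))}"

lemma tiling_scale:
  assumes c: "c > 0" and T: "tiling T"
  shows "tiling (scale_tiles c T)"
  unfolding tiling_def
proof
  have "\<Union>(scale_tiles c T) = (*\<^sub>R) c ` \<Union>T" by (auto simp: scale_tiles_def)
  also have "\<dots> = UNIV"
  proof -
    have "x \<in> (*\<^sub>R) c ` UNIV" for x :: complex
      by (rule image_eqI[of _ _ "x /\<^sub>R c"]) (use c in simp_all)
    then show ?thesis using T unfolding tiling_def by blast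
  qed
  finally show "\<Union>(scale_tiles c T) = UNIV" .
  show "pairwise (\<lambda>s t. interior s \<inter> interior t = {}) (scale_tiles c T)"
    unfolding pairwise_def
  proof (intro ballI impI)
    fix s t assume "s \<in> scale_tiles c T" "t \<in> scale_tiles c T" "s \<noteq> t"
    then obtain s' t' where s: "s = (*\<^sub>R) c ` s'" "s' \<in> T" and t: "t = (*\<^sub>R) c ` t'" "t' \<in> T" and "s' \<noteq> t'"
      by (auto simp: scale_tiles_def)
    then have "interior s' \<inter> interior t' = {}" using T by (auto simp: tiling_def pairwise_def)
    moreover have "interior ((*\<^sub>R) c ` u) = (*\<^sub>R) c ` interior u" for u :: "complex set"
      using c by (intro interior_injective_linear_image) (auto simp: linear_scaleR inj_on_def)
    ultimately show "interior s \<inter> interior t = {}" using c by (auto simp: s t)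
  qed
qed

lemma scale_scale: "scale_tiles c (scale_tiles d T) = scale_tiles (c * d) T"
  by (simp add: scale_tiles_def image_image)

lemma scale_1: "scale_tiles 1 T = T"
  by (simp add: scale_tiles_def)

text \<open>A translate of a subset is a subset of the translate, and scaling by \<open>c\<close>
  turns the dissection maps into the isometries of \<open>iter\<close>.\<close>

lemma scale_substitution_tilings:
  assumes F: "coded_by c F R" and c: "c > 0" and B: "\<And>i. (*) (of_real c) ` prototile F i = B i"
  shows "scale_tiles c ` substitution_tilings F = hull_of B R"
proof -
  have place: "scale_tiles c (translate_tiles v (subst_iterate F n j)) = place B (of_real c * v) (iter R n j)" for v n j
  proof -
    have "(*\<^sub>R) c ` (+) v ` (*\<^sub>R) (lam ^ n) ` (\<lambda>x. g (of_real c * x) / of_real (c * lam ^ n)) ` prototile F i =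
        (\<lambda>x. of_real c * v + g x) ` B i" for g i
      unfolding B[symmetric] image_image
      by (rule image_cong) (use c in \<open>simp_all add: scaleR_conv_of_real distrib_left\<close>)
    note eq = this
    show ?thesis
      unfolding scale_tiles_def translate_tiles_def subst_iterate_def dissection_iter[OF F c] place_def
        image_image[of _ _ "_ ` _"] image_image[of _ _ "iter R n j"]
    proof (rule image_cong[OF refl], goal_cases)
      case (1 p)
      obtain i g where "p = (i, g)" by (cases p)
      then show ?case by (simp only: prod.case image_image eq[unfolded image_image])
    qed
  qed
  have mono: "P \<subseteq> Z \<longleftrightarrow> scale_tiles c P \<subseteq> scale_tiles c Z" for P Z
  proof
    assume "scale_tiles c P \<subseteq> scale_tiles c Z"
    then have "scale_tiles (inverse c) (scale_tiles c P) \<subseteq> scale_tiles (inverse c) (scale_tiles c Z)"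
      unfolding scale_tiles_def by (rule image_mono)
    then show "P \<subseteq> Z" using c by (simp add: scale_scale scale_1)
  qed (auto simp: scale_tiles_def)
  have legal: "(\<exists>v n j. \<exists>Q\<subseteq>subst_iterate F n j. P = translate_tiles v Q) \<longleftrightarrow>
      (\<exists>v n j. scale_tiles c P \<subseteq> place B v (iter R n j))" for P
  proof
    assume "\<exists>v n j. \<exists>Q\<subseteq>subst_iterate F n j. P = translate_tiles v Q"
    then obtain v n j Q where "Q \<subseteq> subst_iterate F n j" "P = translate_tiles v Q" by (elim exE conjE)
    then have "P \<subseteq> translate_tiles v (subst_iterate F n j)"
      unfolding translate_tiles_def by (simp only: image_mono)
    then have "scale_tiles c P \<subseteq> place B (of_real c * v) (iter R n j)"
      by (simp only: mono[THEN iffD1] flip: place)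
    then show "\<exists>v n j. scale_tiles c P \<subseteq> place B v (iter R n j)" by (intro exI)
  next
    assume "\<exists>v n j. scale_tiles c P \<subseteq> place B v (iter R n j)"
    then obtain v n j where "scale_tiles c P \<subseteq> place B v (iter R n j)" by (elim exE)
    moreover have "v = of_real c * (v / of_real c)" using c by simp
    ultimately have "scale_tiles c P \<subseteq> scale_tiles c (translate_tiles (v / of_real c) (subst_iterate F n j))"
      unfolding place by simp
    then have "P \<subseteq> translate_tiles (v / of_real c) (subst_iterate F n j)" by (rule mono[THEN iffD2])
    then obtain Q where "Q \<subseteq> subst_iterate F n j" "P = translate_tiles (v / of_real c) Q"
      unfolding translate_tiles_def by (rule subset_imageE)
    then show "\<exists>v n j. \<exists>Q\<subseteq>subst_iterate F n j. P = translate_tiles v Q" by (intro exI conjI)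
  qed
  show ?thesis
  proof (intro equalityI subsetI)
    fix T assume "T \<in> scale_tiles c ` substitution_tilings F"
    then obtain T' where T: "T = scale_tiles c T'" and T': "T' \<in> substitution_tilings F" by (rule imageE)
    have "\<exists>v n j. P \<subseteq> place B v (iter R n j)" if P: "P \<subseteq> T" "finite P" for P
    proof -
      obtain P' where "P' \<subseteq> T'" "finite P'" "P = scale_tiles c P'"
        using finite_subset_image[OF P(2) P(1)[unfolded T scale_tiles_def]] unfolding scale_tiles_def by (elim exE conjE)
      moreover from this have "\<exists>v n j. \<exists>Q\<subseteq>subst_iterate F n j. P' = translate_tiles v Q"
        using T' unfolding substitution_tilings_def by simp
      ultimately show ?thesis unfolding legal by simp
    qed
    moreover have "tiling T" using T' tiling_scale[OF c] unfolding T substitution_tilings_def by blast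
    ultimately show "T \<in> hull_of B R" unfolding hull_of_def by blast
  next
    fix T assume T: "T \<in> hull_of B R"
    define T' where "T' = scale_tiles (inverse c) T"
    have TT': "T = scale_tiles c T'" using c by (simp add: T'_def scale_scale scale_1)
    have "tiling T'" unfolding T'_def using c T by (intro tiling_scale) (auto simp: hull_of_def)
    moreover have "\<exists>v n j. \<exists>Q\<subseteq>subst_iterate F n j. P = translate_tiles v Q" if "P \<subseteq> T' \<and> finite P" for P
    proof -
      have "scale_tiles c P \<subseteq> T \<and> finite (scale_tiles c P)"
        using that mono[THEN iffD1, of P T'] unfolding TT' by (simp add: scale_tiles_def)
      then show ?thesis unfolding legal using T unfolding hull_of_def by simp
    qed
    ultimately have "T' \<in> substitution_tilings F" unfolding substitution_tilings_def by blast
    then show "T \<in> scale_tiles c ` substitution_tilings F" using TT' by blast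
  qed
qed

section \<open>Isometries and prototiles\<close>

text \<open>All isometries with linear part in the dihedral group of order 16. The shift is any
  complex number, since legality allows arbitrary translations; only relative positions have
  coordinates in \<open>zx\<close>.\<close>

definition isom :: "(complex \<Rightarrow> complex) set" where
  "isom = {h. \<exists>k r v. h = (\<lambda>x. xi powi k * (if r then cnj x else x) + v)}"

lemma isom_mact: "mact g \<in> isom"
proof -
  obtain k r z where "g = Mot k r z" by (cases g)
  then have "mact g = (\<lambda>x. xi powi k * (if r then cnj x else x) + den z)" by (simp add: fun_eq_iff)
  then show ?thesis unfolding isom_def by blast
qed

lemma isom_id: "id \<in> isom"
  using isom_mact[of mone] by simp

lemma isom_translate: "h \<in> isom \<Longrightarrow> (\<lambda>x. v + h x) \<in> isom"
proof -
  assume "h \<in> isom"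
  then obtain k r w where "h = (\<lambda>x. xi powi k * (if r then cnj x else x) + w)"
    unfolding isom_def by blast
  then have "(\<lambda>x. v + h x) = (\<lambda>x. xi powi k * (if r then cnj x else x) + (v + w))" by (simp add: fun_eq_iff)
  then show ?thesis unfolding isom_def by blast
qed

lemma isom_comp: "g \<in> isom \<Longrightarrow> h \<in> isom \<Longrightarrow> g \<circ> h \<in> isom"
proof -
  assume "g \<in> isom" "h \<in> isom"
  then obtain k r v k' r' v' where
    g: "g = (\<lambda>x. xi powi k * (if r then cnj x else x) + v)" and
    h: "h = (\<lambda>x. xi powi k' * (if r' then cnj x else x) + v')"
    unfolding isom_def by blast
  have "g \<circ> h = (\<lambda>x. xi powi (if r then k - k' else k + k') * (if r \<noteq> r' then cnj x else x) +
      (xi powi k * (if r then cnj v' else v') + v))"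
    by (auto simp add: fun_eq_iff g h power_int_add power_int_diff cnj_xi_powi' divide_inverse algebra_simps)
  then show ?thesis unfolding isom_def by blast
qed

lemma isom_infl: "g \<in> isom \<Longrightarrow> infl g \<in> isom"
proof -
  assume "g \<in> isom"
  then obtain k r v where g: "g = (\<lambda>x. xi powi k * (if r then cnj x else x) + v)"
    unfolding isom_def by blast
  have "infl g = (\<lambda>x. xi powi k * (if r then cnj x else x) + of_real lam * v)"
    by (simp add: fun_eq_iff g infl_def field_simps)
  then show ?thesis unfolding isom_def by blast
qed

lemma isom_funpow_infl: "g \<in> isom \<Longrightarrow> (infl ^^ n) g \<in> isom"
  by (induction n) (simp_all add: isom_infl)

lemma isom_iter: "(i, g) \<in> iter R n j \<Longrightarrow> g \<in> isom"
proof (induction n arbitrary: g j)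
  case (Suc n)
  then obtain f g' i' where "g = (infl ^^ n) (mact f) \<circ> g'" "(i, g') \<in> iter R n i'" by auto
  with Suc.IH show ?case by (metis isom_comp isom_funpow_infl isom_mact)
qed (simp add: isom_id)

lemma isom_linear:
  assumes "h \<in> isom"
  obtains L v where "linear L" "inj L" "\<And>x. h x = v + L x" "\<And>x. norm (L x) = norm x"
proof -
  obtain k r v where h: "h = (\<lambda>x. xi powi k * (if r then cnj x else x) + v)"
    using assms unfolding isom_def by blast
  define L where "L x = xi powi k * (if r then cnj x else x)" for x
  have lin: "linear L"
    unfolding L_def by (rule linearI) (auto simp: algebra_simps scaleR_conv_of_real)
  have norm: "norm (L x) = norm x" for x
    by (simp add: L_def norm_mult norm_power_int)
  have "inj L"
    using linear_injective_0[OF lin] norm by (metis norm_eq_zero)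
  with lin norm show thesis by (intro that[of L v]) (simp_all add: h L_def)
qed

lemma isom_dist: "h \<in> isom \<Longrightarrow> dist (h x) (h y) = dist x y"
  by (erule isom_linear) (simp add: dist_norm flip: linear_diff)

lemma isom_inj: "h \<in> isom \<Longrightarrow> inj h"
  by (rule injI) (metis isom_dist dist_eq_0_iff)

lemma isom_image: "h \<in> isom \<Longrightarrow> \<exists>L v. linear L \<and> inj L \<and> (\<forall>S. h ` S = (+) v ` L ` S)"
  by (erule isom_linear) (auto simp: image_image)

lemma isom_convex_hull: "h \<in> isom \<Longrightarrow> h ` (convex hull S) = convex hull (h ` S)"
proof -
  assume "h \<in> isom"
  then obtain L v where L: "linear L" "\<And>S. h ` S = (+) v ` L ` S" using isom_image by blast
  show ?thesis unfolding L(2) by (simp only: convex_hull_translation convex_hull_linear_image[OF L(1)])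
qed

lemma isom_interior: "h \<in> isom \<Longrightarrow> interior (h ` S) = h ` interior S"
proof -
  assume "h \<in> isom"
  then obtain L v where L: "linear L" "inj L" "\<And>S. h ` S = (+) v ` L ` S" using isom_image by blast
  show ?thesis unfolding L(3) by (simp only: interior_translation interior_injective_linear_image[OF L(1,2)])
qed

lemma extreme_points_linear_image:
  fixes L :: "complex \<Rightarrow> complex"
  assumes "linear L" "inj L"
  shows "{x. x extreme_point_of (L ` S)} = L ` {x. x extreme_point_of S}"
proof -
  have "L x extreme_point_of (L ` S) \<longleftrightarrow> x extreme_point_of S" for x
    using face_of_linear_image[OF assms, of "{x}" S] by (simp add: face_of_singleton)
  moreover have "y \<in> L ` S" if "y extreme_point_of (L ` S)" for y
    using that by (simp add: extreme_point_of_def)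
  ultimately show ?thesis by blast
qed

lemma isom_continuous: "h \<in> isom \<Longrightarrow> continuous_on S h"
  unfolding continuous_on_iff by (metis isom_dist)

lemma isom_compact: "h \<in> isom \<Longrightarrow> compact S \<Longrightarrow> compact (h ` S)"
  by (rule compact_continuous_image[OF isom_continuous])

lemma isom_split:
  assumes "h \<in> isom"
  obtains g v where "g \<in> set all_lins" "\<And>x. h x = mact g x + v"
proof -
  obtain k r v where h: "h = (\<lambda>x. xi powi k * (if r then cnj x else x) + v)"
    using assms unfolding isom_def by blast
  have "k mod 8 \<in> set [0..7]" by simp
  then have "Mot (k mod 8) r (Zx 0 0 0 0) \<in> set all_lins"
    unfolding all_lins_def by (cases r) auto
  moreover have "h x = mact (Mot (k mod 8) r (Zx 0 0 0 0)) x + v" for x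
    by (simp add: h xi_power_int_mod)
  ultimately show thesis by (rule that)
qed

lemma isom_inverse:
  assumes "h \<in> isom"
  obtains h' where "h' \<in> isom" "h' \<circ> h = id" "h \<circ> h' = id"
proof -
  obtain g v where g: "\<And>x. h x = mact g x + v" using isom_split[OF assms] by blast
  have "mact (minv g) \<circ> (\<lambda>x. - v + id x) \<in> isom"
    by (intro isom_comp isom_mact isom_translate isom_id)
  moreover have "mact (minv g) (mact g x) = x" "mact g (mact (minv g) x) = x" for x
    using mact_minv[of g] by (metis comp_apply id_apply)+
  ultimately show thesis by (intro that[of "mact (minv g) \<circ> (\<lambda>x. - v + id x)"]) (auto simp: g)
qed

text \<open>Multiplying by a sum of two powers of \<open>xi\<close> rotates by any multiple of \<open>pi / 8\<close>, which covers
  the directions of all sides and bisectors that occur.\<close>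

definition lift_im :: "int \<Rightarrow> int \<Rightarrow> zx \<Rightarrow> zx" where
  "lift_im k k' d = zadd (zrot k d) (zrot k' d)"

lemma den_lift_im: "den (lift_im k k' d) = (xi powi k + xi powi k') * den d"
  by (simp add: lift_im_def den_zadd den_zrot distrib_right)

section \<open>Extreme points and rigidity of the polygons\<close>

lemma not_in_hull_vertices:
  assumes V: "V \<in> set [ab_vertices Rhomb, ab_vertices Tri, dual_vertices Rhomb, dual_vertices Tri]"
    and p: "p \<in> set V"
  shows "den p \<notin> convex hull (den ` set V - {den p})"
proof
  assume in_hull: "den p \<in> convex hull (den ` set V - {den p})"
  obtain k k' where kk: "\<forall>q\<in>set V. q \<noteq> p \<longrightarrow> im_pos (lift_im k k' (zadd q (zneg p)))"
    using vertices_exposed V p unfolding lift_im_def Let_def by blast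
  define w where "w = xi powi k + xi powi k'"
  have "Im (w * (den q - den p)) > 0" if "q \<in> set V" "q \<noteq> p" for q
  proof -
    have "w * (den q - den p) = den (lift_im k k' (zadd q (zneg p)))"
      by (simp add: den_lift_im w_def den_zadd den_zneg)
    then show ?thesis using kk that im_pos by simp
  qed
  then have "den ` set V - {den p} \<subseteq> {x. Im (w * (x - den p)) > 0}" by auto
  moreover have "convex {x. Im (w * (x - den p)) > 0}"
  proof -
    have "{x. Im (w * (x - den p)) > 0} = {x. inner (Complex (Im w) (Re w)) x > Im (w * den p)}"
      by (auto simp: inner_complex_def algebra_simps)
    then show ?thesis by (simp add: convex_halfspace_gt)
  qed
  ultimately have "convex hull (den ` set V - {den p}) \<subseteq> {x. Im (w * (x - den p)) > 0}"
    by (rule hull_minimal)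
  with in_hull show False by auto
qed

lemma extreme_vertices:
  assumes V: "V \<in> set [ab_vertices Rhomb, ab_vertices Tri, dual_vertices Rhomb, dual_vertices Tri]"
  shows "{x. x extreme_point_of (convex hull (den ` set V))} = den ` set V"
  using extreme_point_of_convex_hull_convex_independent[of "den ` set V"] not_in_hull_vertices[OF V]
  by (auto simp: finite_imp_compact)

lemma vertices_mem: "ab_vertices i \<in> set [ab_vertices Rhomb, ab_vertices Tri, dual_vertices Rhomb, dual_vertices Tri]"
    "dual_vertices i \<in> set [ab_vertices Rhomb, ab_vertices Tri, dual_vertices Rhomb, dual_vertices Tri]"
  by (cases i; simp)+

text \<open>An isometry between the hulls permutes extreme points, and these are exactly the listed
  vertices. So the relative position of the two placements has coordinates in \<open>zx\<close> and
  is covered by the finite check given as the first assumption.\<close>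

lemma rigid:
  assumes rigid: "\<forall>g\<in>set all_lins. \<forall>i\<in>set [Rhomb, Tri]. \<forall>i'\<in>set [Rhomb, Tri]. \<forall>p\<in>set (V i).
     (let h = align g (hd (V i')) p in
      zact h ` set (V i') = set (V i) \<longrightarrow> i = i' \<and> h \<in> set (syms i))"
    and V: "\<And>i. V i \<in> set [ab_vertices Rhomb, ab_vertices Tri, dual_vertices Rhomb, dual_vertices Tri]"
    and h: "h \<in> isom" "h' \<in> isom"
    and eq: "h ` (convex hull (den ` set (V i))) = h' ` (convex hull (den ` set (V i')))"
  shows "i = i' \<and> (\<exists>s\<in>set (syms i). h' = h \<circ> mact s)"
proof -
  obtain h1 where h1: "h1 \<in> isom" "h1 \<circ> h = id" "h \<circ> h1 = id" by (rule isom_inverse[OF h(1)])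
  have f: "h1 \<circ> h' \<in> isom" using h1 h by (simp add: isom_comp)
  obtain g v where g: "g \<in> set all_lins" "\<And>x. (h1 \<circ> h') x = mact g x + v" using isom_split[OF f] by blast
  have "(h1 \<circ> h') ` (convex hull (den ` set (V i'))) = convex hull (den ` set (V i))"
    using eq[symmetric] h1(2) by (metis image_comp image_id id_apply)
  then have "convex hull ((h1 \<circ> h') ` den ` set (V i')) = convex hull (den ` set (V i))"
    by (simp only: isom_convex_hull[OF f])
  moreover have "{x. x extreme_point_of (convex hull ((h1 \<circ> h') ` den ` set (V i')))} = (h1 \<circ> h') ` den ` set (V i')"
  proof -
    obtain L w where L: "linear L" "inj L" "\<And>S. (h1 \<circ> h') ` S = (+) w ` L ` S" using isom_image[OF f] by blast
    have "{x. x extreme_point_of ((h1 \<circ> h') ` S)} = (h1 \<circ> h') ` {x. x extreme_point_of S}" for S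
      unfolding L(3) using L(1,2) by (simp only: extreme_points_of_translation extreme_points_linear_image)
    then show ?thesis
      unfolding isom_convex_hull[OF f, symmetric] using extreme_vertices[OF V] by simp
  qed
  ultimately have im: "(h1 \<circ> h') ` den ` set (V i') = den ` set (V i)"
    using extreme_vertices[OF V] by simp
  have ne: "hd (V i') \<in> set (V i')" using V[of i'] by (cases i') auto
  then have "(h1 \<circ> h') (den (hd (V i'))) \<in> den ` set (V i)" unfolding im[symmetric] by (intro imageI)
  then obtain p where p: "p \<in> set (V i)" "(h1 \<circ> h') (den (hd (V i'))) = den p" by blast
  define a where "a = align g (hd (V i')) p"
  have a: "h1 \<circ> h' = mact a"
  proof
    fix x
    obtain k r where gg: "g = Mot k r (Zx 0 0 0 0)" using g(1) by (auto simp: all_lins_def)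
    have "v = den p - mact g (den (hd (V i')))" using p(2) unfolding g(2) by (simp add: eq_diff_eq add.commute)
    then show "(h1 \<circ> h') x = mact a x"
      unfolding g(2) a_def align_def gg by (simp add: den_zadd den_zneg den_zrot den_zcnj)
  qed
  have "den ` zact a ` set (V i') = den ` set (V i)"
    using im unfolding a image_image by (simp add: den_zact)
  then have "zact a ` set (V i') = set (V i)"
    by (rule inj_image_eq_iff[THEN iffD1, rotated]) (auto simp: inj_def den_inject)
  moreover have "i \<in> set [Rhomb, Tri]" "i' \<in> set [Rhomb, Tri]" by (cases i; simp) (cases i'; simp)
  ultimately have "i = i' \<and> a \<in> set (syms i)"
    using rigid g(1) p(1) unfolding a_def Let_def by blast
  moreover have "h' = h \<circ> mact a" using h1(3) a by (metis comp_assoc fun.map_id0 id_apply id_comp)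
  ultimately show ?thesis by blast
qed

definition dual_tile :: "proto \<Rightarrow> complex set" where
  "dual_tile i = convex hull (den ` set (dual_vertices i))"

text \<open>Built from its quarters, so that its dissection is inherited from the dual tiles through
  \<open>quarters_ab_rule\<close> and only the dual triangles are dissected geometrically.\<close>

definition ab_tile :: "proto \<Rightarrow> complex set" where
  "ab_tile j = (\<Union>(i, d)\<in>set (quarters j). mact d ` dual_tile i)"

lemma mact_dual_tile: "mact g ` dual_tile i = convex hull (den ` zact g ` set (dual_vertices i))"
  by (simp add: dual_tile_def isom_convex_hull[OF isom_mact] image_image den_zact)

lemma convex_hull_ab_tile: "convex hull (ab_tile j) = convex hull (den ` set (ab_vertices j))"
proof
  have "den (zact d q) \<in> convex hull (den ` set (ab_vertices j))"
    if id: "(i, d) \<in> set (quarters j)" and q: "q \<in> set (dual_vertices i)" for i d q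
  proof -
    obtain p p' where pp: "p \<in> set (ab_vertices j)" "p' \<in> set (ab_vertices j)" "zadd (zact d q) (zact d q) = zadd p p'"
      using quarters_vertices(2)[unfolded all_proto ball_pair, rule_format, OF id q] by blast
    have "2 * den (zact d q) = den p + den p'" using arg_cong[OF pp(3), of den] by (simp add: den_zadd)
    then have "den (zact d q) = (1 / 2) *\<^sub>R den p + (1 / 2) *\<^sub>R den p'"
      by (simp add: scaleR_conv_of_real field_simps)
    moreover have "den p \<in> convex hull (den ` set (ab_vertices j))" "den p' \<in> convex hull (den ` set (ab_vertices j))"
      using pp by (simp_all add: hull_inc)
    ultimately show ?thesis using convexD[OF convex_convex_hull, of "den p" "den ` set (ab_vertices j)" "den p'" "1/2" "1/2"] by simp
  qed
  then have "mact d ` dual_tile i \<subseteq> convex hull (den ` set (ab_vertices j))" if "(i, d) \<in> set (quarters j)" for i d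
    using that unfolding mact_dual_tile by (intro hull_minimal convex_convex_hull) auto
  then have "ab_tile j \<subseteq> convex hull (den ` set (ab_vertices j))" unfolding ab_tile_def by blast
  then show "convex hull (ab_tile j) \<subseteq> convex hull (den ` set (ab_vertices j))"
    by (intro hull_minimal convex_convex_hull)
  have "den p \<in> ab_tile j" if p: "p \<in> set (ab_vertices j)" for p
  proof -
    obtain i d where d: "(i, d) \<in> set (quarters j)" "p \<in> zact d ` set (dual_vertices i)"
      using quarters_vertices(1)[unfolded all_proto bex_pair, rule_format, OF p] by blast
    then have "den p \<in> mact d ` dual_tile i" unfolding mact_dual_tile by (intro hull_inc imageI)
    with d(1) show ?thesis unfolding ab_tile_def by blast
  qed
  then show "convex hull (den ` set (ab_vertices j)) \<subseteq> convex hull (ab_tile j)"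
    by (intro hull_mono) auto
qed

lemma ab_tile_rigid:
  assumes "h \<in> isom" "h' \<in> isom" "h ` ab_tile i = h' ` ab_tile i'"
  shows "i = i' \<and> (\<exists>s\<in>set (ab_syms i). h' = h \<circ> mact s)"
proof (rule rigid[OF ab_vertices_rigid vertices_mem(1) assms(1,2)])
  show "h ` (convex hull (den ` set (ab_vertices i))) = h' ` (convex hull (den ` set (ab_vertices i')))"
    unfolding convex_hull_ab_tile[symmetric] using assms by (simp add: isom_convex_hull)
qed

lemma dual_tile_rigid:
  assumes "h \<in> isom" "h' \<in> isom" "h ` dual_tile i = h' ` dual_tile i'"
  shows "i = i' \<and> (\<exists>s\<in>set (dual_syms i). h' = h \<circ> mact s)"
  by (rule rigid[OF dual_vertices_rigid vertices_mem(2) assms(1,2)]) (use assms(3) in \<open>simp add: dual_tile_def\<close>)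

lemma dual_tile_sym: "s \<in> set (dual_syms i) \<Longrightarrow> mact s ` dual_tile i = dual_tile i"
  unfolding mact_dual_tile using dual_syms_vertices[unfolded all_proto] by (simp add: dual_tile_def)

lemma compact_dual_tile: "compact (dual_tile i)"
  by (simp add: dual_tile_def finite_imp_compact_convex_hull)

lemma compact_ab_tile: "compact (ab_tile j)"
  unfolding ab_tile_def by (auto intro!: compact_UN isom_compact isom_mact compact_dual_tile)

lemma inner_pt_interior: "den (inner_pt i) \<in> interior (dual_tile i)"
proof -
  have ne: "den p \<noteq> den q" if "p \<noteq> q" for p q using that den_inject by simp
  obtain a b c where abc: "dual_vertices i = [a, b, c]" "a \<noteq> b" "a \<noteq> c" "b \<noteq> c" by (cases i) auto
  have "den a \<notin> closed_segment (den b) (den c)" "den b \<notin> closed_segment (den c) (den a)" "den c \<notin> closed_segment (den a) (den b)"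
    using not_in_hull_vertices[OF vertices_mem(2), of a i] not_in_hull_vertices[OF vertices_mem(2), of b i]
      not_in_hull_vertices[OF vertices_mem(2), of c i] abc
    by (simp_all add: den_inject insert_Diff_if segment_convex_hull insert_commute)
  then have "\<not> collinear {den a, den b, den c}"
    unfolding collinear_between_cases between_mem_segment by simp
  from interior_convex_hull_3_minimal[OF this] have int: "interior (dual_tile i) =
    {v. \<exists>x y z. 0 < x \<and> 0 < y \<and> 0 < z \<and> x + y + z = 1 \<and> x *\<^sub>R den a + y *\<^sub>R den b + z *\<^sub>R den c = v}"
    by (simp add: dual_tile_def abc)
  have s: "sqrt 2 < 2" "sqrt 2 > 1" by (simp_all add: real_less_lsqrt)
  have ss: "sqrt 2 * (sqrt 2 * t) = 2 * t" for t by (simp flip: mult.assoc)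
  show ?thesis
  proof (cases i)
    case Rhomb
    have eqs: "a = (Zx (- 2) (- 6) (- 6) (- 2))" "b = (Zx 0 (- 2) (- 2) 0)" "c = (Zx (- 2) (- 2) (- 2) 2)"
      using abc(1) by (simp_all add: Rhomb)
    \<comment> \<open>Barycentric coordinates of the inner point with respect to the three vertices;
      being positive they place it in the interior.\<close>
    have "((6 - 3 * sqrt 2) / 4) *\<^sub>R den a + (sqrt 2 - 1) *\<^sub>R den b + ((2 - sqrt 2) / 4) *\<^sub>R den c = den (inner_pt i)"
      by (simp add: eqs Rhomb complex_eq_iff den_alt xi_Complex field_simps ss del: den.simps)
    moreover have "0 < (6 - 3 * sqrt 2) / 4" "0 < sqrt 2 - 1" "0 < (2 - sqrt 2) / 4"
      "(6 - 3 * sqrt 2) / 4 + (sqrt 2 - 1) + (2 - sqrt 2) / 4 = 1"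
      using s by (simp_all add: field_simps)
    ultimately show ?thesis unfolding int by blast
  next
    case Tri
    have eqs: "a = (Zx (- 6) (- 2) 2 6)" "b = (Zx (- 2) 0 2 4)" "c = (Zx (- 2) 2 6 6)"
      using abc(1) by (simp_all add: Tri)
    have "((2 - sqrt 2) / 2) *\<^sub>R den a + (sqrt 2 - 1) *\<^sub>R den b + ((2 - sqrt 2) / 2) *\<^sub>R den c = den (inner_pt i)"
      by (simp add: eqs Tri complex_eq_iff den_alt xi_Complex field_simps ss del: den.simps)
    moreover have "0 < (2 - sqrt 2) / 2" "0 < sqrt 2 - 1"
      "(2 - sqrt 2) / 2 + (sqrt 2 - 1) + (2 - sqrt 2) / 2 = 1"
      using s by (simp_all add: field_simps)
    ultimately show ?thesis unfolding int by blast
  qed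
qed

section \<open>Dissections of the dual triangles\<close>

lemma triangle_cut:
  fixes a b c m :: complex
  assumes m: "m \<in> closed_segment b c"
  shows "convex hull {a, b, c} = convex hull {a, b, m} \<union> convex hull {a, m, c}"
proof
  have "m \<in> convex hull {b, c}" using m by (simp add: segment_convex_hull)
  then have m': "m \<in> convex hull {a, b, c}" using hull_mono[of "{b, c}" "{a, b, c}"] by blast
  then show "convex hull {a, b, m} \<union> convex hull {a, m, c} \<subseteq> convex hull {a, b, c}"
    by (intro Un_least hull_minimal convex_convex_hull) (auto intro: hull_inc)
  show "convex hull {a, b, c} \<subseteq> convex hull {a, b, m} \<union> convex hull {a, m, c}"
  proof
    fix x assume "x \<in> convex hull {a, b, c}"
    then obtain u v p where p: "p \<in> convex hull {b, c}" "u \<ge> 0" "v \<ge> 0" "u + v = 1" "x = u *\<^sub>R a + v *\<^sub>R p"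
      by (auto simp: convex_hull_insert[of "{b, c}" a])
    then have "p \<in> closed_segment b m \<union> closed_segment m c"
      using Un_closed_segment[OF m] by (simp add: segment_convex_hull)
    then consider "p \<in> convex hull {b, m}" | "p \<in> convex hull {m, c}" by (auto simp: segment_convex_hull)
    then show "x \<in> convex hull {a, b, m} \<union> convex hull {a, m, c}"
      using p convex_hull_insert[of "{b, m}" a] convex_hull_insert[of "{m, c}" a] by cases blast+
  qed
qed

lemma triangle_cut_interior:
  fixes a b c m :: complex
  assumes m: "m \<in> open_segment b c" and am: "m \<noteq> a"
  shows "interior (convex hull {a, b, m}) \<inter> interior (convex hull {a, m, c}) = {}"
proof -
  define w where "w = \<i> * (m - a)"
  have w: "w \<noteq> 0" using am by (simp add: w_def)
  have wm: "inner w m = inner w a"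
    by (simp add: w_def inner_complex_def algebra_simps)
  obtain u where u: "0 < u" "u < 1" "m = (1 - u) *\<^sub>R b + u *\<^sub>R c"
    using m by (auto simp: in_segment)
  \<comment> \<open>\<open>m\<close> lies on the line through \<open>a\<close> with normal
    \<open>w\<close> and strictly between \<open>b\<close> and \<open>c\<close>, so these two lie
    weakly on opposite sides of the line.\<close>
  have bal: "(1 - u) * (inner w b - inner w a) + u * (inner w c - inner w a) = 0"
    using wm unfolding u(3) by (simp add: inner_add_right algebra_simps)
  have half: "interior (convex hull S) \<inter> interior (convex hull T) = {}"
    if "\<And>x. x \<in> S \<Longrightarrow> inner w x \<le> inner w a" "\<And>x. x \<in> T \<Longrightarrow> inner w x \<ge> inner w a" for S T
  proof -
    have "convex hull S \<subseteq> {x. inner w x \<le> inner w a}" "convex hull T \<subseteq> {x. inner w x \<ge> inner w a}"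
      by (rule hull_minimal; use that in \<open>auto simp: convex_halfspace_le convex_halfspace_ge\<close>)+
    then have "interior (convex hull S) \<inter> interior (convex hull T) \<subseteq> interior {x. inner w x \<le> inner w a} \<inter> interior {x. inner w x \<ge> inner w a}"
      by (meson Int_mono interior_mono)
    also have "\<dots> = {}" using w by (auto simp: interior_halfspace_le interior_halfspace_ge)
    finally show ?thesis by blast
  qed
  show ?thesis
  proof (cases "inner w b \<le> inner w a")
    case True
    then have "u * (inner w c - inner w a) \<ge> 0"
      using bal u mult_nonneg_nonpos[of "1 - u" "inner w b - inner w a"] by linarith
    then have "inner w c \<ge> inner w a" using u by (simp add: zero_le_mult_iff)
    with True wm show ?thesis by (intro half) auto
  next
    case False
    then have "u * (inner w c - inner w a) \<le> 0"
      using bal u mult_nonneg_nonneg[of "1 - u" "inner w b - inner w a"] by linarith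
    then have "inner w c \<le> inner w a" using u by (simp add: mult_le_0_iff)
    with False wm have "interior (convex hull {a, m, c}) \<inter> interior (convex hull {a, b, m}) = {}"
      by (intro half) auto
    then show ?thesis by blast
  qed
qed

definition re_pos :: "zx \<Rightarrow> bool" where
  "re_pos z = im_pos (zrot 2 z)"

text \<open>Exact test for a point of an open segment: a rotation by a multiple of pi / 8, with a
  scaling, turns both differences into positive reals.\<close>

definition strictly_between :: "zx \<Rightarrow> zx \<Rightarrow> zx \<Rightarrow> bool" where
  "strictly_between b m c \<longleftrightarrow> (\<exists>k\<in>set [0..7]. \<exists>k'\<in>set [k, k + 1].
     let p = lift_im k k' (zadd m (zneg b)); q = lift_im k k' (zadd c (zneg m)) in
     im_zero p \<and> re_pos p \<and> im_zero q \<and> re_pos q)"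

lemma re_pos: "re_pos z \<Longrightarrow> Re (den z) > 0"
  using im_pos[of "zrot 2 z"] by (simp add: re_pos_def den_zrot xi_power2)

lemma strictly_between_open_segment:
  assumes "strictly_between b m c"
  shows "den m \<in> open_segment (den b) (den c)"
proof -
  obtain k k' where
    im: "im_zero (lift_im k k' (zadd m (zneg b)))" "im_zero (lift_im k k' (zadd c (zneg m)))" and
    re: "re_pos (lift_im k k' (zadd m (zneg b)))" "re_pos (lift_im k k' (zadd c (zneg m)))"
    using assms unfolding strictly_between_def Let_def by blast
  note * = im[THEN im_zero] re[THEN re_pos]
  define w where "w = xi powi k + xi powi k'"
  have wd: "den (lift_im k k' (zadd x (zneg y))) = w * (den x - den y)" for x y
    by (simp add: den_lift_im w_def den_zadd den_zneg)
  define p q where "p = Re (w * (den m - den b))" and "q = Re (w * (den c - den m))"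
  have pq: "w * (den m - den b) = of_real p" "w * (den c - den m) = of_real q" "p > 0" "q > 0"
    using * unfolding wd p_def q_def by (simp_all add: complex_eq_iff)
  have w: "w \<noteq> 0" using pq by auto
  have "w * (den m - ((1 - p / (p + q)) *\<^sub>R den b + (p / (p + q)) *\<^sub>R den c)) = 0"
  proof -
    have "w * (den m - ((1 - p / (p + q)) *\<^sub>R den b + (p / (p + q)) *\<^sub>R den c)) =
      w * (den m - den b) - of_real (p / (p + q)) * (w * (den m - den b) + w * (den c - den m))"
      by (simp add: scaleR_conv_of_real algebra_simps)
    also have "\<dots> = of_real (p - p / (p + q) * (p + q))"
      unfolding pq by (simp only: of_real_add of_real_mult of_real_diff)
    also have "\<dots> = 0" using pq(3,4) by simp
    finally show ?thesis .
  qed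
  then have "den m = (1 - p / (p + q)) *\<^sub>R den b + (p / (p + q)) *\<^sub>R den c" using w by simp
  moreover have "den b \<noteq> den c"
  proof
    assume "den b = den c"
    then have "w * (den m - den b) + w * (den c - den m) = 0" by (simp add: algebra_simps)
    then have "complex_of_real p + complex_of_real q = 0" unfolding pq .
    then have "complex_of_real (p + q) = 0" by (simp only: of_real_add)
    then have "p + q = 0" by (simp only: of_real_eq_0_iff)
    then show False using pq by simp
  qed
  moreover have "0 < p / (p + q)" "p / (p + q) < 1" using pq by simp_all
  ultimately show ?thesis unfolding in_segment by blast
qed

text \<open>Certificates for dissections of a triangle: a \<open>Cut\<close> runs from the apex
  \<open>a\<close> to the point \<open>m\<close> of the opposite side \<open>b c\<close>. Validity
  compares bases as sets, so each subtree may choose its own apex.\<close>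

datatype cut = Piece zx zx zx | Cut zx zx zx zx cut cut

fun cut_base :: "cut \<Rightarrow> zx list" where
  "cut_base (Piece a b c) = [a, b, c]"
| "cut_base (Cut a b m c s t) = [a, b, c]"

fun cut_valid :: "cut \<Rightarrow> bool" where
  "cut_valid (Piece a b c) = True"
| "cut_valid (Cut a b m c s t) \<longleftrightarrow> strictly_between b m c \<and> m \<noteq> a \<and>
     set (cut_base s) = {a, b, m} \<and> set (cut_base t) = {a, m, c} \<and> cut_valid s \<and> cut_valid t"

fun cut_pieces :: "cut \<Rightarrow> zx list list" where
  "cut_pieces (Piece a b c) = [[a, b, c]]"
| "cut_pieces (Cut a b m c s t) = cut_pieces s @ cut_pieces t"

definition zhull :: "zx set \<Rightarrow> complex set" where
  "zhull V = convex hull (den ` V)"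

lemma cut_Union: "cut_valid s \<Longrightarrow> zhull (set (cut_base s)) = (\<Union>V\<in>set (cut_pieces s). zhull (set V))"
proof (induction s)
  case (Cut a b m c s t)
  then have m: "den m \<in> closed_segment (den b) (den c)"
    using strictly_between_open_segment[of b m c] subsetD[OF segment_open_subset_closed] by auto
  then show ?case using Cut triangle_cut[OF m, of "den a"] by (simp add: zhull_def)
qed simp

lemma cut_disjoint:
  "cut_valid s \<Longrightarrow> U \<in> set (cut_pieces s) \<Longrightarrow> V \<in> set (cut_pieces s) \<Longrightarrow> set U \<noteq> set V \<Longrightarrow>
    interior (zhull (set U)) \<inter> interior (zhull (set V)) = {}"
proof (induction s)
  case (Cut a b m c s t)
  have "den m \<in> open_segment (den b) (den c)" "den m \<noteq> den a"
    using Cut.prems(1) by (auto simp: strictly_between_open_segment den_inject)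
  from triangle_cut_interior[OF this]
  have st: "interior (zhull (set (cut_base s))) \<inter> interior (zhull (set (cut_base t))) = {}"
    using Cut.prems(1) by (simp add: zhull_def)
  have sub: "interior (zhull (set U)) \<subseteq> interior (zhull (set (cut_base r)))" if "cut_valid r" "U \<in> set (cut_pieces r)" for U r
    unfolding cut_Union[OF that(1)] using that(2) by (intro interior_mono) blast
  consider "U \<in> set (cut_pieces s)" "V \<in> set (cut_pieces s)" | "U \<in> set (cut_pieces t)" "V \<in> set (cut_pieces t)"
    | "U \<in> set (cut_pieces s)" "V \<in> set (cut_pieces t)" | "U \<in> set (cut_pieces t)" "V \<in> set (cut_pieces s)"
    using Cut.prems(2,3) by auto
  then show ?case
  proof cases
    case 3
    then show ?thesis using st sub[of s U] sub[of t V] Cut.prems(1) by auto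
  next
    case 4
    then show ?thesis using st sub[of t U] sub[of s V] Cut.prems(1) by auto
  qed (use Cut in auto)
qed simp

fun dual_cut :: "proto \<Rightarrow> cut" where
  "dual_cut Rhomb =
    (Cut (Zx (- 6) (- 6) (- 2) 2) (Zx (- 6) (- 14) (- 14) (- 6)) (Zx (- 2) (- 6) (- 6) (- 2)) (Zx (- 2) (- 4) (- 4) (- 2))
      (Cut (Zx (- 2) (- 6) (- 6) (- 2)) (Zx (- 6) (- 6) (- 2) 2) (Zx (- 6) (- 10) (- 10) (- 2)) (Zx (- 6) (- 14) (- 14) (- 6))
      (Cut (Zx (- 2) (- 6) (- 6) (- 2)) (Zx (- 6) (- 6) (- 2) 2) (Zx (- 6) (- 8) (- 6) 0) (Zx (- 6) (- 10) (- 10) (- 2))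
      (Piece (Zx (- 2) (- 6) (- 6) (- 2)) (Zx (- 6) (- 6) (- 2) 2) (Zx (- 6) (- 8) (- 6) 0))
      (Piece (Zx (- 2) (- 6) (- 6) (- 2)) (Zx (- 6) (- 8) (- 6) 0) (Zx (- 6) (- 10) (- 10) (- 2))))
      (Cut (Zx (- 6) (- 10) (- 10) (- 2)) (Zx (- 6) (- 14) (- 14) (- 6)) (Zx (- 4) (- 10) (- 10) (- 4)) (Zx (- 2) (- 6) (- 6) (- 2))
      (Piece (Zx (- 6) (- 10) (- 10) (- 2)) (Zx (- 6) (- 14) (- 14) (- 6)) (Zx (- 4) (- 10) (- 10) (- 4)))
      (Piece (Zx (- 6) (- 10) (- 10) (- 2)) (Zx (- 4) (- 10) (- 10) (- 4)) (Zx (- 2) (- 6) (- 6) (- 2)))))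
      (Piece (Zx (- 6) (- 6) (- 2) 2) (Zx (- 2) (- 6) (- 6) (- 2)) (Zx (- 2) (- 4) (- 4) (- 2))))"
| "dual_cut Tri =
    (Cut (Zx (- 14) (- 6) 6 14) (Zx (- 6) 0 6 8) (Zx (- 6) 2 10 10) (Zx (- 6) 6 14 14)
      (Cut (Zx (- 6) 2 10 10) (Zx (- 14) (- 6) 6 14) (Zx (- 10) (- 2) 6 10) (Zx (- 6) 0 6 8)
      (Cut (Zx (- 10) (- 2) 6 10) (Zx (- 6) 2 10 10) (Zx (- 10) (- 2) 8 12) (Zx (- 14) (- 6) 6 14)
      (Piece (Zx (- 10) (- 2) 6 10) (Zx (- 6) 2 10 10) (Zx (- 10) (- 2) 8 12))
      (Piece (Zx (- 10) (- 2) 6 10) (Zx (- 10) (- 2) 8 12) (Zx (- 14) (- 6) 6 14)))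
      (Piece (Zx (- 6) 2 10 10) (Zx (- 10) (- 2) 6 10) (Zx (- 6) 0 6 8)))
      (Cut (Zx (- 6) 2 10 10) (Zx (- 6) 6 14 14) (Zx (- 8) 2 12 14) (Zx (- 14) (- 6) 6 14)
      (Piece (Zx (- 6) 2 10 10) (Zx (- 6) 6 14 14) (Zx (- 8) 2 12 14))
      (Cut (Zx (- 6) 2 10 10) (Zx (- 8) 2 12 14) (Zx (- 10) (- 2) 10 14) (Zx (- 14) (- 6) 6 14)
      (Piece (Zx (- 6) 2 10 10) (Zx (- 8) 2 12 14) (Zx (- 10) (- 2) 10 14))
      (Cut (Zx (- 10) (- 2) 10 14) (Zx (- 14) (- 6) 6 14) (Zx (- 10) (- 2) 8 12) (Zx (- 6) 2 10 10)
      (Piece (Zx (- 10) (- 2) 10 14) (Zx (- 14) (- 6) 6 14) (Zx (- 10) (- 2) 8 12))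
      (Piece (Zx (- 10) (- 2) 10 14) (Zx (- 10) (- 2) 8 12) (Zx (- 6) 2 10 10))))))"

text \<open>Leaves and dual rule are compared by vertex sets. The one evaluation thus yields both
  that the pieces fill the inflated tile and that their interiors are disjoint.\<close>

lemma dual_cut:
  "\<forall>j\<in>set [Rhomb, Tri]. cut_valid (dual_cut j) \<and> set (cut_base (dual_cut j)) = zlam ` set (dual_vertices j) \<and>
     set ` set (cut_pieces (dual_cut j)) = (\<lambda>(i, f). zact f ` set (dual_vertices i)) ` set (dual_rule j)"
  by code_simp

lemmas dual_cut_valid = dual_cut[unfolded all_proto, THEN spec, THEN conjunct1]
lemmas dual_cut_base = dual_cut[unfolded all_proto, THEN spec, THEN conjunct2, THEN conjunct1]
lemmas dual_cut_pieces = dual_cut[unfolded all_proto, THEN spec, THEN conjunct2, THEN conjunct2]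

text \<open>\<open>cut_disjoint\<close> separates pieces with different vertex sets; this carries
  the separation over to different entries of the rule.\<close>

lemma dual_pieces_distinct:
  "\<forall>j\<in>set [Rhomb, Tri]. \<forall>(i, f)\<in>set (dual_rule j). \<forall>(i', f')\<in>set (dual_rule j).
     zact f ` set (dual_vertices i) = zact f' ` set (dual_vertices i') \<longrightarrow> (i, f) = (i', f')"
  by code_simp

section \<open>The polygons solve the two systems\<close>

lemma scale_dual_tile: "(*) (of_real lam) ` dual_tile j = zhull (zlam ` set (dual_vertices j))"
proof -
  have "linear ((*) (complex_of_real lam))" by (rule linear_times)
  then show ?thesis by (simp add: dual_tile_def zhull_def convex_hull_linear_image image_image den_zlam)
qed

lemma dual_pieces:
  "(\<lambda>V. zhull (set V)) ` set (cut_pieces (dual_cut j)) = (\<lambda>(i, f). mact f ` dual_tile i) ` set (dual_rule j)"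
proof -
  have "(\<lambda>V. zhull (set V)) ` set (cut_pieces (dual_cut j)) = zhull ` set ` set (cut_pieces (dual_cut j))"
    by (simp add: image_image)
  also have "set ` set (cut_pieces (dual_cut j)) = (\<lambda>(i, f). zact f ` set (dual_vertices i)) ` set (dual_rule j)"
    by (rule dual_cut_pieces)
  finally show ?thesis by (simp add: image_image split_def zhull_def mact_dual_tile)
qed

lemma dual_tile_eq: "(*) (of_real lam) ` dual_tile j = (\<Union>(i, f)\<in>set (dual_rule j). mact f ` dual_tile i)"
proof -
  have v: "cut_valid (dual_cut j)" "set (cut_base (dual_cut j)) = zlam ` set (dual_vertices j)"
    by (rule dual_cut_valid dual_cut_base dual_cut_pieces)+
  show ?thesis unfolding scale_dual_tile v(2)[symmetric] cut_Union[OF v(1)] dual_pieces by simp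
qed

lemma dual_tile_disjoint:
  assumes "(i, f) \<in> set (dual_rule j)" "(i', f') \<in> set (dual_rule j)" "(i, f) \<noteq> (i', f')"
  shows "interior (mact f ` dual_tile i) \<inter> interior (mact f' ` dual_tile i') = {}"
proof -
  have v: "cut_valid (dual_cut j)"
    "set ` set (cut_pieces (dual_cut j)) = (\<lambda>(i, f). zact f ` set (dual_vertices i)) ` set (dual_rule j)"
    by (rule dual_cut_valid dual_cut_base dual_cut_pieces)+
  have "\<exists>U\<in>set (cut_pieces (dual_cut j)). set U = zact f ` set (dual_vertices i)" if "(i, f) \<in> set (dual_rule j)" for i f
  proof -
    have "zact f ` set (dual_vertices i) \<in> set ` set (cut_pieces (dual_cut j))"
      unfolding v(2) by (rule rev_image_eqI[OF that]) simp
    then show ?thesis by (auto simp: image_iff)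
  qed
  then obtain U U' where U: "U \<in> set (cut_pieces (dual_cut j))" "set U = zact f ` set (dual_vertices i)"
    "U' \<in> set (cut_pieces (dual_cut j))" "set U' = zact f' ` set (dual_vertices i')"
    using assms(1,2) by meson
  have "set U \<noteq> set U'"
    using dual_pieces_distinct[unfolded all_proto ball_pair, rule_format, OF assms(1,2)] assms(3) unfolding U(2,4) by blast
  from cut_disjoint[OF v(1) U(1,3) this] show ?thesis
    unfolding U(2,4) by (simp add: zhull_def mact_dual_tile)
qed

lemma map_prod_Collect: "map_prod id m ` {(i, c f d) |i f d. P i f d} = {(i, m (c f d)) |i f d. P i f d}"
  by force

lemma UN_UN_image_comp:
  "(\<Union>(i, f)\<in>A. m f ` (\<Union>(i', d)\<in>B i. n d ` T i')) =
   (\<Union>(i', g)\<in>{(i', m f \<circ> n d) |i' f d. \<exists>i. (i, f) \<in> A \<and> (i', d) \<in> B i}. g ` T i')"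
proof (intro equalityI subsetI)
  fix x assume "x \<in> (\<Union>(i, f)\<in>A. m f ` (\<Union>(i', d)\<in>B i. n d ` T i'))"
  then obtain i f i' d y where *: "(i, f) \<in> A" "(i', d) \<in> B i" "y \<in> T i'" "x = m f (n d y)" by blast
  have "(i', m f \<circ> n d) \<in> {(i', m f \<circ> n d) |i' f d. \<exists>i. (i, f) \<in> A \<and> (i', d) \<in> B i}" using *(1,2) by blast
  moreover have "x \<in> (m f \<circ> n d) ` T i'" using *(3,4) by simp
  ultimately show "x \<in> (\<Union>(i', g)\<in>{(i', m f \<circ> n d) |i' f d. \<exists>i. (i, f) \<in> A \<and> (i', d) \<in> B i}. g ` T i')"
    by blast
next
  fix x assume "x \<in> (\<Union>(i', g)\<in>{(i', m f \<circ> n d) |i' f d. \<exists>i. (i, f) \<in> A \<and> (i', d) \<in> B i}. g ` T i')"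
  then obtain i f i' d y where "(i, f) \<in> A" "(i', d) \<in> B i" "y \<in> T i'" "x = m f (n d y)" by auto
  then show "x \<in> (\<Union>(i, f)\<in>A. m f ` (\<Union>(i', d)\<in>B i. n d ` T i'))" by blast
qed

lemma set_list_comp:
  "set [(i', c f d). (i, f) \<leftarrow> A, (i', d) \<leftarrow> B i] = {(i', c f d) |i' f d. \<exists>i. (i, f) \<in> set A \<and> (i', d) \<in> set (B i)}"
proof -
  have "set (case p of (i, f) \<Rightarrow> map (\<lambda>(i', d). (i', c f d)) (B i)) = {(i', c f d) |i' f d. \<exists>i. (i, f) = p \<and> (i', d) \<in> set (B i)}" for p
    by (cases p) auto
  then show ?thesis unfolding set_concat set_map image_image by (simp only:) blast
qed

lemma quarters_ab_rule_set:
  "{(i', mact f \<circ> mact d) |i' f d. \<exists>i. (i, f) \<in> set (ab_rule j) \<and> (i', d) \<in> set (quarters i)} =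
   {(i', mact (minfl d) \<circ> mact f) |i' d f. \<exists>i. (i, d) \<in> set (quarters j) \<and> (i', f) \<in> set (dual_rule i)}"
  (is "?L = ?R")
proof -
  let ?m = "map_prod id mact :: proto \<times> motion \<Rightarrow> _"
  have "?L = ?m ` {(i', mcomp f d) |i' f d. \<exists>i. (i, f) \<in> set (ab_rule j) \<and> (i', d) \<in> set (quarters i)}"
    unfolding mact_mcomp[symmetric] map_prod_Collect ..
  also have "{(i', mcomp f d) |i' f d. \<exists>i. (i, f) \<in> set (ab_rule j) \<and> (i', d) \<in> set (quarters i)} =
     set [(i', mcomp f d). (i, f) \<leftarrow> ab_rule j, (i', d) \<leftarrow> quarters i]" by (rule set_list_comp[symmetric])
  also have "\<dots> = set [(i', mcomp (minfl d) f). (i, d) \<leftarrow> quarters j, (i', f) \<leftarrow> dual_rule i]"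
    using quarters_ab_rule[unfolded all_proto] by simp
  also have "\<dots> = {(i', mcomp (minfl d) f) |i' d f. \<exists>i. (i, d) \<in> set (quarters j) \<and> (i', f) \<in> set (dual_rule i)}" by (rule set_list_comp)
  also have "?m ` \<dots> = ?R"
    unfolding mact_mcomp[symmetric] map_prod_Collect ..
  finally show ?thesis .
qed

text \<open>Quartering the pieces of the inflated tile gives the same dual tiles as dissecting its
  inflated quarters, and those dissections are already established.\<close>

lemma ab_tile_eq: "(*) (of_real lam) ` ab_tile j = (\<Union>(i, f)\<in>set (ab_rule j). mact f ` ab_tile i)"
proof -
  have infl: "(*) (of_real lam) ` mact d ` S = mact (minfl d) ` (*) (of_real lam) ` S" for d S
    by (simp add: image_image mact_minfl)
  have "(\<Union>(i, f)\<in>set (ab_rule j). mact f ` ab_tile i) =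
    (\<Union>(i', g)\<in>{(i', mact f \<circ> mact d) |i' f d. \<exists>i. (i, f) \<in> set (ab_rule j) \<and> (i', d) \<in> set (quarters i)}. g ` dual_tile i')"
    unfolding ab_tile_def by (rule UN_UN_image_comp)
  also have "\<dots> = (\<Union>(i, d)\<in>set (quarters j). mact (minfl d) ` (\<Union>(i', f)\<in>set (dual_rule i). mact f ` dual_tile i'))"
    unfolding quarters_ab_rule_set by (rule UN_UN_image_comp[symmetric])
  also have "\<dots> = (\<Union>(i, d)\<in>set (quarters j). (*) (of_real lam) ` mact d ` dual_tile i)"
    unfolding dual_tile_eq[symmetric] infl ..
  also have "\<dots> = (*) (of_real lam) ` ab_tile j"
    unfolding ab_tile_def by blast
  finally show ?thesis ..
qed

lemma hull_ab: "substitution_tilings ammann_beenker = hull_of ab_tile ab_rule"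
proof -
  have "ab_tile j \<noteq> {}" for j
    by (cases j) (auto simp: ab_tile_def dual_tile_def)
  then have "(*) (of_real 1) ` prototile ammann_beenker i = ab_tile i" for i
    by (intro prototile_unique[OF coded_ammann_beenker] compact_ab_tile ab_tile_eq) simp_all
  from scale_substitution_tilings[OF coded_ammann_beenker _ this] show ?thesis
    by (simp add: scale_1)
qed

lemma hull_dual: "scale_tiles (lam ^ 2) ` substitution_tilings (star_dual ammann_beenker) = hull_of dual_tile dual_rule"
proof -
  have "dual_tile j \<noteq> {}" for j
    by (cases j) (auto simp: dual_tile_def)
  then have "(*) (of_real (lam ^ 2)) ` prototile (star_dual ammann_beenker) i = dual_tile i" for i
    by (intro prototile_unique[OF coded_star_dual] compact_dual_tile dual_tile_eq) simp_all
  from scale_substitution_tilings[OF coded_star_dual _ this] show ?thesis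
    by simp
qed

section \<open>Patches, quarters and matching of edges\<close>

definition qset :: "(proto \<times> (complex \<Rightarrow> complex)) set \<Rightarrow> (proto \<times> (complex \<Rightarrow> complex)) set" where
  "qset S = {(i', g \<circ> mact d) |i' g d. \<exists>i. (i, g) \<in> S \<and> (i', d) \<in> set (quarters i)}"

text \<open>The n-fold form of \<open>quarters_ab_rule\<close>: a further step is added at the
  bottom, where each tile is dissected on its own, and is then exchanged for a step of the dual
  rule.\<close>

lemma qset_iter:
  "qset (iter ab_rule n j) =
    {(i', (infl ^^ n) (mact d) \<circ> g) |i' d g. \<exists>i. (i, d) \<in> set (quarters j) \<and> (i', g) \<in> iter dual_rule n i}"
proof (induction n)
  case 0
  then show ?case by (auto simp: qset_def)
next
  case (Suc n)
  have "qset (iter ab_rule (Suc n) j) =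
    {(i', infl g \<circ> mact f \<circ> mact d) |i' g f d. \<exists>i i''. (i, g) \<in> iter ab_rule n j \<and> (i'', f) \<in> set (ab_rule i) \<and> (i', d) \<in> set (quarters i'')}"
    unfolding qset_def iter_Suc_bottom by blast
  also have "\<dots> =
    {(i', infl g \<circ> (mact f \<circ> mact d)) |i' g f d. \<exists>i i''. (i, g) \<in> iter ab_rule n j \<and> (i'', f) \<in> set (ab_rule i) \<and> (i', d) \<in> set (quarters i'')}"
    by (simp only: comp_assoc)
  also have "\<dots> = {(i', infl g \<circ> h) |i' g h. \<exists>i. (i, g) \<in> iter ab_rule n j \<and>
      (i', h) \<in> {(i', mact f \<circ> mact d) |i' f d. \<exists>i''. (i'', f) \<in> set (ab_rule i) \<and> (i', d) \<in> set (quarters i'')}}"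
    by blast
  also have "\<dots> = {(i', infl g \<circ> (mact (minfl d) \<circ> mact f)) |i' g d f. \<exists>i i''. (i, g) \<in> iter ab_rule n j \<and>
      (i'', d) \<in> set (quarters i) \<and> (i', f) \<in> set (dual_rule i'')}"
    unfolding quarters_ab_rule_set by blast
  also have "\<dots> = {(i', infl (g \<circ> mact d) \<circ> mact f) |i' g d f. \<exists>i i''. (i, g) \<in> iter ab_rule n j \<and>
      (i'', d) \<in> set (quarters i) \<and> (i', f) \<in> set (dual_rule i'')}"
    by (simp only: infl_comp infl_mact comp_assoc)
  also have "\<dots> = {(i', infl h \<circ> mact f) |i' h f. \<exists>i. (i, h) \<in> qset (iter ab_rule n j) \<and> (i', f) \<in> set (dual_rule i)}"
    unfolding qset_def by blast
  also have "\<dots> = {(i', infl ((infl ^^ n) (mact d) \<circ> g) \<circ> mact f) |i' d g f. \<exists>i i''. (i, d) \<in> set (quarters j) \<and>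
      (i'', g) \<in> iter dual_rule n i \<and> (i', f) \<in> set (dual_rule i'')}"
    unfolding Suc.IH by blast
  also have "\<dots> = {(i', (infl ^^ Suc n) (mact d) \<circ> (infl g \<circ> mact f)) |i' d g f. \<exists>i i''. (i, d) \<in> set (quarters j) \<and>
      (i'', g) \<in> iter dual_rule n i \<and> (i', f) \<in> set (dual_rule i'')}"
    by (simp only: infl_comp comp_assoc funpow.simps comp_apply)
  also have "\<dots> = {(i', (infl ^^ Suc n) (mact d) \<circ> g) |i' d g. \<exists>i. (i, d) \<in> set (quarters j) \<and> (i', g) \<in> iter dual_rule (Suc n) i}"
    unfolding iter_Suc_bottom by blast
  finally show ?case .
qed

section \<open>Agreement of the two kinds of legal patches\<close>

primrec citer :: "rule \<Rightarrow> nat \<Rightarrow> proto \<Rightarrow> (proto \<times> motion) list" where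
  "citer R 0 j = [(j, mone)]"
| "citer R (Suc n) j = [(i', mcomp (minfl g) f). (i, g) \<leftarrow> citer R n j, (i', f) \<leftarrow> R i]"

lemma citer: "(i, g) \<in> set (citer R n j) \<Longrightarrow> (i, mact g) \<in> iter R n j"
proof (induction n arbitrary: i g)
  case (Suc n)
  then obtain i' h f where "g = mcomp (minfl h) f" "(i', h) \<in> set (citer R n j)" "(i, f) \<in> set (R i')"
    unfolding citer.simps set_list_comp by blast
  moreover from this have "mact g = infl (mact h) \<circ> mact f" by (simp add: mact_mcomp infl_mact)
  ultimately show ?case unfolding iter_Suc_bottom using Suc.IH by blast
qed simp

text \<open>This check and the next make the legal patches of the dual rule the same as those of
  quartered Ammann-Beenker iterates. The copy found must be a pure translate, since legality permits
  no rotations or reflections.\<close>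

lemma dual_in_quarters:
  "\<forall>i\<in>set [Rhomb, Tri]. \<exists>(i', g)\<in>set (citer ab_rule (Suc (Suc 0)) Rhomb). \<exists>(i'', d)\<in>set (quarters i').
     i'' = i \<and> mturn (mcomp g d) = 0 \<and> \<not> mflip (mcomp g d)"
  by code_simp

text \<open>The constant shifts are the displacements of one translated copy of the quartered tile
  inside the iterate named.\<close>

lemma quarters_in_dual:
  "\<forall>(i, d)\<in>set (quarters Rhomb). (i, mcomp (Mot 0 False (Zx (- 14) (- 6) 6 14)) d) \<in> set (citer dual_rule (Suc 0) Tri)"
  "\<forall>(i, d)\<in>set (quarters Tri). (i, mcomp (Mot 0 False (Zx (- 30) (- 50) (- 38) (- 6))) d) \<in> set (citer dual_rule (Suc (Suc (Suc 0))) Rhomb)"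
  by code_simp+

lemma mact_translation: "mturn g = 0 \<Longrightarrow> \<not> mflip g \<Longrightarrow> mact g = (\<lambda>x. den (mshift g) + x)"
  by (cases g) (simp add: fun_eq_iff)

lemma funpow_infl_translate: "(infl ^^ n) (\<lambda>x. z + h x) = (\<lambda>x. of_real (lam ^ n) * z + (infl ^^ n) h x)"
  by (simp add: fun_eq_iff funpow_infl distrib_left)

lemma placeE:
  assumes "t \<in> place B v S"
  obtains i g where "(i, g) \<in> S" "t = (\<lambda>x. v + g x) ` B i"
  using assms unfolding place_def by auto

lemma placeI: "(i, g) \<in> S \<Longrightarrow> (\<lambda>x. v + g x) ` B i \<in> place B v S"
  unfolding place_def by (rule image_eqI[of _ _ "(i, g)"]) simp_all

lemma place_subset:
  assumes "\<And>i g. (i, g) \<in> S \<Longrightarrow> (i, \<lambda>x. z + g x) \<in> T"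
  shows "place B v S \<subseteq> place B (v - z) T"
proof
  fix t assume "t \<in> place B v S"
  then obtain i g where g: "(i, g) \<in> S" "t = (\<lambda>x. v + g x) ` B i" by (rule placeE)
  have "t = (\<lambda>x. v - z + (z + g x)) ` B i" using g(2) by simp
  then show "t \<in> place B (v - z) T" using placeI[OF assms[OF g(1)], of "v - z" B] by simp
qed

text \<open>A translated copy of the starting configuration remains a translated copy under
  \<open>n\<close> more steps, its displacement \<open>z\<close> being stretched by
  \<open>lam ^ n\<close>.\<close>

lemma quarters_in_dual_place:
  "\<exists>v' n' i. place dual_tile v (qset (iter ab_rule n j)) \<subseteq> place dual_tile v' (iter dual_rule n' i)"
proof -
  obtain m i0 z where m: "\<And>i d. (i, d) \<in> set (quarters j) \<Longrightarrow> (i, \<lambda>x. z + mact d x) \<in> iter dual_rule m i0"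
  proof (cases j)
    case Rhomb
    have "(i, \<lambda>x. den (Zx (- 14) (- 6) 6 14) + mact d x) \<in> iter dual_rule (Suc 0) Tri" if "(i, d) \<in> set (quarters j)" for i d
      using citer[OF quarters_in_dual(1)[unfolded ball_pair, rule_format, OF that[unfolded Rhomb]]]
      by (simp add: mact_mcomp mact_translation comp_def del: iter.simps den.simps)
    then show thesis by (rule that)
  next
    case Tri
    have "(i, \<lambda>x. den (Zx (- 30) (- 50) (- 38) (- 6)) + mact d x) \<in> iter dual_rule (Suc (Suc (Suc 0))) Rhomb" if "(i, d) \<in> set (quarters j)" for i d
      using citer[OF quarters_in_dual(2)[unfolded ball_pair, rule_format, OF that[unfolded Tri]]]
      by (simp add: mact_mcomp mact_translation comp_def del: iter.simps den.simps)
    then show thesis by (rule that)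
  qed
  have "(i, \<lambda>x. of_real (lam ^ n) * z + h x) \<in> iter dual_rule (m + n) i0" if h: "(i, h) \<in> qset (iter ab_rule n j)" for i h
  proof -
    obtain i' d g where d: "(i', d) \<in> set (quarters j)" "(i, g) \<in> iter dual_rule n i'" "h = (infl ^^ n) (mact d) \<circ> g"
      using h unfolding qset_iter by blast
    have "(i, (infl ^^ n) (\<lambda>x. z + mact d x) \<circ> g) \<in> iter dual_rule (m + n) i0"
      by (rule iter_add[OF m[OF d(1)] d(2)])
    then show ?thesis by (simp add: d(3) funpow_infl_translate comp_def)
  qed
  from place_subset[of "qset (iter ab_rule n j)", OF this] show ?thesis by (intro exI)
qed

lemma dual_in_quarters_place:
  "\<exists>v' n' j. place dual_tile v (iter dual_rule n i) \<subseteq> place dual_tile v' (qset (iter ab_rule n' j))"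
proof -
  obtain i' a d where a: "(i', a) \<in> set (citer ab_rule (Suc (Suc 0)) Rhomb)" "(i, d) \<in> set (quarters i')"
    and t: "mturn (mcomp a d) = 0" "\<not> mflip (mcomp a d)"
    using dual_in_quarters[unfolded all_proto bex_pair, THEN spec, of i] by blast
  define z where "z = den (mshift (mcomp a d))"
  have z: "mact a \<circ> mact d = (\<lambda>x. z + x)"
    unfolding mact_mcomp[symmetric] z_def by (rule mact_translation[OF t])
  have "(i, mact a \<circ> mact d) \<in> qset (iter ab_rule (Suc (Suc 0)) Rhomb)"
    unfolding qset_def using citer[OF a(1)] a(2) by blast
  \<comment> \<open>\<open>qset_iter\<close> presents this quarter also as a tile of a dual iterate,
    a form that the dual rule can substitute further.\<close>
  then obtain i0 d0 g0 where g0: "(i0, d0) \<in> set (quarters Rhomb)" "(i, g0) \<in> iter dual_rule (Suc (Suc 0)) i0"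
    "mact a \<circ> mact d = (infl ^^ Suc (Suc 0)) (mact d0) \<circ> g0"
    unfolding qset_iter by blast
  have "(i', \<lambda>x. of_real (lam ^ n) * z + g x) \<in> qset (iter ab_rule (Suc (Suc 0) + n) Rhomb)"
    if g: "(i', g) \<in> iter dual_rule n i" for i' g
  proof -
    have "(i', (infl ^^ n) g0 \<circ> g) \<in> iter dual_rule (Suc (Suc 0) + n) i0"
      by (rule iter_add[OF g0(2) g])
    then have "(i', (infl ^^ (Suc (Suc 0) + n)) (mact d0) \<circ> ((infl ^^ n) g0 \<circ> g)) \<in> qset (iter ab_rule (Suc (Suc 0) + n) Rhomb)"
      unfolding qset_iter using g0(1) by blast
    also have "(infl ^^ (Suc (Suc 0) + n)) (mact d0) = (infl ^^ n) ((infl ^^ Suc (Suc 0)) (mact d0))"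
      by (subst add.commute) (simp only: funpow_add comp_apply)
    also have "(infl ^^ n) ((infl ^^ Suc (Suc 0)) (mact d0)) \<circ> ((infl ^^ n) g0 \<circ> g) = (infl ^^ n) (mact a \<circ> mact d) \<circ> g"
      unfolding g0(3) funpow_infl_comp by (simp only: comp_assoc)
    also have "\<dots> = (\<lambda>x. of_real (lam ^ n) * z + g x)"
      unfolding z using funpow_infl_translate[of n z id] by (simp add: fun_eq_iff funpow_infl)
    finally show ?thesis .
  qed
  from place_subset[of "iter dual_rule n i", OF this] show ?thesis by (intro exI)
qed

section \<open>Supports of iterates and packing\<close>

lemma iter_support:
  assumes eq: "\<And>j. (*) (of_real lam) ` B j = (\<Union>(i, g)\<in>set (R j). mact g ` B i)"
    and g: "(i, g) \<in> iter R n j"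
  shows "g ` B i \<subseteq> (*) (of_real (lam ^ n)) ` B j"
  using g
proof (induction n arbitrary: g j)
  case (Suc n)
  then obtain i' f g' where f: "(i', f) \<in> set (R j)" "(i, g') \<in> iter R n i'" "g = (infl ^^ n) (mact f) \<circ> g'" by auto
  have "g ` B i \<subseteq> (infl ^^ n) (mact f) ` (*) (of_real (lam ^ n)) ` B i'"
    unfolding f(3) image_comp[symmetric] by (intro image_mono Suc.IH f)
  also have "\<dots> = (*) (of_real (lam ^ n)) ` mact f ` B i'"
    unfolding image_image funpow_infl by (rule image_cong) simp_all
  also have "\<dots> \<subseteq> (*) (of_real (lam ^ n)) ` (*) (of_real lam) ` B j"
    unfolding eq using f(1) by (intro image_mono) blast
  also have "\<dots> = (*) (of_real (lam ^ Suc n)) ` B j"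
    unfolding image_image by (rule image_cong) simp_all
  finally show ?case .
qed simp

lemma interior_scale: "c \<noteq> 0 \<Longrightarrow> interior ((*) (of_real c) ` S) = (*) (of_real c :: complex) ` interior S"
  by (rule interior_injective_linear_image) (auto simp: linear_times inj_on_def)

text \<open>Tiles from one first-level piece are separated by induction, tiles from different pieces
  by the disjoint interiors of the inflated pieces. Different tiles rather than different maps are
  assumed because an isosceles tile has two placements.\<close>

lemma dual_iter_disjoint:
  assumes "(i, g) \<in> iter dual_rule n j" "(i', g') \<in> iter dual_rule n j" "g ` dual_tile i \<noteq> g' ` dual_tile i'"
  shows "interior (g ` dual_tile i) \<inter> interior (g' ` dual_tile i') = {}"
  using assms
proof (induction n arbitrary: j g g')
  case 0
  then show ?case by simp
next
  case (Suc n)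
  obtain i1 f h where f: "(i1, f) \<in> set (dual_rule j)" "(i, h) \<in> iter dual_rule n i1" "g = (infl ^^ n) (mact f) \<circ> h"
    using Suc.prems(1) by auto
  obtain i1' f' h' where f': "(i1', f') \<in> set (dual_rule j)" "(i', h') \<in> iter dual_rule n i1'" "g' = (infl ^^ n) (mact f') \<circ> h'"
    using Suc.prems(2) by auto
  show ?case
  proof (cases "(i1, f) = (i1', f')")
    case True
    have iso: "(infl ^^ n) (mact f) \<in> isom" by (intro isom_funpow_infl isom_mact)
    have "h ` dual_tile i \<noteq> h' ` dual_tile i'"
    proof
      assume "h ` dual_tile i = h' ` dual_tile i'"
      then have "g ` dual_tile i = g' ` dual_tile i'"
        using True unfolding f(3) f'(3) image_comp[symmetric] by (simp only: prod.inject)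
      with Suc.prems(3) show False ..
    qed
    moreover have "(i', h') \<in> iter dual_rule n i1" using f'(2) True by simp
    ultimately have "interior (h ` dual_tile i) \<inter> interior (h' ` dual_tile i') = {}"
      by (intro Suc.IH[OF f(2)])
    moreover have "f' = f" using True by simp
    ultimately show ?thesis
      unfolding f(3) f'(3) image_comp[symmetric] isom_interior[OF iso]
      by (simp only: isom_interior[OF iso] image_Int[OF isom_inj[OF iso], symmetric] image_empty)
  next
    case False
    have sub: "interior (((infl ^^ n) (mact f) \<circ> h) ` dual_tile i) \<subseteq> (*) (of_real (lam ^ n)) ` interior (mact f ` dual_tile i1)"
      if "(i, h) \<in> iter dual_rule n i1" for f h i i1
    proof -
      have "((infl ^^ n) (mact f) \<circ> h) ` dual_tile i \<subseteq> (infl ^^ n) (mact f) ` (*) (of_real (lam ^ n)) ` dual_tile i1"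
        unfolding image_comp[symmetric] by (intro image_mono iter_support[OF dual_tile_eq that])
      also have "\<dots> = (*) (of_real (lam ^ n)) ` mact f ` dual_tile i1"
        unfolding image_image funpow_infl by (rule image_cong) simp_all
      finally show ?thesis
        using interior_scale[of "lam ^ n" "mact f ` dual_tile i1"] interior_mono by (metis lam_nonzero power_not_zero)
    qed
    have "inj ((*) (complex_of_real (lam ^ n)))" by (simp add: inj_on_def)
    then have "(*) (of_real (lam ^ n)) ` interior (mact f ` dual_tile i1) \<inter> (*) (of_real (lam ^ n)) ` interior (mact f' ` dual_tile i1') = {}"
      using dual_tile_disjoint[OF f(1) f'(1) False] by (metis image_Int image_empty)
    then show ?thesis using sub[OF f(2), of f] sub[OF f'(2), of f'] unfolding f(3) f'(3) by blast
  qed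
qed

lemma quarters_packing:
  assumes y: "y \<in> place dual_tile v (qset (iter ab_rule n j))" "y' \<in> place dual_tile v (qset (iter ab_rule n j))" "y \<noteq> y'"
  shows "interior y \<inter> interior y' = {}"
proof -
  obtain v' n' i0 where "place dual_tile v (qset (iter ab_rule n j)) \<subseteq> place dual_tile v' (iter dual_rule n' i0)"
    using quarters_in_dual_place by blast
  then have y': "y \<in> place dual_tile v' (iter dual_rule n' i0)" "y' \<in> place dual_tile v' (iter dual_rule n' i0)"
    using y by blast+
  obtain i g where g1: "(i, g) \<in> iter dual_rule n' i0" "y = (\<lambda>x. v' + g x) ` dual_tile i"
    using y'(1) by (rule placeE)
  obtain i' g' where g2: "(i', g') \<in> iter dual_rule n' i0" "y' = (\<lambda>x. v' + g' x) ` dual_tile i'"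
    using y'(2) by (rule placeE)
  have y: "y = (+) v' ` g ` dual_tile i" "y' = (+) v' ` g' ` dual_tile i'"
    by (simp_all add: g1 g2 image_image)
  then have "interior (g ` dual_tile i) \<inter> interior (g' ` dual_tile i') = {}"
    using assms(3) by (intro dual_iter_disjoint[OF g1(1) g2(1)]) metis
  then show ?thesis unfolding y interior_translation by auto
qed

text \<open>An edge on the boundary of the patch: the whole inflated prototile lies on the tile's
  side of the line through the edge. This form passes through further inflation, and a single point
  of the prototile beyond the line refutes it.\<close>

definition outer_edge :: "nat \<Rightarrow> proto \<Rightarrow> (complex \<Rightarrow> complex) \<Rightarrow> motion \<Rightarrow> bool" where
  "outer_edge n j g e \<longleftrightarrow> (\<forall>p\<in>ab_tile j. \<exists>z. Im z \<ge> 0 \<and> of_real (lam ^ n) * p = g (mact e z))"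

lemma mact_mcj: "mact mcj = cnj"
  by (simp add: fun_eq_iff mcj_def)

lemma outer_edge_0:
  assumes "(\<kappa>, e) \<in> set (edges j)"
  shows "outer_edge 0 j id e"
  unfolding outer_edge_def
proof
  fix p assume "p \<in> ab_tile j"
  then obtain i d where d: "(i, d) \<in> set (quarters j)" "p \<in> mact d ` dual_tile i" unfolding ab_tile_def by auto
  have iso: "mact (minv e) \<in> isom" by (rule isom_mact)
  have "Im (den (zact (minv e) (zact d q))) \<ge> 0" if "q \<in> set (dual_vertices i)" for q
    using edges_halfplane[unfolded all_proto ball_pair Let_def, rule_format, OF assms d(1) that]
    by (auto dest: im_pos im_zero)
  then have "mact (minv e) ` mact d ` dual_tile i \<subseteq> {x. Im x \<ge> 0}"
    unfolding mact_dual_tile isom_convex_hull[OF iso] by (intro hull_minimal) (auto simp: den_zact convex_halfspace_Im_ge)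
  then have "Im (mact (minv e) p) \<ge> 0" using d(2) by blast
  moreover have "mact e (mact (minv e) p) = p" using mact_minv(2)[of e] by (metis comp_apply id_apply)
  ultimately show "\<exists>z. Im z \<ge> 0 \<and> of_real (lam ^ 0) * p = id (mact e z)"
    by (intro exI[of _ "mact (minv e) p"]) simp
qed

definition matched :: "(proto \<times> (complex \<Rightarrow> complex)) set \<Rightarrow> (complex \<Rightarrow> complex) \<Rightarrow> edge \<Rightarrow> motion \<Rightarrow> bool" where
  "matched S g \<kappa> e \<longleftrightarrow> (\<exists>i' g' \<kappa>' e'. (i', g') \<in> S \<and> (\<kappa>', e') \<in> set (edges i') \<and> matching \<kappa> \<kappa>' \<and>
     g' \<circ> mact e' = g \<circ> mact e \<circ> cnj)"

text \<open>Subedge frames act as the identity or as \<open>b - cnj z\<close> with \<open>b\<close>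
  real, and both preserve the upper half plane.\<close>

lemma subedge_halfplane:
  assumes "(\<kappa>', s) \<in> set (subedges \<kappa>)" "Im y \<ge> 0"
  shows "\<exists>z. Im z \<ge> 0 \<and> mact s z = y"
proof -
  have s: "s = Mot 0 False (Zx 0 0 0 0) \<or> s = Mot 4 True (Zx 12 8 0 (- 8)) \<or> s = Mot 4 True (Zx 16 12 0 (- 12))"
    using subedges_motions[OF assms(1)] by simp
  have "\<exists>z. Im z \<ge> 0 \<and> mact (Mot 4 True b) z = y" if "im_zero b" for b
    by (rule exI[of _ "cnj (den b - y)"]) (use im_zero[OF that] assms(2) in \<open>simp add: xi_power4\<close>)
  moreover have "im_zero (Zx 12 8 0 (- 8))" "im_zero (Zx 16 12 0 (- 12))" by (simp_all add: im_zero_def)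
  moreover have "\<exists>z. Im z \<ge> 0 \<and> mact (Mot 0 False (Zx 0 0 0 0)) z = y" using assms(2) by (intro exI[of _ y]) simp
  ultimately show ?thesis using s by blast
qed

lemma infl_cnj: "infl cnj = cnj"
  by (simp add: fun_eq_iff infl_def)

text \<open>A new edge lies inside its inflated parent, next to another piece, or is a subedge of an
  inflated edge of the parent. In the second case the alternative is inherited: matching edges are
  subdivided identically on both sides, and a subedge of a boundary edge lies on the same boundary
  line.\<close>

lemma edge_matched_or_outer:
  assumes "(i, g) \<in> iter ab_rule n j" "(\<kappa>, e) \<in> set (edges i)"
  shows "matched (iter ab_rule n j) g \<kappa> e \<or> outer_edge n j g e"
  using assms
proof (induction n arbitrary: i g \<kappa> e)
  case 0
  then have "i = j" "g = id" by simp_all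
  then show ?case using outer_edge_0 0(2) by blast
next
  case (Suc n)
  obtain i0 g0 f where f: "(i0, g0) \<in> iter ab_rule n j" "(i, f) \<in> set (ab_rule i0)" "g = infl g0 \<circ> mact f"
    using Suc.prems(1) unfolding iter_Suc_bottom by blast
  consider (inner) i' f' \<kappa>' e' where "(i', f') \<in> set (ab_rule i0)" "(\<kappa>', e') \<in> set (edges i')" "matching \<kappa> \<kappa>'"
      "mcomp f' e' = mcomp f (mcomp e mcj)"
    | (border) \<kappa>0 e0 s where "(\<kappa>0, e0) \<in> set (edges i0)" "(\<kappa>, s) \<in> set (subedges \<kappa>0)" "mcomp f e = mcomp (minfl e0) s"
    using edges_subdivided[unfolded all_proto ball_pair bex_pair, THEN spec, of i0] f(2) Suc.prems(2) by blast
  then show ?case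
  proof cases
    case inner
    have "(i', infl g0 \<circ> mact f') \<in> iter ab_rule (Suc n) j"
      unfolding iter_Suc_bottom using f(1) inner(1) by blast
    moreover have "(infl g0 \<circ> mact f') \<circ> mact e' = g \<circ> mact e \<circ> cnj"
    proof -
      have "mact f' \<circ> mact e' = mact f \<circ> (mact e \<circ> cnj)"
        using arg_cong[OF inner(4), of mact] unfolding mact_mcomp mact_mcj .
      then show ?thesis unfolding f(3) by (simp only: comp_assoc)
    qed
    ultimately show ?thesis unfolding matched_def using inner(2,3) by blast
  next
    case border
    have fe: "mact f \<circ> mact e = infl (mact e0) \<circ> mact s"
      using arg_cong[OF border(3), of mact] unfolding mact_mcomp infl_mact .
    \<comment> \<open>\<open>cnj\<close> changes the side of an edge. As it commutes with the
      subedge frames, mirrored frames have mirrored subedges.\<close>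
    have scj: "mact s \<circ> cnj = cnj \<circ> mact s"
      using arg_cong[OF subedges_motions[OF border(2), THEN conjunct1], of mact] unfolding mact_mcomp mact_mcj .
    from Suc.IH[OF f(1) border(1)] show ?thesis
    proof
      assume "matched (iter ab_rule n j) g0 \<kappa>0 e0"
      then obtain i0' g0' \<kappa>0' e0' where m: "(i0', g0') \<in> iter ab_rule n j" "(\<kappa>0', e0') \<in> set (edges i0')"
        "matching \<kappa>0 \<kappa>0'" "g0' \<circ> mact e0' = g0 \<circ> mact e0 \<circ> cnj"
        unfolding matched_def by blast
      have "(\<kappa>, s) \<in> set (subedges \<kappa>0')" using border(2) subedges_matching(1)[OF m(3)] by simp
      then obtain i' f' where f': "(i', f') \<in> set (ab_rule i0')"
          "(\<kappa>, mcomp (mcomp (minv f') (minfl e0')) s) \<in> set (edges i')"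
        using subedges_edges[unfolded all_proto ball_pair bex_pair, THEN spec, of i0'] m(2) by blast
      let ?e' = "mcomp (mcomp (minv f') (minfl e0')) s"
      have "mact f' \<circ> mact ?e' = (mact f' \<circ> mact (minv f')) \<circ> (infl (mact e0') \<circ> mact s)"
        by (simp only: mact_mcomp infl_mact comp_assoc)
      then have fe': "mact f' \<circ> mact ?e' = infl (mact e0') \<circ> mact s"
        by (simp only: mact_minv id_comp)
      have "(infl g0' \<circ> mact f') \<circ> mact ?e' = infl (g0' \<circ> mact e0') \<circ> mact s"
        by (simp only: comp_assoc fe' infl_comp)
      also have "\<dots> = infl g0 \<circ> infl (mact e0) \<circ> (cnj \<circ> mact s)"
        unfolding m(4) by (simp only: infl_comp infl_cnj comp_assoc)
      also have "\<dots> = infl g0 \<circ> (mact f \<circ> mact e) \<circ> cnj"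
        unfolding fe scj[symmetric] by (simp only: comp_assoc)
      also have "\<dots> = g \<circ> mact e \<circ> cnj" unfolding f(3) by (simp only: comp_assoc)
      finally have eq: "(infl g0' \<circ> mact f') \<circ> mact ?e' = g \<circ> mact e \<circ> cnj" .
      have "(i', infl g0' \<circ> mact f') \<in> iter ab_rule (Suc n) j"
        unfolding iter_Suc_bottom using m(1) f'(1) by blast
      then have "matched (iter ab_rule (Suc n) j) g \<kappa> e"
        unfolding matched_def using f'(2) eq subedges_matching(2)[OF border(2)] by blast
      then show ?thesis ..
    next
      assume outer: "outer_edge n j g0 e0"
      have "outer_edge (Suc n) j g e"
        unfolding outer_edge_def
      proof
        fix p assume "p \<in> ab_tile j"
        then obtain z where z: "Im z \<ge> 0" "of_real (lam ^ n) * p = g0 (mact e0 z)"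
          using outer unfolding outer_edge_def by blast
        then have "Im (of_real lam * z) \<ge> 0" using lam_pos by (simp add: less_imp_le)
        then obtain z' where z': "Im z' \<ge> 0" "mact s z' = of_real lam * z" using subedge_halfplane[OF border(2)] by blast
        have "g (mact e z') = infl g0 ((mact f \<circ> mact e) z')" by (simp add: f(3))
        also have "\<dots> = infl g0 (infl (mact e0) (of_real lam * z))" by (simp add: fe z'(2))
        also have "\<dots> = of_real lam * g0 (mact e0 z)" by (simp add: infl_def)
        also have "\<dots> = of_real (lam ^ Suc n) * p" by (simp flip: z(2))
        finally show "\<exists>z. Im z \<ge> 0 \<and> of_real (lam ^ Suc n) * p = g (mact e z)" using z'(1) by metis
      qed
      then show ?thesis ..
    qed
  qed
qed

lemma not_outer_edge:
  assumes g: "g \<in> isom" and q: "g (den q) \<in> (*) (of_real (lam ^ n)) ` ab_tile j"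
    and neg: "im_pos (zneg (zact (minv e) q))"
  shows "\<not> outer_edge n j g e"
proof
  assume "outer_edge n j g e"
  then obtain z where z: "Im z \<ge> 0" "g (den q) = g (mact e z)" using q unfolding outer_edge_def by auto
  then have "den q = mact e z" using isom_inj[OF g] by (simp add: inj_eq)
  then have "mact (minv e) (den q) = z" using mact_minv(1)[of e] by (metis comp_apply id_apply)
  then show False using im_neg[OF neg] z(1) by (simp add: den_zact)
qed

lemma matching_edges:
  "matching ELegP \<kappa> \<Longrightarrow> (\<kappa>, e) \<in> set (edges i) \<Longrightarrow> i = Rhomb"
  "matching EHyp \<kappa> \<Longrightarrow> (\<kappa>, e) \<in> set (edges i) \<Longrightarrow> i = Tri \<and> e = edgeH"
  by (cases i; auto simp: edgeH_def)+

lemma across_legP: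
  assumes g: "(Tri, g) \<in> iter ab_rule n j" and e: "\<not> outer_edge n j g edgeP"
  shows "(Rhomb, g \<circ> mact wit1) \<in> qset (iter ab_rule n j)"
proof -
  obtain i' g' \<kappa>' e' where m: "(i', g') \<in> iter ab_rule n j" "(\<kappa>', e') \<in> set (edges i')" "matching ELegP \<kappa>'"
     "g' \<circ> mact e' = g \<circ> mact edgeP \<circ> cnj"
    using edge_matched_or_outer[OF g motion_data(4)] e unfolding matched_def by blast
  have i': "i' = Rhomb" by (rule matching_edges(1)[OF m(3,2)])
  then have "(Rhomb, mcomp e' qedge) \<in> set (quarters Rhomb)"
    using motion_data(6)[unfolded ball_pair] m(2) by blast
  then have "(Rhomb, g' \<circ> mact (mcomp e' qedge)) \<in> qset (iter ab_rule n j)"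
    unfolding qset_def using m(1) i' by blast
  moreover have "g' \<circ> mact (mcomp e' qedge) = g \<circ> mact wit1"
  proof -
    have "g' \<circ> mact (mcomp e' qedge) = (g' \<circ> mact e') \<circ> mact qedge" by (simp only: mact_mcomp comp_assoc)
    also have "\<dots> = g \<circ> mact (mcomp edgeP (mcomp mcj qedge))"
      unfolding m(4) by (simp only: mact_mcomp mact_mcj comp_assoc)
    finally show ?thesis unfolding motion_data(1) .
  qed
  ultimately show ?thesis by simp
qed

text \<open>Both hypotenuses run from \<open>Q\<close> to \<open>P\<close>. Agreement of the
  orientations forces the neighbour to be the mirror image and excludes the triangle rotated by pi,
  so the corner \<open>P\<close> is common.\<close>

lemma across_hyp:
  assumes g: "(Tri, g) \<in> iter ab_rule n j" and e: "\<not> outer_edge n j g edgeH"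
  shows "(Tri, g \<circ> mact flipH) \<in> iter ab_rule n j"
proof -
  obtain i' g' \<kappa>' e' where m: "(i', g') \<in> iter ab_rule n j" "(\<kappa>', e') \<in> set (edges i')" "matching EHyp \<kappa>'"
     "g' \<circ> mact e' = g \<circ> mact edgeH \<circ> cnj"
    using edge_matched_or_outer[OF g motion_data(5)] e unfolding matched_def by blast
  have i': "i' = Tri" "e' = edgeH" using matching_edges(2)[OF m(3,2)] by simp_all
  have "g' \<circ> mact edgeH = g \<circ> mact (mcomp edgeH mcj)"
    using m(4) unfolding i' by (simp only: mact_mcomp mact_mcj comp_assoc)
  also have "\<dots> = g \<circ> mact flipH \<circ> mact edgeH" unfolding motion_data(3) by (simp only: mact_mcomp comp_assoc)
  finally have "g' \<circ> (mact edgeH \<circ> mact (minv edgeH)) = g \<circ> mact flipH \<circ> (mact edgeH \<circ> mact (minv edgeH))"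
    by (simp only: comp_assoc[symmetric])
  then have "g' = g \<circ> mact flipH" by (simp only: mact_minv comp_id)
  then show ?thesis using m(1) i' by simp
qed

lemma outer_edge_comp: "outer_edge n j (g \<circ> mact a) e \<longleftrightarrow> outer_edge n j g (mcomp a e)"
  by (simp add: outer_edge_def mact_mcomp)

text \<open>The sample point lies beyond the edge to be crossed, so that edge is not on the boundary
  of a patch covering the point. For \<open>wit2\<close> two edges are crossed: the hypotenuse, then
  the leg \<open>V P\<close> of the mirrored triangle.\<close>

lemma witness_in_qset:
  assumes g: "(Tri, g) \<in> iter ab_rule n j" and w: "w \<in> {wit1, wit2}"
    and q: "g (mact w (den (inner_pt Rhomb))) \<in> (*) (of_real (lam ^ n)) ` ab_tile j"
  shows "(Rhomb, g \<circ> mact w) \<in> qset (iter ab_rule n j)"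
proof -
  have iso: "g \<in> isom" by (rule isom_iter[OF g])
  note no = not_outer_edge[OF iso q[folded den_zact]]
  show ?thesis
  proof (cases "w = wit1")
    case True
    then show ?thesis using across_legP[OF g] no[of edgeP] wit_outside(1) by simp
  next
    case False
    then have w2: "w = wit2" using w by simp
    have g': "(Tri, g \<circ> mact flipH) \<in> iter ab_rule n j"
      by (rule across_hyp[OF g no]) (simp only: w2 wit_outside)
    have "\<not> outer_edge n j g (mcomp flipH edgeP)"
      by (rule no) (simp only: w2 wit_outside)
    then have "(Rhomb, g \<circ> mact flipH \<circ> mact wit1) \<in> qset (iter ab_rule n j)"
      by (rule across_legP[OF g', unfolded outer_edge_comp])
    then show ?thesis unfolding w2 motion_data(2)[symmetric] mact_mcomp by (simp only: comp_assoc)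
  qed
qed

section \<open>Merging quarters\<close>

text \<open>The dual tiles whose presence identifies an Ammann-Beenker tile: a triangle needs, besides its
  halves, the rhombs behind the two legs at \<open>P\<close> of its square.\<close>

fun wits :: "proto \<Rightarrow> (proto \<times> motion) list" where
  "wits Rhomb = quarters Rhomb"
| "wits Tri = quarters Tri @ [(Rhomb, wit1), (Rhomb, wit2)]"

lemma quarters_wits: "set (quarters i) \<subseteq> set (wits i)"
  by (cases i) auto

lemma ab_syms_minv: "\<forall>i\<in>set [Rhomb, Tri]. \<forall>g\<in>set (ab_syms i). minv g \<in> set (ab_syms i)"
  by code_simp

lemma ab_syms_quarter:
  assumes "g \<in> set (ab_syms i)" "(i', d) \<in> set (quarters i)"
  obtains d' where "(i', d') \<in> set (quarters i)" "mact g ` mact d ` dual_tile i' = mact d' ` dual_tile i'"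
proof -
  obtain d' s where d': "(i', d') \<in> set (quarters i)" "s \<in> set (dual_syms i')" "mcomp g d = mcomp d' s"
    using ab_syms_quarters[unfolded all_proto ball_pair bex_pair, THEN spec, of i] assms by blast
  have "mact g ` mact d ` dual_tile i' = mact d' ` mact s ` dual_tile i'"
    using arg_cong[OF d'(3), of mact] unfolding mact_mcomp image_comp by simp
  also have "\<dots> = mact d' ` dual_tile i'" by (simp only: dual_tile_sym[OF d'(2)])
  finally show thesis by (rule that[OF d'(1)])
qed

lemma ab_tile_sym: 
  assumes "g \<in> set (ab_syms i)"
  shows "mact g ` ab_tile i = ab_tile i"
proof -
  have sub: "mact g ` ab_tile i \<subseteq> ab_tile i" if g: "g \<in> set (ab_syms i)" for g
  proof
    fix x assume "x \<in> mact g ` ab_tile i"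
    then obtain i' d where d: "(i', d) \<in> set (quarters i)" "x \<in> mact g ` mact d ` dual_tile i'"
      unfolding ab_tile_def by blast
    obtain d' where "(i', d') \<in> set (quarters i)" "mact g ` mact d ` dual_tile i' = mact d' ` dual_tile i'"
      using ab_syms_quarter[OF g d(1)] .
    with d(2) show "x \<in> ab_tile i" unfolding ab_tile_def by blast
  qed
  have "minv g \<in> set (ab_syms i)" using ab_syms_minv[unfolded all_proto] assms by blast
  then have "mact g ` mact (minv g) ` ab_tile i \<subseteq> mact g ` ab_tile i" by (intro image_mono sub)
  then have "ab_tile i \<subseteq> mact g ` ab_tile i" by (simp only: image_comp mact_minv image_id id_apply)
  with sub[OF assms] show ?thesis by (rule subset_antisym)
qed

lemma dual_tile_in_ab_tile: "(i', d) \<in> set (quarters i) \<Longrightarrow> (h \<circ> mact d) ` dual_tile i' \<subseteq> h ` ab_tile i"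
  unfolding ab_tile_def image_comp[symmetric] by (intro image_mono) blast

lemma in_ab_tile:
  assumes "x \<in> h ` ab_tile i"
  obtains i' d where "(i', d) \<in> set (quarters i)" "x \<in> (h \<circ> mact d) ` dual_tile i'"
  using assms unfolding ab_tile_def image_comp[symmetric] by blast

text \<open>The quarters depend on the tile only as a set: two placements differ by a symmetry from
  \<open>ab_syms\<close>, which permutes them.\<close>

lemma same_tile_same_quarters:
  assumes "h \<in> isom" "h' \<in> isom" "h ` ab_tile i = h' ` ab_tile i'" "(i1, d) \<in> set (quarters i')"
  obtains d' where "(i1, d') \<in> set (quarters i)" "(h' \<circ> mact d) ` dual_tile i1 = (h \<circ> mact d') ` dual_tile i1"
proof -
  obtain s where s: "i = i'" "s \<in> set (ab_syms i)" "h' = h \<circ> mact s" using ab_tile_rigid[OF assms(1-3)] by blast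
  obtain d' where d': "(i1, d') \<in> set (quarters i)" "mact s ` mact d ` dual_tile i1 = mact d' ` dual_tile i1"
    using ab_syms_quarter[OF s(2)] assms(4) s(1) by blast
  have "(h' \<circ> mact d) ` dual_tile i1 = h ` mact s ` mact d ` dual_tile i1" unfolding s(3) by (simp only: image_comp comp_assoc)
  also have "\<dots> = (h \<circ> mact d') ` dual_tile i1" unfolding d'(2) by (simp only: image_comp)
  finally show thesis by (rule that[OF d'(1)])
qed

text \<open>\<open>ab_zone\<close> and \<open>dual_zone\<close> share their parameters, the second
  being the quartered form of the first. A finite patch and its image can thus be compared inside
  one and the same iterate.\<close>

definition ab_zone :: "complex \<Rightarrow> nat \<Rightarrow> proto \<Rightarrow> complex set set" where
  "ab_zone v n j = place ab_tile v (iter ab_rule n j)"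

definition dual_zone :: "complex \<Rightarrow> nat \<Rightarrow> proto \<Rightarrow> complex set set" where
  "dual_zone v n j = place dual_tile v (qset (iter ab_rule n j))"

text \<open>A bare triangle has two placements, which differ in the corner taken as
  \<open>P\<close>; \<open>merge\<close> accepts the tile as soon as one of them has the required
  rhombs.\<close>

definition good :: "complex set set \<Rightarrow> proto \<Rightarrow> (complex \<Rightarrow> complex) \<Rightarrow> bool" where
  "good Z i h \<longleftrightarrow> h \<in> isom \<and> (\<forall>i' w. (i', w) \<in> set (wits i) \<longrightarrow> (h \<circ> mact w) ` dual_tile i' \<in> Z)"

definition merge :: "complex set set \<Rightarrow> complex set set" where
  "merge Z = {h ` ab_tile i |i h. good Z i h}"

definition quarter :: "complex set set \<Rightarrow> complex set set" where
  "quarter T = {(h \<circ> mact d) ` dual_tile i' |i h i' d. h \<in> isom \<and> h ` ab_tile i \<in> T \<and> (i', d) \<in> set (quarters i)}"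

lemma good_mono: "Z \<subseteq> Z' \<Longrightarrow> good Z i h \<Longrightarrow> good Z' i h"
  unfolding good_def by blast

lemma merge_mono: "Z \<subseteq> Z' \<Longrightarrow> merge Z \<subseteq> merge Z'"
  unfolding merge_def using good_mono by blast

lemma quarter_mono: "T \<subseteq> T' \<Longrightarrow> quarter T \<subseteq> quarter T'"
  unfolding quarter_def by blast

lemma isom_iter_translate: "(i, g) \<in> iter R n j \<Longrightarrow> (\<lambda>x. v + g x) \<in> isom"
  by (intro isom_translate isom_iter)

lemma ab_zoneE:
  assumes "t \<in> ab_zone v n j"
  obtains i g where "(i, g) \<in> iter ab_rule n j" "t = (\<lambda>x. v + g x) ` ab_tile i"
  using assms unfolding ab_zone_def by (rule placeE)

lemma dual_zoneI:
  assumes "(i, g) \<in> iter ab_rule n j" "(i', d) \<in> set (quarters i)"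
  shows "((\<lambda>x. v + g x) \<circ> mact d) ` dual_tile i' \<in> dual_zone v n j"
proof -
  have "(i', g \<circ> mact d) \<in> qset (iter ab_rule n j)" unfolding qset_def using assms by blast
  from placeI[OF this, of v dual_tile] show ?thesis unfolding dual_zone_def by (simp only: comp_def)
qed

lemma dual_zoneE:
  assumes "y \<in> dual_zone v n j"
  obtains i g i' d where "(i, g) \<in> iter ab_rule n j" "(i', d) \<in> set (quarters i)"
    "y = ((\<lambda>x. v + g x) \<circ> mact d) ` dual_tile i'"
proof -
  obtain i' h where h: "(i', h) \<in> qset (iter ab_rule n j)" "y = (\<lambda>x. v + h x) ` dual_tile i'"
    using assms unfolding dual_zone_def by (rule placeE)
  then obtain i g d where "(i, g) \<in> iter ab_rule n j" "(i', d) \<in> set (quarters i)" "h = g \<circ> mact d"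
    unfolding qset_def by blast
  with h(2) show thesis by (intro that[of i g i' d]) (simp_all add: comp_def)
qed

lemma quarter_ab_zone: "quarter (ab_zone v n j) \<subseteq> dual_zone v n j"
proof
  fix y assume "y \<in> quarter (ab_zone v n j)"
  then obtain i h i' d where h: "h \<in> isom" "h ` ab_tile i \<in> ab_zone v n j" "(i', d) \<in> set (quarters i)"
    "y = (h \<circ> mact d) ` dual_tile i'"
    unfolding quarter_def by blast
  obtain i2 g where g: "(i2, g) \<in> iter ab_rule n j" "h ` ab_tile i = (\<lambda>x. v + g x) ` ab_tile i2"
    using h(2) by (rule ab_zoneE)
  obtain d' where "(i', d') \<in> set (quarters i2)"
    "(h \<circ> mact d) ` dual_tile i' = ((\<lambda>x. v + g x) \<circ> mact d') ` dual_tile i'"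
    using same_tile_same_quarters[OF isom_iter_translate[OF g(1)] h(1) g(2)[symmetric] h(3)] .
  then show "y \<in> dual_zone v n j" using dual_zoneI[OF g(1)] h(4) by simp
qed

lemma dual_zone_support:
  assumes "y \<in> dual_zone v n j" "v + p \<in> y"
  shows "p \<in> (*) (of_real (lam ^ n)) ` ab_tile j"
proof -
  obtain i g i' d where g: "(i, g) \<in> iter ab_rule n j" "(i', d) \<in> set (quarters i)"
    "y = ((\<lambda>x. v + g x) \<circ> mact d) ` dual_tile i'"
    using assms(1) by (rule dual_zoneE)
  have "y \<subseteq> (\<lambda>x. v + g x) ` ab_tile i" unfolding g(3) by (rule dual_tile_in_ab_tile[OF g(2)])
  then have "v + p \<in> (\<lambda>x. v + g x) ` ab_tile i" using assms(2) by (rule subsetD)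
  then have "p \<in> g ` ab_tile i" by auto
  then show ?thesis using iter_support[OF ab_tile_eq g(1)] by blast
qed

text \<open>A dual tile is convex with nonempty interior, so its points are limits of interior
  points. An interior point of \<open>y\<close> in \<open>y'\<close> therefore makes the interiors
  overlap, which packing excludes for different tiles.\<close>

lemma dual_zone_eq:
  assumes y: "y \<in> dual_zone v n j" "y' \<in> dual_zone v n j" and p: "p \<in> interior y" "p \<in> y'"
  shows "y = y'"
proof (rule ccontr)
  assume "y \<noteq> y'"
  then have disj: "interior y \<inter> interior y' = {}"
    using quarters_packing y unfolding dual_zone_def by blast
  obtain i g i' d where g: "(i, g) \<in> iter ab_rule n j" "(i', d) \<in> set (quarters i)"
    "y' = ((\<lambda>x. v + g x) \<circ> mact d) ` dual_tile i'"
    using y(2) by (rule dual_zoneE)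
  have iso: "(\<lambda>x. v + g x) \<circ> mact d \<in> isom" by (intro isom_comp isom_iter_translate[OF g(1)] isom_mact)
  have "convex y'" unfolding g(3) dual_tile_def isom_convex_hull[OF iso] by (rule convex_convex_hull)
  moreover have "interior y' \<noteq> {}" unfolding g(3) isom_interior[OF iso] using inner_pt_interior by blast
  ultimately have "closure (interior y') = closure y'" by (rule convex_closure_interior)
  then have "p \<in> closure (interior y')" using p(2) closure_subset by blast
  then show False using disj p(1) open_Int_closure_eq_empty[of "interior y" "interior y'"] by auto
qed

lemma inner_pt_image: "h \<in> isom \<Longrightarrow> h (den (inner_pt i)) \<in> interior (h ` dual_tile i)"
  using inner_pt_interior by (auto simp: isom_interior)

lemma wit_in_zone:
  assumes g: "(i, g) \<in> iter ab_rule n j" and w: "(i', w) \<in> set (wits i)"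
    and y: "y \<in> dual_zone v n j" "v + g (mact w (den (inner_pt i'))) \<in> y"
  shows "((\<lambda>x. v + g x) \<circ> mact w) ` dual_tile i' \<in> dual_zone v n j"
proof (cases "(i', w) \<in> set (quarters i)")
  case True
  then show ?thesis by (rule dual_zoneI[OF g])
next
  case False
  then have t: "i = Tri" "i' = Rhomb" "w \<in> {wit1, wit2}" using w by (cases i; auto)+
  have "(Rhomb, g \<circ> mact w) \<in> qset (iter ab_rule n j)"
    using dual_zone_support[OF y] by (intro witness_in_qset t) (use g t in auto)
  from placeI[OF this, of v dual_tile] show ?thesis unfolding dual_zone_def t by (simp only: comp_def)
qed

text \<open>Covering the sample point of a witness is enough: it shows that the zone reaches far
  enough to contain the witness, and the covering tile must then be the witness itself by
  \<open>dual_zone_eq\<close>.\<close>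

lemma good_if_sampled:
  assumes g: "(i, g) \<in> iter ab_rule n j" and Z: "Z \<subseteq> dual_zone v n j"
    and sampled: "\<And>i' w. (i', w) \<in> set (wits i) \<Longrightarrow> \<exists>y\<in>Z. v + g (mact w (den (inner_pt i'))) \<in> y"
  shows "good Z i (\<lambda>x. v + g x)"
  unfolding good_def
proof (intro conjI allI impI)
  show iso: "(\<lambda>x. v + g x) \<in> isom" by (rule isom_iter_translate[OF g])
  fix i' w assume w: "(i', w) \<in> set (wits i)"
  obtain y where y: "y \<in> Z" "v + g (mact w (den (inner_pt i'))) \<in> y" using sampled[OF w] by blast
  have yz: "y \<in> dual_zone v n j" using y(1) Z by blast
  let ?u = "((\<lambda>x. v + g x) \<circ> mact w) ` dual_tile i'"
  have u: "?u \<in> dual_zone v n j" by (rule wit_in_zone[OF g w yz y(2)])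
  have "v + g (mact w (den (inner_pt i'))) \<in> interior ?u"
    using inner_pt_image[OF isom_comp[OF iso isom_mact[of w]], of i'] by (simp add: comp_def)
  from dual_zone_eq[OF u yz this y(2)] have "?u = y" .
  then show "?u \<in> Z" using y(1) by simp
qed

text \<open>If the other diagonal of the square were used in the patch, then some edge at \<open>P\<close> would border
  two rhomb quarters that overlap but have their acute angles at different ends.\<close>

lemma good_shared_quarter:
  assumes good: "good (dual_zone v n j) i h" and g: "(i2, g) \<in> iter ab_rule n j"
    and d: "(i', d) \<in> set (quarters i)" "(i2', d2) \<in> set (quarters i2)"
    and eq: "(h \<circ> mact d) ` dual_tile i' = ((\<lambda>x. v + g x) \<circ> mact d2) ` dual_tile i2'"
  shows "h ` ab_tile i = (\<lambda>x. v + g x) ` ab_tile i2"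
proof -
  define k where "k = (\<lambda>x. v + g x)"
  have k: "k \<in> isom" unfolding k_def by (rule isom_iter_translate[OF g])
  have h: "h \<in> isom" using good unfolding good_def by blast
  have "i2' = i' \<and> (\<exists>s\<in>set (dual_syms i2'). h \<circ> mact d = k \<circ> mact d2 \<circ> mact s)"
    by (rule dual_tile_rigid) (use eq k h in \<open>simp_all add: isom_comp isom_mact k_def\<close>)
  then obtain s where s: "i' = i2'" "s \<in> set (dual_syms i')" "h \<circ> mact d = k \<circ> mact d2 \<circ> mact s" by blast
  define c where "c = mcomp (mcomp d2 s) (minv d)"
  have "h \<circ> (mact d \<circ> mact (minv d)) = k \<circ> mact d2 \<circ> mact s \<circ> mact (minv d)"
    unfolding comp_assoc[symmetric] s(3) ..
  then have hk: "h = k \<circ> mact c"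
    unfolding c_def mact_mcomp by (simp only: mact_minv comp_id comp_assoc)
  have "i = i2 \<and> (c \<in> set (ab_syms i) \<or>
       i = Tri \<and> (\<exists>w\<in>{wit1, wit2}. \<exists>w'\<in>{wit1, wit2}. mcomp c w = mcomp w' swap))"
    using shared_quarter[unfolded all_proto ball_pair Let_def, rule_format, OF d s(1)] s(2) unfolding c_def by blast
  then have i: "i = i2" and cases: "c \<in> set (ab_syms i) \<or>
       i = Tri \<and> (\<exists>w\<in>{wit1, wit2}. \<exists>w'\<in>{wit1, wit2}. mcomp c w = mcomp w' swap)" by blast+
  from cases show ?thesis
  proof
    assume "c \<in> set (ab_syms i)"
    then show ?thesis unfolding hk image_comp[symmetric] ab_tile_sym[OF \<open>c \<in> _\<close>] by (simp only: k_def i)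
  next
    assume "i = Tri \<and> (\<exists>w\<in>{wit1, wit2}. \<exists>w'\<in>{wit1, wit2}. mcomp c w = mcomp w' swap)"
    then obtain w w' where t: "i = Tri" and w: "w \<in> {wit1, wit2}" "w' \<in> {wit1, wit2}" "mcomp c w = mcomp w' swap"
      by blast
    let ?o = "den (inner_pt Rhomb)"
    have o: "mact swap ?o = ?o" using swap_inner_pt by (simp only: den_zact[symmetric])
    have hw: "h \<circ> mact w = k \<circ> mact w' \<circ> mact swap"
      using arg_cong[OF w(3), of mact] unfolding hk mact_mcomp by (simp only: comp_assoc)
    have y: "(h \<circ> mact w) ` dual_tile Rhomb \<in> dual_zone v n j"
      using good w(1) t unfolding good_def by auto
    have inY: "k (mact w' ?o) \<in> interior ((h \<circ> mact w) ` dual_tile Rhomb)"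
      using inner_pt_image[OF isom_comp[OF isom_comp[OF k isom_mact[of w']] isom_mact[of swap]], of Rhomb]
      by (simp only: comp_apply o hw)
    then have "v + g (mact w' ?o) \<in> (h \<circ> mact w) ` dual_tile Rhomb"
      using interior_subset unfolding k_def by blast
    then have y': "(k \<circ> mact w') ` dual_tile Rhomb \<in> dual_zone v n j"
      unfolding k_def using g w(2) t i by (intro wit_in_zone[OF g _ y]) auto
    have "?o \<in> dual_tile Rhomb" using inner_pt_interior interior_subset by blast
    then have "k (mact w' ?o) \<in> (k \<circ> mact w') ` dual_tile Rhomb" by (simp only: comp_apply image_comp[symmetric] imageI)
    \<comment> \<open>\<open>swap\<close> fixes the sample point, so the two quarters overlap and
      must be the same tile.\<close>
    from dual_zone_eq[OF y y' inY this] have "(h \<circ> mact w) ` dual_tile Rhomb = (k \<circ> mact w') ` dual_tile Rhomb" .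
    then have "(k \<circ> mact w') ` dual_tile Rhomb = (k \<circ> mact w' \<circ> mact swap) ` dual_tile Rhomb"
      unfolding hw ..
    then have "\<exists>s\<in>set (dual_syms Rhomb). k \<circ> mact w' \<circ> mact swap = k \<circ> mact w' \<circ> mact s"
      using dual_tile_rigid[of "k \<circ> mact w'" "k \<circ> mact w' \<circ> mact swap" Rhomb Rhomb] k by (simp add: isom_comp isom_mact)
    then have "k \<circ> mact w' \<circ> mact swap = k \<circ> mact w' \<circ> id"
      using mact_mone by (simp add: mone_def)
    \<comment> \<open>The point is the acute vertex of the rhomb quarter, which \<open>swap\<close>
      moves to the obtuse one.\<close>
    then have "(k \<circ> mact w') (mact swap (den (Zx (- 2) (- 6) (- 6) (- 2)))) = (k \<circ> mact w') (den (Zx (- 2) (- 6) (- 6) (- 2)))"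
      by (metis comp_apply id_apply)
    then have "mact swap (den (Zx (- 2) (- 6) (- 6) (- 2))) = den (Zx (- 2) (- 6) (- 6) (- 2))"
      using isom_inj[of "k \<circ> mact w'"] k by (simp only: isom_comp isom_mact inj_eq)
    then have "zact swap (Zx (- 2) (- 6) (- 6) (- 2)) = Zx (- 2) (- 6) (- 6) (- 2)"
      by (simp only: den_zact[symmetric] den_inject)
    then show ?thesis by (simp add: swap_def zrot_def)
  qed
qed

text \<open>Each quarter of a good tile comes from some tile of the zone, and one shared quarter
  already identifies the two tiles.\<close>

lemma merge_dual_zone: "merge (dual_zone v n j) \<subseteq> ab_zone v n j"
proof
  fix t assume "t \<in> merge (dual_zone v n j)"
  then obtain i h where t: "t = h ` ab_tile i" and good: "good (dual_zone v n j) i h" unfolding merge_def by blast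
  obtain i' d where d: "(i', d) \<in> set (quarters i)" by (cases i) auto
  then have "(h \<circ> mact d) ` dual_tile i' \<in> dual_zone v n j" using good quarters_wits unfolding good_def by blast
  then obtain i2 g i2' d2 where g: "(i2, g) \<in> iter ab_rule n j" "(i2', d2) \<in> set (quarters i2)"
    "(h \<circ> mact d) ` dual_tile i' = ((\<lambda>x. v + g x) \<circ> mact d2) ` dual_tile i2'"
    by (rule dual_zoneE)
  show "t \<in> ab_zone v n j"
    unfolding t good_shared_quarter[OF good g(1) d g(2,3)] ab_zone_def by (rule placeI[OF g(1)])
qed

section \<open>Mutual local derivability\<close>

lemma finite_support:
  assumes local: "\<And>t. t \<in> G T \<Longrightarrow> \<exists>F. finite F \<and> F \<subseteq> T \<and> t \<in> G F"
    and mono: "\<And>F F'. F \<subseteq> F' \<Longrightarrow> G F \<subseteq> G F'"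
    and P: "P \<subseteq> G T" "finite P"
  shows "\<exists>F. finite F \<and> F \<subseteq> T \<and> P \<subseteq> G F"
proof -
  have "\<forall>t\<in>P. \<exists>F. finite F \<and> F \<subseteq> T \<and> t \<in> G F" using local P(1) by blast
  then obtain F where F: "\<forall>t\<in>P. finite (F t) \<and> F t \<subseteq> T \<and> t \<in> G (F t)" by (rule bchoice[THEN exE])
  have "t \<in> G (\<Union>(F ` P))" if "t \<in> P" for t
  proof -
    have "F t \<subseteq> \<Union>(F ` P)" using that by blast
    then have "G (F t) \<subseteq> G (\<Union>(F ` P))" by (rule mono)
    then show ?thesis using F that by (meson subsetD)
  qed
  moreover have "finite (\<Union>(F ` P))" "\<Union>(F ` P) \<subseteq> T" using F P(2) by auto
  ultimately show ?thesis by blast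
qed

lemma quarter_finite_support: "P \<subseteq> quarter T \<Longrightarrow> finite P \<Longrightarrow> \<exists>F. finite F \<and> F \<subseteq> T \<and> P \<subseteq> quarter F"
proof (rule finite_support[where G = quarter])
  fix y assume "y \<in> quarter T"
  then obtain i h i' d where h: "h \<in> isom" "h ` ab_tile i \<in> T" "(i', d) \<in> set (quarters i)"
    "y = (h \<circ> mact d) ` dual_tile i'"
    unfolding quarter_def by blast
  have "y \<in> quarter {h ` ab_tile i}" unfolding quarter_def h(4) using h(1,3) by blast
  with h(2) show "\<exists>F. finite F \<and> F \<subseteq> T \<and> y \<in> quarter F" by (intro exI[of _ "{h ` ab_tile i}"]) simp
qed (rule quarter_mono)

lemma merge_finite_support: "P \<subseteq> merge Z \<Longrightarrow> finite P \<Longrightarrow> \<exists>F. finite F \<and> F \<subseteq> Z \<and> P \<subseteq> merge F"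
proof (rule finite_support[where G = merge])
  fix t assume "t \<in> merge Z"
  then obtain i h where t: "t = h ` ab_tile i" and good: "good Z i h" unfolding merge_def by blast
  define F where "F = (\<lambda>(i', w). (h \<circ> mact w) ` dual_tile i') ` set (wits i)"
  have "(h \<circ> mact w) ` dual_tile i' \<in> F" if "(i', w) \<in> set (wits i)" for i' w
    unfolding F_def by (rule image_eqI[OF _ that]) simp
  then have "good F i h" using good unfolding good_def by blast
  then have "t \<in> merge F" unfolding merge_def t by blast
  moreover have "F \<subseteq> Z" using good unfolding good_def F_def by auto
  moreover have "finite F" unfolding F_def by simp
  ultimately show "\<exists>F. finite F \<and> F \<subseteq> Z \<and> t \<in> merge F" by blast
qed (rule merge_mono)

text \<open>The two inclusions between dual iterates and quartered iterates let the legality of dual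
  tilings be tested on the zones used for Ammann-Beenker tilings.\<close>

lemma hull_of_dual_zone:
  "T \<in> hull_of dual_tile dual_rule \<longleftrightarrow> tiling T \<and> (\<forall>P. P \<subseteq> T \<and> finite P \<longrightarrow> (\<exists>v n j. P \<subseteq> dual_zone v n j))"
proof -
  have "(\<exists>v n j. P \<subseteq> place dual_tile v (iter dual_rule n j)) \<longleftrightarrow> (\<exists>v n j. P \<subseteq> dual_zone v n j)" for P
  proof
    assume "\<exists>v n j. P \<subseteq> place dual_tile v (iter dual_rule n j)"
    then obtain v n j where P: "P \<subseteq> place dual_tile v (iter dual_rule n j)" by (elim exE)
    obtain v' n' j' where "place dual_tile v (iter dual_rule n j) \<subseteq> dual_zone v' n' j'"
      unfolding dual_zone_def using dual_in_quarters_place[of v n j] by (elim exE)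
    with P show "\<exists>v n j. P \<subseteq> dual_zone v n j" by (intro exI subset_trans[OF P])
  next
    assume "\<exists>v n j. P \<subseteq> dual_zone v n j"
    then obtain v n j where P: "P \<subseteq> dual_zone v n j" by (elim exE)
    obtain v' n' j' where "dual_zone v n j \<subseteq> place dual_tile v' (iter dual_rule n' j')"
      unfolding dual_zone_def using quarters_in_dual_place[of v n j] by (elim exE)
    with P show "\<exists>v n j. P \<subseteq> place dual_tile v (iter dual_rule n j)" by (intro exI subset_trans[OF P])
  qed
  then show ?thesis unfolding hull_of_def by simp
qed

lemma hull_of_ab_zone:
  "T \<in> hull_of ab_tile ab_rule \<longleftrightarrow> tiling T \<and> (\<forall>P. P \<subseteq> T \<and> finite P \<longrightarrow> (\<exists>v n j. P \<subseteq> ab_zone v n j))"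
  unfolding hull_of_def ab_zone_def mem_Collect_eq ..

lemma dual_hullD:
  assumes "T \<in> hull_of dual_tile dual_rule"
  shows "\<Union>T = UNIV" and "P \<subseteq> T \<Longrightarrow> finite P \<Longrightarrow> \<exists>v n j. P \<subseteq> dual_zone v n j"
  using assms unfolding hull_of_dual_zone tiling_def by simp_all

lemma ab_hullD:
  assumes "T \<in> hull_of ab_tile ab_rule"
  shows "\<Union>T = UNIV" and "P \<subseteq> T \<Longrightarrow> finite P \<Longrightarrow> \<exists>v n j. P \<subseteq> ab_zone v n j"
  using assms unfolding hull_of_ab_zone tiling_def by simp_all

text \<open>The closed sets are removed one at a time: the open set lies in the current one, or a
  nonempty open remainder is left for the others.\<close>

lemma finite_closed_cover:
  fixes U :: "complex set"
  assumes "finite P" "\<And>s. s \<in> P \<Longrightarrow> closed s" "open U" "U \<noteq> {}" "U \<subseteq> \<Union>P"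
  shows "\<exists>s\<in>P. interior s \<inter> U \<noteq> {}"
  using assms
proof (induction P arbitrary: U rule: finite_induct)
  case (insert s P)
  show ?case
  proof (cases "U \<subseteq> s")
    case True
    then have "U \<subseteq> interior s" using insert.prems(2) by (rule interior_maximal)
    then show ?thesis using insert.prems(3) by blast
  next
    case False
    have "open (U - s)" using insert.prems(1,2) by (simp add: open_Diff)
    then have "\<exists>s'\<in>P. interior s' \<inter> (U - s) \<noteq> {}"
      using False insert.prems by (intro insert.IH) auto
    then show ?thesis by blast
  qed
qed simp

lemma quarter_overlap:
  assumes h: "h \<in> isom" and U: "open U" "U \<noteq> {}" "U \<subseteq> h ` ab_tile i"
  obtains i' d where "(i', d) \<in> set (quarters i)" "interior ((h \<circ> mact d) ` dual_tile i') \<inter> U \<noteq> {}"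
proof -
  let ?P = "(\<lambda>(i', d). (h \<circ> mact d) ` dual_tile i') ` set (quarters i)"
  have "\<exists>s\<in>?P. interior s \<inter> U \<noteq> {}"
  proof (rule finite_closed_cover[OF _ _ U(1,2)])
    fix s assume "s \<in> ?P"
    then obtain i' d where "s = (h \<circ> mact d) ` dual_tile i'" by auto
    then show "closed s"
      by (simp only: compact_imp_closed isom_compact isom_comp h isom_mact compact_dual_tile)
  next
    show "U \<subseteq> \<Union>?P"
    proof
      fix x assume "x \<in> U"
      with U(3) have "x \<in> h ` ab_tile i" by blast
      then obtain i' d where d: "(i', d) \<in> set (quarters i)" "x \<in> (h \<circ> mact d) ` dual_tile i'" by (rule in_ab_tile)
      have "(h \<circ> mact d) ` dual_tile i' \<in> ?P" by (rule image_eqI[OF _ d(1)]) simp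
      then show "x \<in> \<Union>?P" using d(2) by (rule UnionI)
    qed
  qed simp
  then obtain s where s: "s \<in> ?P" "interior s \<inter> U \<noteq> {}" by (rule bexE)
  then obtain i' d where "(i', d) \<in> set (quarters i)" "s = (h \<circ> mact d) ` dual_tile i'" by auto
  with s(2) show thesis by (intro that) simp_all
qed

lemma finite_proto: "finite (UNIV :: proto set)"
proof -
  have "(UNIV :: proto set) = {Rhomb, Tri}" using proto.exhaust by auto
  then show ?thesis by (rule ssubst) simp
qed

text \<open>Sampling at finitely many points keeps the finite patches of the legality condition finite
  without any local finiteness of tilings.\<close>

definition samples :: "complex set" where
  "samples = (\<Union>i. (\<lambda>(i', w). mact w (den (inner_pt i'))) ` set (wits i))"

lemma finite_samples: "finite samples"
  unfolding samples_def using finite_proto by simp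

lemma in_samples: "(i', w) \<in> set (wits i) \<Longrightarrow> mact w (den (inner_pt i')) \<in> samples"
  unfolding samples_def by (rule UN_I[OF UNIV_I]) (rule image_eqI[of _ _ "(i', w)"], simp_all)

lemma sample_cover:
  assumes T: "\<Union>T = UNIV" and H: "finite H"
  shows "\<exists>P. finite P \<and> P \<subseteq> T \<and> (\<forall>h\<in>H. \<forall>q\<in>samples. \<exists>t\<in>P. h q \<in> t)"
proof -
  have "\<exists>t. t \<in> T \<and> p \<in> t" for p using T by (metis UNIV_I Union_iff)
  then obtain \<tau> where \<tau>: "\<And>p. \<tau> p \<in> T \<and> p \<in> \<tau> p" by metis
  let ?P = "(\<lambda>(h, q). \<tau> (h q)) ` (H \<times> samples)"
  have "finite ?P" using H finite_samples by simp
  moreover have "?P \<subseteq> T" using \<tau> by auto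
  moreover have "\<exists>t\<in>?P. h q \<in> t" if "h \<in> H" "q \<in> samples" for h q
    by (rule bexI[of _ "\<tau> (h q)"]) (use \<tau> that in auto)
  ultimately show ?thesis by blast
qed

lemma finite_ab_placements: "finite {h \<in> isom. \<exists>i. h ` ab_tile i = t}"
proof (cases "\<exists>h0\<in>isom. \<exists>i0. h0 ` ab_tile i0 = t")
  case True
  then obtain h0 i0 where h0: "h0 \<in> isom" "h0 ` ab_tile i0 = t" by blast
  have "{h \<in> isom. \<exists>i. h ` ab_tile i = t} \<subseteq> (\<lambda>s. h0 \<circ> mact s) ` set (ab_syms i0)"
  proof
    fix h assume "h \<in> {h \<in> isom. \<exists>i. h ` ab_tile i = t}"
    then obtain i where h: "h \<in> isom" "h ` ab_tile i = t" by blast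
    have "h0 ` ab_tile i0 = h ` ab_tile i" using h0 h by simp
    then obtain s where "s \<in> set (ab_syms i0)" "h = h0 \<circ> mact s" using ab_tile_rigid[OF h0(1) h(1)] by blast
    then show "h \<in> (\<lambda>s. h0 \<circ> mact s) ` set (ab_syms i0)" by (intro image_eqI)
  qed
  then show ?thesis by (rule finite_subset) simp
next
  case False
  then have "{h \<in> isom. \<exists>i. h ` ab_tile i = t} = {}" by blast
  then show ?thesis by (simp only: finite.emptyI)
qed

lemma finite_dual_placements: "finite {h \<in> isom. \<exists>i. h ` dual_tile i = t}"
proof (cases "\<exists>h0\<in>isom. \<exists>i0. h0 ` dual_tile i0 = t")
  case True
  then obtain h0 i0 where h0: "h0 \<in> isom" "h0 ` dual_tile i0 = t" by blast
  have "{h \<in> isom. \<exists>i. h ` dual_tile i = t} \<subseteq> (\<lambda>s. h0 \<circ> mact s) ` set (dual_syms i0)"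
  proof
    fix h assume "h \<in> {h \<in> isom. \<exists>i. h ` dual_tile i = t}"
    then obtain i where h: "h \<in> isom" "h ` dual_tile i = t" by blast
    have "h0 ` dual_tile i0 = h ` dual_tile i" using h0 h by simp
    then obtain s where "s \<in> set (dual_syms i0)" "h = h0 \<circ> mact s" using dual_tile_rigid[OF h0(1) h(1)] by blast
    then show "h \<in> (\<lambda>s. h0 \<circ> mact s) ` set (dual_syms i0)" by (intro image_eqI)
  qed
  then show ?thesis by (rule finite_subset) simp
next
  case False
  then have "{h \<in> isom. \<exists>i. h ` dual_tile i = t} = {}" by blast
  then show ?thesis by (simp only: finite.emptyI)
qed

lemma tile_in_merge_quarter:
  assumes T: "T \<in> hull_of ab_tile ab_rule" and t: "t \<in> T"
  shows "t \<in> merge (quarter T)"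
proof -
  \<comment> \<open>The iterate containing \<open>t\<close>, and with it the placement of
    \<open>t\<close>, is known only after a finite patch has been fixed. Sample points of all
    placements are therefore covered in advance.\<close>
  let ?H = "{h \<in> isom. \<exists>i. h ` ab_tile i = t}"
  obtain P where P: "finite P" "P \<subseteq> T" "\<forall>h\<in>?H. \<forall>q\<in>samples. \<exists>t\<in>P. h q \<in> t"
    using sample_cover[OF ab_hullD(1)[OF T] finite_ab_placements[of t]] by (elim exE conjE)
  have "insert t P \<subseteq> T" "finite (insert t P)" using P t by auto
  then obtain v n j where z: "insert t P \<subseteq> ab_zone v n j" using ab_hullD(2)[OF T] by meson
  then have "t \<in> ab_zone v n j" by blast
  then obtain i g where g: "(i, g) \<in> iter ab_rule n j" "t = (\<lambda>x. v + g x) ` ab_tile i"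
    by (rule ab_zoneE)
  have H: "(\<lambda>x. v + g x) \<in> ?H" using isom_iter_translate[OF g(1)] g(2) by blast
  have PT: "quarter P \<subseteq> quarter T" using P(2) by (rule quarter_mono)
  have "good (quarter P) i (\<lambda>x. v + g x)"
  proof (rule good_if_sampled[OF g(1)])
    have "P \<subseteq> ab_zone v n j" using z by blast
    then show "quarter P \<subseteq> dual_zone v n j" using quarter_mono quarter_ab_zone by blast
    fix i' w assume w: "(i', w) \<in> set (wits i)"
    obtain u where u: "u \<in> P" "v + g (mact w (den (inner_pt i'))) \<in> u" using P(3)[THEN bspec, OF H, THEN bspec, OF in_samples[OF w]] by blast
    then have "u \<in> ab_zone v n j" using z by blast
    then obtain i2 g2 where g2: "(i2, g2) \<in> iter ab_rule n j" "u = (\<lambda>x. v + g2 x) ` ab_tile i2"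
      by (rule ab_zoneE)
    have "v + g (mact w (den (inner_pt i'))) \<in> (\<lambda>x. v + g2 x) ` ab_tile i2" using u(2) unfolding g2(2) .
    then obtain i3 d where d: "(i3, d) \<in> set (quarters i2)"
        "v + g (mact w (den (inner_pt i'))) \<in> ((\<lambda>x. v + g2 x) \<circ> mact d) ` dual_tile i3"
      by (rule in_ab_tile)
    have "((\<lambda>x. v + g2 x) \<circ> mact d) ` dual_tile i3 \<in> quarter P"
      unfolding quarter_def using isom_iter_translate[OF g2(1)] u(1) g2(2) d(1) by blast
    with d(2) show "\<exists>y\<in>quarter P. v + g (mact w (den (inner_pt i'))) \<in> y" by blast
  qed
  then have "good (quarter T) i (\<lambda>x. v + g x)" by (rule good_mono[OF PT])
  then show ?thesis unfolding merge_def g(2) by blast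
qed

lemma dual_tile_in_merge:
  assumes T: "T \<in> hull_of dual_tile dual_rule" and y: "y \<in> T"
  obtains i h i' d where "good T i h" "(i', d) \<in> set (quarters i)" "y = (h \<circ> mact d) ` dual_tile i'"
proof -
  let ?K = "{k \<in> isom. \<exists>i. k ` dual_tile i = y}"
  \<comment> \<open>All candidate placements of a parent tile: \<open>y\<close> is its quarter
    \<open>d\<close>, in some placement \<open>k\<close> of \<open>y\<close>.\<close>
  let ?H = "\<Union>i. (\<lambda>(k, (i', d)). k \<circ> mact (minv d)) ` (?K \<times> set (quarters i))"
  have fin: "finite ?H" using finite_proto finite_dual_placements by simp
  obtain P where P: "finite P" "P \<subseteq> T" "\<forall>h\<in>?H. \<forall>q\<in>samples. \<exists>t\<in>P. h q \<in> t"
    using sample_cover[OF dual_hullD(1)[OF T] fin] by (elim exE conjE)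
  have "insert y P \<subseteq> T" "finite (insert y P)" using P y by auto
  then obtain v n j where z: "insert y P \<subseteq> dual_zone v n j" using dual_hullD(2)[OF T] by meson
  then have "y \<in> dual_zone v n j" by blast
  then obtain i g i' d where g: "(i, g) \<in> iter ab_rule n j" "(i', d) \<in> set (quarters i)"
      "y = ((\<lambda>x. v + g x) \<circ> mact d) ` dual_tile i'"
    by (rule dual_zoneE)
  let ?k = "\<lambda>x. v + g x"
  have "?k \<circ> mact d \<in> ?K"
    using isom_comp[OF isom_iter_translate[OF g(1)] isom_mact[of d]] g(3) by blast
  moreover have "?k = (?k \<circ> mact d) \<circ> mact (minv d)" by (simp only: comp_assoc mact_minv comp_id)
  ultimately have H: "?k \<in> ?H" using g(2) by (intro UN_I[of i] image_eqI[of _ _ "(?k \<circ> mact d, (i', d))"]) simp_all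
  have "good P i ?k"
  proof (rule good_if_sampled[OF g(1)])
    show "P \<subseteq> dual_zone v n j" using z by blast
    fix i' w assume w: "(i', w) \<in> set (wits i)"
    show "\<exists>y\<in>P. v + g (mact w (den (inner_pt i'))) \<in> y" using P(3)[THEN bspec, OF H, THEN bspec, OF in_samples[OF w]] .
  qed
  then have "good T i ?k" by (rule good_mono[OF P(2)])
  then show thesis using g(2,3) by (rule that)
qed

section \<open>Cutting and merging as inverse maps between the hulls\<close>

lemma quarter_in_hull:
  assumes T: "T \<in> hull_of ab_tile ab_rule"
  shows "quarter T \<in> hull_of dual_tile dual_rule"
proof -
  have legal: "\<exists>v n j. P \<subseteq> dual_zone v n j" if P: "P \<subseteq> quarter T" "finite P" for P
  proof -
    obtain F where F: "finite F" "F \<subseteq> T" "P \<subseteq> quarter F" using quarter_finite_support[OF P] by blast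
    then obtain v n j where "F \<subseteq> ab_zone v n j" using ab_hullD(2)[OF T] by meson
    then have "P \<subseteq> dual_zone v n j" using F(3) quarter_mono quarter_ab_zone by blast
    then show ?thesis by blast
  qed
  have "tiling (quarter T)"
    unfolding tiling_def
  proof
    show "\<Union>(quarter T) = UNIV"
    proof (intro equalityI subsetI UNIV_I)
      fix x
      obtain t where t: "t \<in> T" "x \<in> t" using ab_hullD(1)[OF T] by blast
      have "{t} \<subseteq> T" "finite {t}" using t by auto
      then obtain v n j where "{t} \<subseteq> ab_zone v n j" using ab_hullD(2)[OF T] by meson
      then have "t \<in> ab_zone v n j" by blast
      then obtain i g where g: "(i, g) \<in> iter ab_rule n j" "t = (\<lambda>x. v + g x) ` ab_tile i"
        by (rule ab_zoneE)
      have "x \<in> (\<lambda>x. v + g x) ` ab_tile i" using t(2) unfolding g(2) .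
      then obtain i' d where d: "(i', d) \<in> set (quarters i)" "x \<in> ((\<lambda>x. v + g x) \<circ> mact d) ` dual_tile i'"
        by (rule in_ab_tile)
      have "((\<lambda>x. v + g x) \<circ> mact d) ` dual_tile i' \<in> quarter T"
        unfolding quarter_def using isom_iter_translate[OF g(1)] t(1) g(2) d(1) by blast
      with d(2) show "x \<in> \<Union>(quarter T)" by blast
    qed
    show "pairwise (\<lambda>s t. interior s \<inter> interior t = {}) (quarter T)"
      unfolding pairwise_def
    proof (intro ballI impI)
      fix y y' assume y: "y \<in> quarter T" "y' \<in> quarter T" "y \<noteq> y'"
      then obtain v n j where "{y, y'} \<subseteq> dual_zone v n j" using legal[of "{y, y'}"] by blast
      then show "interior y \<inter> interior y' = {}"
        using y(3) unfolding dual_zone_def by (intro quarters_packing) auto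
    qed
  qed
  with legal show ?thesis unfolding hull_of_dual_zone by simp
qed

text \<open>Merged tiles with overlapping interiors have overlapping quarters, which coincide by
  packing. The common quarter identifies both tiles with one tile of the zone.\<close>

lemma merge_disjoint:
  assumes T: "T \<in> hull_of dual_tile dual_rule" and t: "t \<in> merge T" "t' \<in> merge T" "t \<noteq> t'"
  shows "interior t \<inter> interior t' = {}"
proof (rule ccontr)
  assume ov: "interior t \<inter> interior t' \<noteq> {}"
  have "{t, t'} \<subseteq> merge T" "finite {t, t'}" using t by simp_all
  then obtain F where F: "finite F" "F \<subseteq> T" "{t, t'} \<subseteq> merge F" using merge_finite_support by meson
  then obtain v n j where z: "F \<subseteq> dual_zone v n j" using dual_hullD(2)[OF T] by meson
  have m: "t \<in> merge (dual_zone v n j)" "t' \<in> merge (dual_zone v n j)" using F(3) merge_mono[OF z] by auto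
  obtain i h where t1: "t = h ` ab_tile i" "good (dual_zone v n j) i h" using m(1) unfolding merge_def by blast
  obtain i' h' where t2: "t' = h' ` ab_tile i'" "good (dual_zone v n j) i' h'" using m(2) unfolding merge_def by blast
  have iso: "h \<in> isom" "h' \<in> isom" using t1(2) t2(2) unfolding good_def by blast+
  have U: "open (interior t \<inter> interior t')" "interior t \<inter> interior t' \<subseteq> h ` ab_tile i"
    using interior_subset[of t] unfolding t1(1)[symmetric] by (auto intro: open_Int)
  obtain a d where d: "(a, d) \<in> set (quarters i)" "interior ((h \<circ> mact d) ` dual_tile a) \<inter> (interior t \<inter> interior t') \<noteq> {}"
    by (rule quarter_overlap[OF iso(1) U(1) ov U(2)])
  let ?V = "interior ((h \<circ> mact d) ` dual_tile a) \<inter> (interior t \<inter> interior t')"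
  have V: "open ?V" "?V \<subseteq> h' ` ab_tile i'"
    using interior_subset[of t'] unfolding t2(1)[symmetric] by (auto intro: open_Int)
  obtain a' d' where d': "(a', d') \<in> set (quarters i')" "interior ((h' \<circ> mact d') ` dual_tile a') \<inter> ?V \<noteq> {}"
    by (rule quarter_overlap[OF iso(2) V(1) d(2) V(2)])
  have q: "(h \<circ> mact d) ` dual_tile a \<in> dual_zone v n j" "(h' \<circ> mact d') ` dual_tile a' \<in> dual_zone v n j"
    using t1(2) t2(2) d(1) d'(1) quarters_wits unfolding good_def by blast+
  have eq: "(h \<circ> mact d) ` dual_tile a = (h' \<circ> mact d') ` dual_tile a'"
    using quarters_packing[OF q[unfolded dual_zone_def]] d'(2) by blast
  obtain i2 g i3 d3 where g: "(i2, g) \<in> iter ab_rule n j" "(i3, d3) \<in> set (quarters i2)"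
      "(h \<circ> mact d) ` dual_tile a = ((\<lambda>x. v + g x) \<circ> mact d3) ` dual_tile i3"
    using q(1) by (rule dual_zoneE)
  have "t = (\<lambda>x. v + g x) ` ab_tile i2"
    unfolding t1(1) by (rule good_shared_quarter[OF t1(2) g(1) d(1) g(2,3)])
  moreover have "t' = (\<lambda>x. v + g x) ` ab_tile i2"
    unfolding t2(1) by (rule good_shared_quarter[OF t2(2) g(1) d'(1) g(2) eq[symmetric, THEN trans, OF g(3)]])
  ultimately show False using t(3) by simp
qed

lemma merge_in_hull:
  assumes T: "T \<in> hull_of dual_tile dual_rule"
  shows "merge T \<in> hull_of ab_tile ab_rule"
proof -
  have legal: "\<exists>v n j. P \<subseteq> ab_zone v n j" if P: "P \<subseteq> merge T" "finite P" for P
  proof -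
  obtain F where F: "finite F" "F \<subseteq> T" "P \<subseteq> merge F" using merge_finite_support[OF P] by blast
  then obtain v n j where "F \<subseteq> dual_zone v n j" using dual_hullD(2)[OF T] by meson
  then have "P \<subseteq> ab_zone v n j" using F(3) merge_mono merge_dual_zone by blast
  then show ?thesis by blast
  qed
  have "tiling (merge T)"
    unfolding tiling_def
  proof
    show "\<Union>(merge T) = UNIV"
    proof (intro equalityI subsetI UNIV_I)
      fix x
      obtain y where y: "y \<in> T" "x \<in> y" using dual_hullD(1)[OF T] by blast
      obtain i h i' d where h: "good T i h" "(i', d) \<in> set (quarters i)" "y = (h \<circ> mact d) ` dual_tile i'"
        using dual_tile_in_merge[OF T y(1)] .
      have "x \<in> h ` ab_tile i" using y(2) dual_tile_in_ab_tile[OF h(2), of h] unfolding h(3) by blast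
      moreover have "h ` ab_tile i \<in> merge T" unfolding merge_def using h(1) by blast
      ultimately show "x \<in> \<Union>(merge T)" by blast
    qed
    show "pairwise (\<lambda>s t. interior s \<inter> interior t = {}) (merge T)"
      unfolding pairwise_def using merge_disjoint[OF T] by blast
  qed
  with legal show ?thesis unfolding hull_of_ab_zone by simp
qed

lemma quarter_merge:
  assumes T: "T \<in> hull_of dual_tile dual_rule"
  shows "quarter (merge T) = T"
proof (intro equalityI subsetI)
  fix y assume "y \<in> quarter (merge T)"
  then obtain i h i' d where h: "h \<in> isom" "h ` ab_tile i \<in> merge T" "(i', d) \<in> set (quarters i)"
    "y = (h \<circ> mact d) ` dual_tile i'"
    unfolding quarter_def by blast
  then obtain i2 h2 where h2: "h ` ab_tile i = h2 ` ab_tile i2" "good T i2 h2" unfolding merge_def by blast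
  have iso2: "h2 \<in> isom" using h2(2) unfolding good_def by blast
  obtain d' where d': "(i', d') \<in> set (quarters i2)" "(h \<circ> mact d) ` dual_tile i' = (h2 \<circ> mact d') ` dual_tile i'"
    using same_tile_same_quarters[OF iso2 h(1) h2(1)[symmetric] h(3)] .
  have "(i', d') \<in> set (wits i2)" using d'(1) quarters_wits by blast
  then show "y \<in> T" using h2(2) unfolding good_def h(4) d'(2) by blast
next
  fix y assume "y \<in> T"
  obtain i h i' d where h: "good T i h" "(i', d) \<in> set (quarters i)" "y = (h \<circ> mact d) ` dual_tile i'"
    using dual_tile_in_merge[OF T \<open>y \<in> T\<close>] .
  have "h \<in> isom" using h(1) unfolding good_def by blast
  moreover have "h ` ab_tile i \<in> merge T" unfolding merge_def using h(1) by blast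
  ultimately show "y \<in> quarter (merge T)" unfolding quarter_def h(3) using h(2) by blast
qed

text \<open>A merged tile shares a quarter with some tile of \<open>T\<close>, and inside a common
  zone this makes them equal, so merging creates no foreign tiles. The converse is the presence of
  the witnesses around each tile of \<open>T\<close>.\<close>

lemma merge_quarter:
  assumes T: "T \<in> hull_of ab_tile ab_rule"
  shows "merge (quarter T) = T"
proof (intro equalityI subsetI)
  fix t assume "t \<in> merge (quarter T)"
  then have "{t} \<subseteq> merge (quarter T)" "finite {t}" by simp_all
  then obtain F where F: "finite F" "F \<subseteq> quarter T" "{t} \<subseteq> merge F" using merge_finite_support by meson
  obtain P where P: "finite P" "P \<subseteq> T" "F \<subseteq> quarter P" using quarter_finite_support[OF F(2,1)] by blast
  then obtain v n j where z: "P \<subseteq> ab_zone v n j" using ab_hullD(2)[OF T] by meson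
  obtain i h where t: "t = h ` ab_tile i" and good: "good F i h" using F(3) unfolding merge_def by blast
  have "F \<subseteq> dual_zone v n j" using P(3) quarter_mono[OF z] quarter_ab_zone by blast
  then have good': "good (dual_zone v n j) i h" using good by (rule good_mono)
  obtain i' d where d: "(i', d) \<in> set (quarters i)" by (cases i) auto
  then have "(h \<circ> mact d) ` dual_tile i' \<in> quarter P" using good P(3) quarters_wits unfolding good_def by blast
  then obtain i2 h2 i2' d2 where h2: "h2 \<in> isom" "h2 ` ab_tile i2 \<in> P" "(i2', d2) \<in> set (quarters i2)"
      "(h \<circ> mact d) ` dual_tile i' = (h2 \<circ> mact d2) ` dual_tile i2'"
    unfolding quarter_def by blast
  have "h2 ` ab_tile i2 \<in> ab_zone v n j" using h2(2) z by blast
  then obtain i3 g where g: "(i3, g) \<in> iter ab_rule n j" "h2 ` ab_tile i2 = (\<lambda>x. v + g x) ` ab_tile i3" by (rule ab_zoneE)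
  obtain d3 where d3: "(i2', d3) \<in> set (quarters i3)"
      "(h2 \<circ> mact d2) ` dual_tile i2' = ((\<lambda>x. v + g x) \<circ> mact d3) ` dual_tile i2'"
    using same_tile_same_quarters[OF isom_iter_translate[OF g(1)] h2(1) g(2)[symmetric] h2(3)] .
  have "t = h2 ` ab_tile i2"
    unfolding t g(2) by (rule good_shared_quarter[OF good' g(1) d d3(1) trans[OF h2(4) d3(2)]])
  then show "t \<in> T" using h2(2) P(2) by blast
next
  fix t assume "t \<in> T"
  then show "t \<in> merge (quarter T)" by (rule tile_in_merge_quarter[OF T])
qed

section \<open>Local rules\<close>

lemma patch_shift:
  assumes "patch T r x = patch T' r y" "t \<in> T" "t \<inter> cball x r \<noteq> {}"
  shows "(+) (y - x) ` t \<in> T'"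
proof -
  have "(+) (- x) ` t \<in> patch T r x" using assms(2,3) unfolding patch_def translate_tiles_def by blast
  then have "(+) (- x) ` t \<in> patch T' r y" by (simp only: assms(1))
  then obtain t' where t': "t' \<in> T'" "(+) (- x) ` t = (+) (- y) ` t'"
    unfolding patch_def translate_tiles_def by blast
  have "(+) y ` (+) (- y) ` t' = t'" by (simp add: image_image)
  moreover have "(+) y ` (+) (- x) ` t = (+) (y - x) ` t" by (simp add: image_image algebra_simps)
  ultimately show ?thesis using t' by simp
qed

text \<open>The condition in \<open>local_rule\<close> is symmetric in the two tilings, so
  transporting tiles in one direction suffices.\<close>

lemma local_ruleI:
  assumes "r > 0"
    and shift: "\<And>T T' x y u. T \<in> A \<Longrightarrow> T' \<in> A \<Longrightarrow> patch T r x = patch T' r y \<Longrightarrow> u \<in> \<Phi> T \<Longrightarrow> x \<in> u \<Longrightarrow> (+) (y - x) ` u \<in> \<Phi> T'"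
  shows "local_rule A \<Phi>"
  unfolding local_rule_def
proof (intro exI[of _ r] conjI ballI allI impI)
  have sub: "patch (\<Phi> T) 0 x \<subseteq> patch (\<Phi> T') 0 y"
    if T: "T \<in> A" "T' \<in> A" "patch T r x = patch T' r y" for T T' x y
  proof
    fix s assume "s \<in> patch (\<Phi> T) 0 x"
    then obtain u where u: "u \<in> \<Phi> T" "x \<in> u" "s = (+) (- x) ` u" unfolding patch_def translate_tiles_def by auto
    have "(+) (y - x) ` u \<in> \<Phi> T'" by (rule shift[OF T u(1,2)])
    moreover have "y \<in> (+) (y - x) ` u" by (rule image_eqI[OF _ u(2)]) simp
    moreover have "s = (+) (- y) ` (+) (y - x) ` u" unfolding u(3) image_image by simp
    ultimately show "s \<in> patch (\<Phi> T') 0 y" unfolding patch_def translate_tiles_def by auto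
  qed
  fix T T' x y assume "T \<in> A" "T' \<in> A" "patch T r x = patch T' r y"
  then show "patch (\<Phi> T) 0 x = patch (\<Phi> T') 0 y" by (intro equalityI sub) simp_all
qed (rule assms(1))

lemma isom_shift:
  assumes "h \<in> isom"
  obtains h' where "h' \<in> isom" "\<And>S. (+) v ` h ` S = h' ` S"
    "\<And>g (S :: complex set). (+) v ` (h \<circ> g) ` S = (h' \<circ> g) ` S"
  by (rule that[of "\<lambda>x. v + h x"]) (simp_all add: isom_translate assms image_image)

lemma local_rule_quarter: "local_rule A quarter"
\<comment> \<open>Any positive radius would do, since a quarter containing \<open>x\<close> lies in
  a tile containing \<open>x\<close>.\<close>
proof (rule local_ruleI[of 1])
  fix T T' x y u assume p: "patch T 1 x = patch T' 1 y" and u: "u \<in> quarter T" "x \<in> u"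
  obtain i h i' d where h: "h \<in> isom" "h ` ab_tile i \<in> T" "(i', d) \<in> set (quarters i)"
    "u = (h \<circ> mact d) ` dual_tile i'"
    using u(1) unfolding quarter_def by blast
  obtain h' where h': "h' \<in> isom" "\<And>S. (+) (y - x) ` h ` S = h' ` S" 
      "\<And>g (S :: complex set). (+) (y - x) ` (h \<circ> g) ` S = (h' \<circ> g) ` S"
    using isom_shift[OF h(1)] by blast
  have "x \<in> h ` ab_tile i" using u(2) dual_tile_in_ab_tile[OF h(3), of h] unfolding h(4) by blast
  then have "h ` ab_tile i \<inter> cball x 1 \<noteq> {}" by (metis IntI centre_in_cball empty_iff zero_le_one)
  then have "h' ` ab_tile i \<in> T'" unfolding h'(2)[symmetric] by (rule patch_shift[OF p h(2)])
  then show "(+) (y - x) ` u \<in> quarter T'"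
    unfolding h(4) h'(3) quarter_def using h'(1) h(3) by blast
qed simp

lemma local_rule_merge: "local_rule A merge"
proof -
  \<comment> \<open>The radius bounds the distance from any point of a tile to the sample points of
    its witnesses, so the disc around a point of the tile meets all dual tiles on which the tile
    depends.\<close>
  let ?S = "\<Union>i. ab_tile i \<union> samples"
  have "bounded ?S"
    using finite_proto compact_ab_tile finite_samples by (auto intro!: bounded_UN simp: compact_imp_bounded finite_imp_bounded)
  then obtain r where r: "\<And>a b. a \<in> ?S \<Longrightarrow> b \<in> ?S \<Longrightarrow> dist a b \<le> r" unfolding bounded_two_points by blast
  show ?thesis
  proof (rule local_ruleI[of "max r 1"])
    fix T T' x y u assume p: "patch T (max r 1) x = patch T' (max r 1) y" and u: "u \<in> merge T" "x \<in> u"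
    obtain i h where h: "u = h ` ab_tile i" and good: "good T i h" using u(1) unfolding merge_def by blast
    have iso: "h \<in> isom" using good unfolding good_def by blast
    obtain h' where h': "h' \<in> isom" "\<And>S. (+) (y - x) ` h ` S = h' ` S" 
      "\<And>g (S :: complex set). (+) (y - x) ` (h \<circ> g) ` S = (h' \<circ> g) ` S"
      using isom_shift[OF iso] by blast
    obtain a where a: "a \<in> ab_tile i" "x = h a" using u(2) h by blast
    have "(h' \<circ> mact w) ` dual_tile i' \<in> T'" if w: "(i', w) \<in> set (wits i)" for i' w
    proof -
      let ?q = "mact w (den (inner_pt i'))"
      have "dist a ?q \<le> r" using in_samples[OF w] a(1) by (intro r) auto
      then have "dist x (h ?q) \<le> max r 1" unfolding a(2) isom_dist[OF iso] by simp
      then have "h ?q \<in> cball x (max r 1)" by simp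
      moreover have "den (inner_pt i') \<in> dual_tile i'" using inner_pt_interior interior_subset by blast
      then have "h ?q \<in> (h \<circ> mact w) ` dual_tile i'" by (simp only: image_comp[symmetric] imageI)
      ultimately have "(h \<circ> mact w) ` dual_tile i' \<inter> cball x (max r 1) \<noteq> {}" by blast
      moreover have "(h \<circ> mact w) ` dual_tile i' \<in> T" using good w unfolding good_def by blast
      ultimately show ?thesis unfolding h'(3)[symmetric] by (intro patch_shift[OF p])
    qed
    then have "good T' i h'" unfolding good_def using h'(1) by blast
    then show "(+) (y - x) ` u \<in> merge T'" unfolding h h'(2) merge_def by blast
  qed simp
qed

theorem theorem3p2:
  shows "\<exists>c>0. mutually_locally_derivable
     (scale_tiles c ` substitution_tilings (star_dual ammann_beenker))
     (substitution_tilings ammann_beenker)"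
proof (intro exI[of _ "lam ^ 2"] conjI)
  show "lam ^ 2 > 0" by simp
  let ?A = "hull_of dual_tile dual_rule" and ?B = "hull_of ab_tile ab_rule"
  have bij: "bij_betw merge ?A ?B"
    by (rule bij_betw_byWitness[of _ quarter]) (auto simp: quarter_merge merge_quarter merge_in_hull quarter_in_hull)
  have "inv_into ?A merge T = quarter T" if "T \<in> ?B" for T
  proof -
    have "inv_into ?A merge (merge (quarter T)) = quarter T"
      by (rule inv_into_f_f[OF bij_betw_imp_inj_on[OF bij] quarter_in_hull[OF that]])
    then show ?thesis by (simp only: merge_quarter[OF that])
  qed
  then have "local_rule ?B (inv_into ?A merge)"
    using local_rule_quarter[of ?B] unfolding local_rule_def by simp
  with bij local_rule_merge[of ?A] show "mutually_locally_derivable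
     (scale_tiles (lam ^ 2) ` substitution_tilings (star_dual ammann_beenker))
     (substitution_tilings ammann_beenker)"
    unfolding mutually_locally_derivable_def hull_ab hull_dual by blast
qed

end
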